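(* Let $v\le w$ in $S_n$ and assume that the closed Richardson variety $\overline{R}_{v,w}$ is toric; put $d=\ell(w)-\ell(v)$. Then the moment polytope $\widehat{P}(v,w)\subset\mathbb{R}^d$ is the Minkowski sum of affine transformations of the positroid polytopes indexed by the plabic graphs $G_k(v,w)$: for each $k=1,\dots,n-1$ there is an affine map $\varphi_k:\mathbb{R}^n\to\mathbb{R}^d$ such that $$\widehat{P}(v,w)=\sum_{k=1}^{n-1}\varphi_k\big(P_k(v,w)\big).$$
   Context: All varieties are over $\mathbb{C}$. Let $B,B_-\subset \mathrm{SL}(n)$ be the upper and lower triangular subgroups and $\mathrm{Fl}(n)=\mathrm{SL}(n)/B$; the coset $MB$ corresponds to the flag whose $k$-th subspace is spanned by the first $k$ columns of $M$. For $v\le w$ in Bruhat order on $S_n$, $R_{v,w}=(BwB/B)\cap(B_-vB/B)$ is the open Richardson variety (permutations are represented by matrices sending $e_i$ to $\pm e_{v(i)}$), and $\overline{R}_{v,w}$ is its Zariski closure. $\overline{R}_{v,w}$ is toric if some torus acts on it with an open orbit; this happens if and only if $R_{v,w}$ is isomorphic to a torus, and then the torus is $\mathbb{T}_{v,w}$, i.e. $R_{v,w}$ with a fixed choice of coordinates $x_1,\dots,x_d$, acting on $R_{v,w}$ by multiplication and on $\overline R_{v,w}$ by extension. For $I\subset\{1,\dots,n\}$, $|I|=k$, the flag minor $\Delta_I(M)$ is the minor of $M$ in rows $I$ and the first $k$ columns. Let $\mathcal{M}_k(v,w)$ be the set of $k$-subsets $I$ such that $\Delta_I$ is not identically zero on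 $R_{v,w}$; equivalently $\mathcal{M}_k(v,w)=\{u[k]: v\le u\le w\}$ with $u[k]=\{u(1),\dots,u(k)\}$. It is a positroid, and $G_k(v,w)$ denotes the corresponding reduced plabic graph (unique up to equivalence under Postnikov's bijection between positroids and equivalence classes of reduced plabic graphs). The positroid polytope indexed by $G_k(v,w)$ is $P_k(v,w)=\mathrm{Conv}(e_I: I\in\mathcal{M}_k(v,w))\subset\mathbb{R}^n$, $e_I=\sum_{i\in I}e_i$. Choose representative matrices $M(x)$ depending regularly on $x\in R_{v,w}$. When $R_{v,w}$ is a torus, for $I\in\mathcal M_k(v,w)$ the function $\Delta_I$ is a nonzero constant times a Laurent monomial $x^{m_I}$, $m_I\in\mathbb{Z}^d$. The moment polytope $\widehat{P}(v,w)$ is taken with respect to the embedding $\overline{R}_{v,w}\hookrightarrow\prod_{k=1}^{n-1}\mathbb{P}^{\binom nk-1}\hookrightarrow\mathbb{P}^N$ (Plücker, then Segre): it is the convex hull of the exponent vectors of the homogeneous coordinates not identically zero, i.e. $\mathrm{Conv}(m_{I_1}+\dots+m_{I_{n-1}}: I_k\in\mathcal{M}_k(v,w))$, defined up to translation. *)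

theory Defs
  imports
    "HOL-Analysis.Convex"
    "HOL-Library.Function_Algebras"
    "HOL-Library.Set_Algebras"
    "HOL-Library.Indicator_Function"
    "HOL-Combinatorics.Transposition"
    "Jordan_Normal_Form.Determinant"
begin

text \<open>
  All indices are 0-based: \<open>{1, \<dots>, n}\<close> becomes \<open>{..<n}\<close>, and permutations in \<open>S\<^sub>n\<close> are functions
  \<open>v\<close> with \<open>v permutes {..<n}\<close>.  Matrices are dimension-indexed (Jordan Normal Form library).
  Vectors in \<open>\<real>\<^sup>n\<close> are functions \<open>nat \<Rightarrow> real\<close> vanishing outside \<open>{..<n}\<close>, so that \<open>\<real>\<^sup>0\<close> is allowed and
  several dimensions live in one type.
\<close>

instantiation "fun" :: (type, real_vector) real_vector
begin

definition "scaleR r f = (\<lambda>x. r *\<^sub>R f x)"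

instance
  by standard
    (simp_all add: scaleR_fun_def fun_eq_iff scaleR_add_right scaleR_add_left)

end

definition real_space :: "nat \<Rightarrow> (nat \<Rightarrow> real) set" where
  "real_space n = {x. \<forall>i\<ge>n. x i = 0}"

definition affine_map :: "nat \<Rightarrow> nat \<Rightarrow> ((nat \<Rightarrow> real) \<Rightarrow> nat \<Rightarrow> real) \<Rightarrow> bool" where
  "affine_map n d \<phi> \<longleftrightarrow>
    (\<exists>A b. \<forall>x\<in>real_space n. \<phi> x = (\<lambda>i. if i < d then (\<Sum>j<n. A i j * x j) + b i else 0))"


section \<open>Varieties as quotients of quasi-affine sets\<close>

text \<open>The algebra \<open>\<complex>[G]\<close> of functions generated by a set \<open>G\<close> of coordinate functions.\<close>

inductive_set gen_algebra :: "('a \<Rightarrow> complex) set \<Rightarrow> ('a \<Rightarrow> complex) set" for G where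
  const: "(\<lambda>_. c) \<in> gen_algebra G"
| gen: "f \<in> G \<Longrightarrow> f \<in> gen_algebra G"
| add: "f \<in> gen_algebra G \<Longrightarrow> g \<in> gen_algebra G \<Longrightarrow> (\<lambda>y. f y + g y) \<in> gen_algebra G"
| mult: "f \<in> gen_algebra G \<Longrightarrow> g \<in> gen_algebra G \<Longrightarrow> (\<lambda>y. f y * g y) \<in> gen_algebra G"

text \<open>Regular functions on a locally closed subset \<open>Y\<close> of the affine space with coordinates \<open>G\<close>:
  locally quotients of polynomials.\<close>

definition regular_on :: "('a \<Rightarrow> complex) set \<Rightarrow> 'a set \<Rightarrow> ('a \<Rightarrow> complex) \<Rightarrow> bool" where
  "regular_on G Y f \<longleftrightarrow>
    (\<forall>y\<^sub>0\<in>Y. \<exists>P\<in>gen_algebra G. \<exists>Q\<in>gen_algebra G.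
      Q y\<^sub>0 \<noteq> 0 \<and> (\<forall>y\<in>Y. Q y \<noteq> 0 \<longrightarrow> f y = P y / Q y))"

definition zariski_open :: "('a \<Rightarrow> complex) set \<Rightarrow> 'a set \<Rightarrow> 'a set \<Rightarrow> bool" where
  "zariski_open G Y U \<longleftrightarrow> (\<exists>S\<subseteq>gen_algebra G. U = {y\<in>Y. \<exists>P\<in>S. P y \<noteq> 0})"

text \<open>
  A variety is presented by a locally closed set \<open>cover\<close> in an affine space with coordinates
  \<open>coords\<close>, together with a quotient map \<open>proj\<close> onto the points of the variety; a subset is
  open, and a function on an open subset is regular, iff its pullback along \<open>proj\<close> is.
  Below \<open>proj\<close> is the identity, the quotient map \<open>SL(n) \<rightarrow> SL(n)/B\<close> over a locally closed subset,
  or a product of these; since \<open>SL(n) \<rightarrow> SL(n)/B\<close> is Zariski-locally trivial, this yields the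
  usual topology and the usual sheaf of regular functions.
\<close>

record ('a, 'b) variety =
  coords :: "('a \<Rightarrow> complex) set"
  cover :: "'a set"
  proj :: "'a \<Rightarrow> 'b"

definition points :: "('a, 'b) variety \<Rightarrow> 'b set" where
  "points X = proj X ` cover X"

definition lift_set :: "('a, 'b) variety \<Rightarrow> 'b set \<Rightarrow> 'a set" where
  "lift_set X U = {y \<in> cover X. proj X y \<in> U}"

definition open_in :: "('a, 'b) variety \<Rightarrow> 'b set \<Rightarrow> bool" where
  "open_in X U \<longleftrightarrow> U \<subseteq> points X \<and> zariski_open (coords X) (cover X) (lift_set X U)"

definition closed_in :: "('a, 'b) variety \<Rightarrow> 'b set \<Rightarrow> bool" where
  "closed_in X Z \<longleftrightarrow> Z \<subseteq> points X \<and> open_in X (points X - Z)"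

definition regular_fun :: "('a, 'b) variety \<Rightarrow> 'b set \<Rightarrow> ('b \<Rightarrow> complex) \<Rightarrow> bool" where
  "regular_fun X U f \<longleftrightarrow> regular_on (coords X) (lift_set X U) (\<lambda>y. f (proj X y))"

definition morphism :: "('a, 'b) variety \<Rightarrow> ('c, 'd) variety \<Rightarrow> ('b \<Rightarrow> 'd) \<Rightarrow> bool" where
  "morphism X X' \<phi> \<longleftrightarrow>
    \<phi> ` points X \<subseteq> points X' \<and>
    (\<forall>U. open_in X' U \<longrightarrow>
      open_in X {p \<in> points X. \<phi> p \<in> U} \<and>
      (\<forall>f. regular_fun X' U f \<longrightarrow> regular_fun X {p \<in> points X. \<phi> p \<in> U} (\<lambda>p. f (\<phi> p))))"

definition isomorphism :: "('a, 'b) variety \<Rightarrow> ('c, 'd) variety \<Rightarrow> ('b \<Rightarrow> 'd) \<Rightarrow> bool" where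
  "isomorphism X X' \<phi> \<longleftrightarrow>
    bij_betw \<phi> (points X) (points X') \<and> morphism X X' \<phi> \<and>
    morphism X' X (inv_into (points X) \<phi>)"


section \<open>The torus\<close>

text \<open>\<open>(\<complex>\<^sup>*)\<^sup>d\<close>, a group under pointwise multiplication with neutral element \<open>\<lambda>_. 1\<close>.\<close>

definition torus :: "nat \<Rightarrow> (nat \<Rightarrow> complex) set" where
  "torus d = {x. (\<forall>i<d. x i \<noteq> 0) \<and> (\<forall>i\<ge>d. x i = 1)}"

definition torus_var :: "nat \<Rightarrow> (nat \<Rightarrow> complex, nat \<Rightarrow> complex) variety" where
  "torus_var d = \<lparr>coords = {\<lambda>x. x i |i. i < d}, cover = torus d, proj = (\<lambda>x. x)\<rparr>"

definition int_space :: "nat \<Rightarrow> (nat \<Rightarrow> int) set" where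
  "int_space d = {m. \<forall>i\<ge>d. m i = 0}"

definition monomial :: "nat \<Rightarrow> (nat \<Rightarrow> int) \<Rightarrow> (nat \<Rightarrow> complex) \<Rightarrow> complex" where
  "monomial d m x = (\<Prod>i<d. x i powi m i)"

text \<open>The exponent vector of a function that is a nonzero constant times a Laurent monomial.\<close>

definition exponent :: "nat \<Rightarrow> ((nat \<Rightarrow> complex) \<Rightarrow> complex) \<Rightarrow> nat \<Rightarrow> int" where
  "exponent d f =
    (THE m. m \<in> int_space d \<and> (\<exists>c. c \<noteq> 0 \<and> (\<forall>x\<in>torus d. f x = c * monomial d m x)))"


section \<open>The flag variety and Richardson varieties\<close>

definition SL :: "nat \<Rightarrow> complex mat set" where
  "SL n = {A \<in> carrier_mat n n. det A = 1}"

definition Borel :: "nat \<Rightarrow> complex mat set" where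
  "Borel n = {A \<in> SL n. \<forall>i<n. \<forall>j<n. j < i \<longrightarrow> A $$ (i, j) = 0}"

definition Borel_opp :: "nat \<Rightarrow> complex mat set" where
  "Borel_opp n = {A \<in> SL n. \<forall>i<n. \<forall>j<n. i < j \<longrightarrow> A $$ (i, j) = 0}"

text \<open>The coset \<open>MB\<close>.\<close>

definition flag :: "nat \<Rightarrow> complex mat \<Rightarrow> complex mat set" where
  "flag n M = {M * b |b. b \<in> Borel n}"

definition Fl :: "nat \<Rightarrow> complex mat set set" where
  "Fl n = flag n ` SL n"

text \<open>Matrices in \<open>SL(n)\<close> sending \<open>e\<^sub>i\<close> to \<open>\<plusminus>e\<^bsub>v(i)\<^esub>\<close>; the double cosets below do not depend on the signs.\<close>

definition perm_mats :: "nat \<Rightarrow> (nat \<Rightarrow> nat) \<Rightarrow> complex mat set" where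
  "perm_mats n v = {A \<in> SL n. \<forall>i<n. \<forall>j<n.
     (if i = v j then A $$ (i, j) \<in> {1, -1} else A $$ (i, j) = 0)}"

definition schubert_cell :: "nat \<Rightarrow> (nat \<Rightarrow> nat) \<Rightarrow> complex mat set set" where
  "schubert_cell n w =
    {flag n (b * p * b') |b p b'. b \<in> Borel n \<and> p \<in> perm_mats n w \<and> b' \<in> Borel n}"

definition opp_schubert_cell :: "nat \<Rightarrow> (nat \<Rightarrow> nat) \<Rightarrow> complex mat set set" where
  "opp_schubert_cell n v =
    {flag n (b * p * b') |b p b'. b \<in> Borel_opp n \<and> p \<in> perm_mats n v \<and> b' \<in> Borel n}"

definition richardson :: "nat \<Rightarrow> (nat \<Rightarrow> nat) \<Rightarrow> (nat \<Rightarrow> nat) \<Rightarrow> complex mat set set" where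
  "richardson n v w = schubert_cell n w \<inter> opp_schubert_cell n v"

definition entries :: "nat \<Rightarrow> (complex mat \<Rightarrow> complex) set" where
  "entries n = {\<lambda>A. A $$ (i, j) |i j. i < n \<and> j < n}"

text \<open>A locally closed subset \<open>X\<close> of \<open>Fl(n)\<close> as a variety, and its product with a torus.\<close>

definition flag_var :: "nat \<Rightarrow> complex mat set set \<Rightarrow> (complex mat, complex mat set) variety" where
  "flag_var n X =
    \<lparr>coords = entries n, cover = {A \<in> SL n. flag n A \<in> X}, proj = flag n\<rparr>"

definition torus_flag_var :: "nat \<Rightarrow> nat \<Rightarrow> complex mat set set \<Rightarrow>
    ((nat \<Rightarrow> complex) \<times> complex mat, (nat \<Rightarrow> complex) \<times> complex mat set) variety" where
  "torus_flag_var m n X =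
    \<lparr>coords = {\<lambda>(t, A). t i |i. i < m} \<union> {\<lambda>(t, A). f A |f. f \<in> entries n},
     cover = torus m \<times> {A \<in> SL n. flag n A \<in> X},
     proj = (\<lambda>(t, A). (t, flag n A))\<rparr>"

definition closed_richardson :: "nat \<Rightarrow> (nat \<Rightarrow> nat) \<Rightarrow> (nat \<Rightarrow> nat) \<Rightarrow> complex mat set set" where
  "closed_richardson n v w =
    \<Inter> {Z. closed_in (flag_var n (Fl n)) Z \<and> richardson n v w \<subseteq> Z}"


section \<open>Toric Richardson varieties\<close>

definition torus_action ::
    "nat \<Rightarrow> nat \<Rightarrow> complex mat set set \<Rightarrow>
     ((nat \<Rightarrow> complex) \<Rightarrow> complex mat set \<Rightarrow> complex mat set) \<Rightarrow> bool" where
  "torus_action m n X a \<longleftrightarrow>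
    morphism (torus_flag_var m n X) (flag_var n X) (\<lambda>(t, p). a t p) \<and>
    (\<forall>p\<in>X. a (\<lambda>_. 1) p = p) \<and>
    (\<forall>s\<in>torus m. \<forall>t\<in>torus m. \<forall>p\<in>X. a (\<lambda>i. s i * t i) p = a s (a t p))"

definition toric :: "nat \<Rightarrow> complex mat set set \<Rightarrow> bool" where
  "toric n X \<longleftrightarrow>
    (\<exists>m a. torus_action m n X a \<and> (\<exists>p\<in>X. open_in (flag_var n X) {a t p |t. t \<in> torus m}))"

text \<open>
  The torus \<open>\<T>\<^bsub>v,w\<^esub>\<close>: \<open>\<psi>\<close> is the inverse of a choice of coordinates identifying the open
  Richardson variety with \<open>(\<complex>\<^sup>*)\<^sup>d\<close>, which acts on the open Richardson variety by multiplication
  of the coordinates and on its closure by extension.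
\<close>

definition richardson_torus ::
    "nat \<Rightarrow> (nat \<Rightarrow> nat) \<Rightarrow> (nat \<Rightarrow> nat) \<Rightarrow> nat \<Rightarrow> ((nat \<Rightarrow> complex) \<Rightarrow> complex mat set) \<Rightarrow> bool" where
  "richardson_torus n v w d \<psi> \<longleftrightarrow>
    isomorphism (torus_var d) (flag_var n (richardson n v w)) \<psi> \<and>
    (\<exists>a. torus_action d n (closed_richardson n v w) a \<and>
         (\<forall>s\<in>torus d. \<forall>x\<in>torus d. a s (\<psi> x) = \<psi> (\<lambda>i. s i * x i)))"

text \<open>Representative matrices of the points of the open Richardson variety, with entries regular
  in the coordinates.\<close>

definition regular_representatives ::
    "nat \<Rightarrow> nat \<Rightarrow> ((nat \<Rightarrow> complex) \<Rightarrow> complex mat set) \<Rightarrow> ((nat \<Rightarrow> complex) \<Rightarrow> complex mat) \<Rightarrow> bool" where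
  "regular_representatives n d \<psi> M \<longleftrightarrow>
    (\<forall>x\<in>torus d. M x \<in> SL n \<and> flag n (M x) = \<psi> x) \<and>
    (\<forall>i<n. \<forall>j<n. regular_fun (torus_var d) (torus d) (\<lambda>x. M x $$ (i, j)))"


section \<open>Bruhat order\<close>

definition perm_length :: "nat \<Rightarrow> (nat \<Rightarrow> nat) \<Rightarrow> nat" where
  "perm_length n u = card {(i, j). i < j \<and> j < n \<and> u j < u i}"

definition bruhat_step :: "nat \<Rightarrow> (nat \<Rightarrow> nat) \<Rightarrow> (nat \<Rightarrow> nat) \<Rightarrow> bool" where
  "bruhat_step n u u' \<longleftrightarrow>
    (\<exists>i j. i < j \<and> j < n \<and> u' = u \<circ> Transposition.transpose i j) \<and> perm_length n u < perm_length n u'"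

definition bruhat_le :: "nat \<Rightarrow> (nat \<Rightarrow> nat) \<Rightarrow> (nat \<Rightarrow> nat) \<Rightarrow> bool" where
  "bruhat_le n v w \<longleftrightarrow> v permutes {..<n} \<and> w permutes {..<n} \<and> (bruhat_step n)\<^sup>*\<^sup>* v w"


section \<open>Flag minors and polytopes\<close>

definition flag_minor :: "nat set \<Rightarrow> complex mat \<Rightarrow> complex" where
  "flag_minor I A =
    det (mat (card I) (card I) (\<lambda>(i, j). A $$ (sorted_list_of_set I ! i, j)))"

definition richardson_matroid :: "nat \<Rightarrow> (nat \<Rightarrow> nat) \<Rightarrow> (nat \<Rightarrow> nat) \<Rightarrow> nat \<Rightarrow> nat set set" where
  "richardson_matroid n v w k =
    {I. I \<subseteq> {..<n} \<and> card I = k \<and>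
        (\<exists>A\<in>SL n. flag n A \<in> richardson n v w \<and> flag_minor I A \<noteq> 0)}"

text \<open>The polytope of the positroid \<open>\<M>\<^sub>k(v, w)\<close>.  Under Postnikov's bijection between
  positroids and equivalence classes of reduced plabic graphs this is the polytope indexed by
  \<open>G\<^sub>k(v, w)\<close>.\<close>

definition positroid_polytope ::
    "nat \<Rightarrow> (nat \<Rightarrow> nat) \<Rightarrow> (nat \<Rightarrow> nat) \<Rightarrow> nat \<Rightarrow> (nat \<Rightarrow> real) set" where
  "positroid_polytope n v w k = convex hull {indicator I |I. I \<in> richardson_matroid n v w k}"

definition moment_polytope ::
    "nat \<Rightarrow> (nat \<Rightarrow> nat) \<Rightarrow> (nat \<Rightarrow> nat) \<Rightarrow> nat \<Rightarrow> ((nat \<Rightarrow> complex) \<Rightarrow> complex mat) \<Rightarrow> (nat \<Rightarrow> real) set" where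
  "moment_polytope n v w d M =
    convex hull
      {(\<lambda>i. \<Sum>k=1..n-1. real_of_int (exponent d (\<lambda>x. flag_minor (I k) (M x)) i)) |I.
        \<forall>k\<in>{1..n-1}. I k \<in> richardson_matroid n v w k}"

end

theory Submission
  imports
    Defs
    "HOL-Computational_Algebra.Field_as_Ring"
    "HOL-Computational_Algebra.Fundamental_Theorem_Algebra"
begin

text \<open>
  Fix coordinates \<open>x\<close> on the open Richardson variety \<open>R\<close>.  Everything rests on one fact about the
  exponents \<open>m\<^sub>I\<close> of the flag minors of a fixed size \<open>k\<close>: they depend affinely on the indicator
  vectors \<open>e\<^sub>I\<close>, that is, \<open>m\<^sub>I = b + (\<Sum>j\<in>I. g\<^sub>j)\<close> for suitable vectors \<open>b\<close> and \<open>g\<^sub>j\<close>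
  (\<open>minor_exponents_affine\<close>).  The affine map \<open>\<phi>\<^sub>k\<close> with linear part \<open>e\<^sub>j \<mapsto> g\<^sub>j\<close> and translation \<open>b\<close>
  then carries the vertices of the positroid polytope to the exponents of the minors of size \<open>k\<close>.
  Convex hulls commute with affine maps and with Minkowski sums, and the exponents of the Segre
  coordinates are the sums of one exponent for each \<open>k\<close>.

  The first step is that every flag minor is either identically zero on \<open>R\<close> or a nonzero constant
  times a Laurent monomial.  A nowhere vanishing regular function on a torus is a monomial up to a
  constant (\<open>unit_torus_monomial\<close>), so a minor \<open>\<Delta>\<^sub>I\<close> that is nonzero at one point of \<open>R\<close> has
  to be shown to be nonzero at all of them (\<open>minor_nonvanishing\<close>).  The diagonal matrices act on \<open>R\<close>,
  and since \<open>R\<close> is a torus they act by translations (\<open>cocharacter\<close>); hence they commute with the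
  action of the torus \<open>\<T>\<close> on the closure of \<open>R\<close>.  Choose a one-parameter group \<open>D(t)\<close> of diagonal
  matrices for which \<open>I\<close> is the unique \<open>k\<close>-subset of least weight.  If \<open>\<Delta>\<^sub>I\<close> does not vanish at
  \<open>p\<close>, then \<open>D(t) p\<close> converges for \<open>t \<rightarrow> 0\<close> to a point \<open>p\<^sub>0\<close> of the closure whose \<open>k\<close>-th
  subspace is the coordinate subspace of \<open>I\<close> (\<open>degeneration_curve\<close>).  For \<open>s\<close> in \<open>\<T>\<close> the point
  \<open>s p\<^sub>0\<close> is the limit of \<open>D(t) (s p)\<close>.  If some \<open>\<Delta>\<^sub>J\<close> of the same size with \<open>J \<noteq> I\<close> is nonzero at
  \<open>s p\<^sub>0\<close>, then \<open>\<Delta>\<^sub>I / \<Delta>\<^sub>J\<close>, which is a constant times a negative power of \<open>t\<close> along this curve, can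
  only be finite at the limit if \<open>\<Delta>\<^sub>I\<close> vanishes at \<open>s p\<close>.  As this condition on \<open>s\<close> is open, both the
  vanishing and the nonvanishing of \<open>\<Delta>\<^sub>I\<close> at \<open>s p\<close> are open conditions on \<open>s\<close>, and connectedness
  decides.

  The second step is linear algebra.  Normalise the \<open>n \<times> k\<close> matrix of the first \<open>k\<close> columns so that the
  rows in a basis form the identity.  Its entries are quotients of minors, hence zero or monomial,
  and so are all its minors.  Consider the bipartite graph of the nonzero entries.  The minor
  supported on an induced cycle has exactly two nonzero terms (\<open>det_cycle\<close>), and a sum of two
  monomials is zero or monomial only if their exponents agree.  So the alternating sum of the entry
  exponents vanishes on induced cycles, which is enough for a potential to exist
  (\<open>exists_potential\<close>): the exponent of the entry \<open>(i, l)\<close> is \<open>g\<^sub>i - h\<^sub>l\<close>.  The matrix is therefore a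
  constant matrix with rows and columns scaled by monomials, so that the exponents of its minors
  are sums of row potentials up to a common constant.
\<close>

section \<open>Regular functions\<close>

lemma regular_onI_global:
  assumes "P \<in> gen_algebra G" "Q \<in> gen_algebra G" "\<And>y. y \<in> Y \<Longrightarrow> Q y \<noteq> 0"
    "\<And>y. y \<in> Y \<Longrightarrow> f y = P y / Q y"
  shows "regular_on G Y f"
  unfolding regular_on_def
  by (rule ballI, rule bexI[OF _ assms(1)], rule bexI[OF _ assms(2)]) (use assms(3,4) in simp)

lemma regular_on_gen_algebra: "P \<in> gen_algebra G \<Longrightarrow> regular_on G Y P"
  by (rule regular_onI_global[of P G "\<lambda>_. 1"]) (auto intro: gen_algebra.const)

lemma regular_on_cong:
  assumes "\<And>y. y \<in> Y \<Longrightarrow> f y = g y"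
  shows "regular_on G Y f \<longleftrightarrow> regular_on G Y g"
  unfolding regular_on_def by (simp add: assms cong: ball_cong)

lemma regular_onE:
  assumes "regular_on G Y f" "y \<in> Y"
  obtains P Q where "P \<in> gen_algebra G" "Q \<in> gen_algebra G" "Q y \<noteq> 0"
    "\<And>z. z \<in> Y \<Longrightarrow> Q z \<noteq> 0 \<Longrightarrow> f z = P z / Q z"
proof -
  have "\<exists>P\<in>gen_algebra G. \<exists>Q\<in>gen_algebra G.
      Q y \<noteq> 0 \<and> (\<forall>z\<in>Y. Q z \<noteq> 0 \<longrightarrow> f z = P z / Q z)"
    using assms(1)[unfolded regular_on_def] assms(2) by (rule bspec)
  then obtain P Q where 1: "P \<in> gen_algebra G" "Q \<in> gen_algebra G"
    and 2: "Q y \<noteq> 0" "\<forall>z\<in>Y. Q z \<noteq> 0 \<longrightarrow> f z = P z / Q z" by auto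
  show ?thesis by (rule that[OF 1 2(1)]) (use 2(2) in simp)
qed

lemma regular_on_add:
  assumes "regular_on G Y f" "regular_on G Y g"
  shows "regular_on G Y (\<lambda>y. f y + g y)"
  unfolding regular_on_def
proof
  fix y assume y: "y \<in> Y"
  obtain P Q where 1: "P \<in> gen_algebra G" "Q \<in> gen_algebra G" "Q y \<noteq> 0"
    "\<And>z. z \<in> Y \<Longrightarrow> Q z \<noteq> 0 \<Longrightarrow> f z = P z / Q z" using regular_onE[OF assms(1) y] by metis
  obtain P' Q' where 2: "P' \<in> gen_algebra G" "Q' \<in> gen_algebra G" "Q' y \<noteq> 0"
    "\<And>z. z \<in> Y \<Longrightarrow> Q' z \<noteq> 0 \<Longrightarrow> g z = P' z / Q' z" using regular_onE[OF assms(2) y] by metis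
  have "(\<lambda>z. P z * Q' z + P' z * Q z) \<in> gen_algebra G" "(\<lambda>z. Q z * Q' z) \<in> gen_algebra G"
    using 1 2 by (auto intro!: gen_algebra.add gen_algebra.mult)
  note 3 = this
  have 4: "Q y * Q' y \<noteq> 0" using 1 2 by auto
  have 5: "\<forall>z\<in>Y. Q z * Q' z \<noteq> 0 \<longrightarrow> f z + g z = (P z * Q' z + P' z * Q z) / (Q z * Q' z)"
    using 1(4) 2(4) by (simp add: add_frac_eq)
  show "\<exists>P\<in>gen_algebra G. \<exists>Q\<in>gen_algebra G.
      Q y \<noteq> 0 \<and> (\<forall>y\<in>Y. Q y \<noteq> 0 \<longrightarrow> f y + g y = P y / Q y)"
    by (rule bexI[OF _ 3(1)], rule bexI[OF _ 3(2)], rule conjI[OF 4 5])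
qed

lemma regular_on_mult:
  assumes "regular_on G Y f" "regular_on G Y g"
  shows "regular_on G Y (\<lambda>y. f y * g y)"
  unfolding regular_on_def
proof
  fix y assume y: "y \<in> Y"
  obtain P Q where 1: "P \<in> gen_algebra G" "Q \<in> gen_algebra G" "Q y \<noteq> 0"
    "\<And>z. z \<in> Y \<Longrightarrow> Q z \<noteq> 0 \<Longrightarrow> f z = P z / Q z" using regular_onE[OF assms(1) y] by metis
  obtain P' Q' where 2: "P' \<in> gen_algebra G" "Q' \<in> gen_algebra G" "Q' y \<noteq> 0"
    "\<And>z. z \<in> Y \<Longrightarrow> Q' z \<noteq> 0 \<Longrightarrow> g z = P' z / Q' z" using regular_onE[OF assms(2) y] by metis
  have "(\<lambda>z. P z * P' z) \<in> gen_algebra G" "(\<lambda>z. Q z * Q' z) \<in> gen_algebra G"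
    using 1 2 by (auto intro!: gen_algebra.add gen_algebra.mult)
  note 3 = this
  have 4: "Q y * Q' y \<noteq> 0" using 1 2 by auto
  have 5: "\<forall>z\<in>Y. Q z * Q' z \<noteq> 0 \<longrightarrow> f z * g z = P z * P' z / (Q z * Q' z)"
    using 1(4) 2(4) by simp
  show "\<exists>P\<in>gen_algebra G. \<exists>Q\<in>gen_algebra G.
      Q y \<noteq> 0 \<and> (\<forall>y\<in>Y. Q y \<noteq> 0 \<longrightarrow> f y * g y = P y / Q y)"
    by (rule bexI[OF _ 3(1)], rule bexI[OF _ 3(2)], rule conjI[OF 4 5])
qed

text \<open>The quotient of two local representations is not itself a local representation with the obvious
  denominator, since that denominator need not detect where the second representation is valid; the
  denominator is therefore multiplied by the one of the second representation.\<close>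

lemma regular_on_divide:
  assumes "regular_on G Y f" "regular_on G Y g" and nz: "\<And>y. y \<in> Y \<Longrightarrow> g y \<noteq> 0"
  shows "regular_on G Y (\<lambda>y. f y / g y)"
  unfolding regular_on_def
proof
  fix y assume y: "y \<in> Y"
  obtain P Q where 1: "P \<in> gen_algebra G" "Q \<in> gen_algebra G" "Q y \<noteq> 0"
    "\<And>z. z \<in> Y \<Longrightarrow> Q z \<noteq> 0 \<Longrightarrow> f z = P z / Q z" using regular_onE[OF assms(1) y] by metis
  obtain P' Q' where 2: "P' \<in> gen_algebra G" "Q' \<in> gen_algebra G" "Q' y \<noteq> 0"
    "\<And>z. z \<in> Y \<Longrightarrow> Q' z \<noteq> 0 \<Longrightarrow> g z = P' z / Q' z" using regular_onE[OF assms(2) y] by metis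
  have 3: "(\<lambda>z. P z * Q' z * Q' z) \<in> gen_algebra G" "(\<lambda>z. Q z * P' z * Q' z) \<in> gen_algebra G"
    using 1 2 by (auto intro!: gen_algebra.add gen_algebra.mult)
  have "P' y \<noteq> 0" using 2 nz[OF y] y by auto
  then have 4: "Q y * P' y * Q' y \<noteq> 0" using 1 2 by auto
  have 5: "\<forall>z\<in>Y. Q z * P' z * Q' z \<noteq> 0 \<longrightarrow> f z / g z = P z * Q' z * Q' z / (Q z * P' z * Q' z)"
  proof (intro ballI impI)
    fix z assume "z \<in> Y" and n: "Q z * P' z * Q' z \<noteq> 0"
    then have "f z = P z / Q z" "g z = P' z / Q' z" using 1 2 by auto
    then show "f z / g z = P z * Q' z * Q' z / (Q z * P' z * Q' z)" using n by simp
  qed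
  show "\<exists>P\<in>gen_algebra G. \<exists>Q\<in>gen_algebra G.
      Q y \<noteq> 0 \<and> (\<forall>y\<in>Y. Q y \<noteq> 0 \<longrightarrow> f y / g y = P y / Q y)"
    by (rule bexI[OF _ 3(1)], rule bexI[OF _ 3(2)], rule conjI[OF 4 5])
qed

lemma regular_on_const: "regular_on G Y (\<lambda>_. c)"
  by (rule regular_on_gen_algebra[OF gen_algebra.const])

lemma regular_on_gen: "f \<in> G \<Longrightarrow> regular_on G Y f"
  by (rule regular_on_gen_algebra[OF gen_algebra.gen])

lemma regular_on_powi:
  assumes "regular_on G Y f" and nz: "\<And>y. y \<in> Y \<Longrightarrow> f y \<noteq> 0"
  shows "regular_on G Y (\<lambda>y. f y powi m)"
proof -
  have pw: "regular_on G Y (\<lambda>y. f y ^ k)" for k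
    by (induction k) (auto intro!: regular_on_const regular_on_mult assms)
  show ?thesis
  proof (cases "m \<ge> 0")
    case True then show ?thesis using pw by (simp add: power_int_def)
  next
    case False
    have "regular_on G Y (\<lambda>y. 1 / f y ^ nat (- m))"
      by (rule regular_on_divide[OF regular_on_const pw]) (simp add: nz)
    then show ?thesis using False by (simp add: power_int_def field_simps)
  qed
qed

lemma gen_algebra_compose:
  assumes "P \<in> gen_algebra G" "\<And>c. c \<in> G \<Longrightarrow> regular_on H Z (\<lambda>z. c (g z))"
  shows "regular_on H Z (\<lambda>z. P (g z))"
  using assms by (induction) (auto intro!: regular_on_const regular_on_add regular_on_mult)

lemma regular_on_compose:
  assumes f: "regular_on G Y f" and g: "g ` Z \<subseteq> Y"
    and c: "\<And>c. c \<in> G \<Longrightarrow> regular_on H Z (\<lambda>z. c (g z))"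
  shows "regular_on H Z (\<lambda>z. f (g z))"
  unfolding regular_on_def
proof
  fix z assume z: "z \<in> Z"
  obtain P Q where 1: "P \<in> gen_algebra G" "Q \<in> gen_algebra G" "Q (g z) \<noteq> 0"
    "\<And>y. y \<in> Y \<Longrightarrow> Q y \<noteq> 0 \<Longrightarrow> f y = P y / Q y" using regular_onE[OF f] g z by (metis image_subset_iff)
  have "regular_on H Z (\<lambda>z. P (g z))" "regular_on H Z (\<lambda>z. Q (g z))"
    using gen_algebra_compose 1 c by metis+
  note PQ = this
  obtain P1 Q1 where 2: "P1 \<in> gen_algebra H" "Q1 \<in> gen_algebra H" "Q1 z \<noteq> 0"
    "\<And>y. y \<in> Z \<Longrightarrow> Q1 y \<noteq> 0 \<Longrightarrow> P (g y) = P1 y / Q1 y"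
    using regular_onE[OF PQ(1) z] by blast
  obtain P2 Q2 where den: "P2 \<in> gen_algebra H" "Q2 \<in> gen_algebra H" "Q2 z \<noteq> 0"
    "\<And>y. y \<in> Z \<Longrightarrow> Q2 y \<noteq> 0 \<Longrightarrow> Q (g y) = P2 y / Q2 y"
    using regular_onE[OF PQ(2) z] by blast
  note h2 = 2 den
  have 3: "(\<lambda>z. P1 z * Q2 z * Q2 z) \<in> gen_algebra H" "(\<lambda>z. Q1 z * P2 z * Q2 z) \<in> gen_algebra H"
    using h2 by (auto intro!: gen_algebra.mult)
  have 4: "Q1 z * P2 z * Q2 z \<noteq> 0" using 1(3) h2 z by auto
  have 5: "\<forall>y\<in>Z. Q1 y * P2 y * Q2 y \<noteq> 0 \<longrightarrow> f (g y) = P1 y * Q2 y * Q2 y / (Q1 y * P2 y * Q2 y)"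
  proof (intro ballI impI)
    fix y assume y: "y \<in> Z" and n: "Q1 y * P2 y * Q2 y \<noteq> 0"
    then have "Q (g y) = P2 y / Q2 y" "P (g y) = P1 y / Q1 y" using h2 by auto
    then show "f (g y) = P1 y * Q2 y * Q2 y / (Q1 y * P2 y * Q2 y)"
      using 1(4)[of "g y"] y g n by (auto simp: image_subset_iff)
  qed
  show "\<exists>P\<in>gen_algebra H. \<exists>Q\<in>gen_algebra H.
      Q z \<noteq> 0 \<and> (\<forall>y\<in>Z. Q y \<noteq> 0 \<longrightarrow> f (g y) = P y / Q y)"
    by (rule bexI[OF _ 3(1)], rule bexI[OF _ 3(2)], rule conjI[OF 4 5])
qed

lemma gen_algebra_continuous:
  assumes "P \<in> gen_algebra G" "\<And>c. c \<in> G \<Longrightarrow> continuous_on Z (\<lambda>z. c (g z))"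
  shows "continuous_on Z (\<lambda>z. P (g z))"
  using assms by (induction) (auto intro!: continuous_intros)

text \<open>Restricted to a curve with continuous coordinates, regular functions and Zariski open sets become
  continuous functions and open sets in the classical topology, so that limits along curves are
  elementary limits of complex functions.\<close>

lemma regular_on_continuous:
  fixes g :: "'z :: topological_space \<Rightarrow> 'a"
  assumes f: "regular_on G Y f" and g: "g ` Z \<subseteq> Y"
    and c: "\<And>c. c \<in> G \<Longrightarrow> continuous_on Z (\<lambda>z. c (g z))"
  shows "continuous_on Z (\<lambda>z. f (g z))"
  unfolding continuous_on_def
proof
  fix z assume z: "z \<in> Z"
  obtain P Q where 1: "P \<in> gen_algebra G" "Q \<in> gen_algebra G" "Q (g z) \<noteq> 0"
    "\<And>y. y \<in> Y \<Longrightarrow> Q y \<noteq> 0 \<Longrightarrow> f y = P y / Q y" using regular_onE[OF f] g z by (metis image_subset_iff)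
  have PQ: "continuous_on Z (\<lambda>z. P (g z))" "continuous_on Z (\<lambda>z. Q (g z))"
    using gen_algebra_continuous 1 c by metis+
  then have "((\<lambda>z. Q (g z)) \<longlongrightarrow> Q (g z)) (at z within Z)"
    using z by (simp add: continuous_on_def)
  then have ev: "\<forall>\<^sub>F y in at z within Z. Q (g y) \<noteq> 0"
    using 1(3) tendsto_imp_eventually_ne by blast
  have "((\<lambda>z. P (g z) / Q (g z)) \<longlongrightarrow> P (g z) / Q (g z)) (at z within Z)"
    using PQ z 1(3) by (auto simp: continuous_on_def intro!: tendsto_divide)
  moreover have "\<forall>\<^sub>F y in at z within Z. P (g y) / Q (g y) = f (g y)"
  proof -
    have "\<forall>\<^sub>F y in at z within Z. y \<in> Z" by (simp add: eventually_at_filter)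
    with ev show ?thesis by eventually_elim (use 1(4) g in \<open>simp add: image_subset_iff\<close>)
  qed
  ultimately have "((\<lambda>z. f (g z)) \<longlongrightarrow> P (g z) / Q (g z)) (at z within Z)"
    by (rule Lim_transform_eventually)
  moreover have "f (g z) = P (g z) / Q (g z)" using 1 g z by auto
  ultimately show "((\<lambda>z. f (g z)) \<longlongrightarrow> f (g z)) (at z within Z)" by simp
qed

lemma zariski_open_preimage_open:
  fixes g :: "'z :: topological_space \<Rightarrow> 'a"
  assumes U: "zariski_open G Y U" and Z: "open Z" "g ` Z \<subseteq> Y"
    and c: "\<And>c. c \<in> G \<Longrightarrow> continuous_on Z (\<lambda>z. c (g z))"
  shows "open {z\<in>Z. g z \<in> U}"
proof -
  obtain S where S: "S \<subseteq> gen_algebra G" "U = {y\<in>Y. \<exists>P\<in>S. P y \<noteq> 0}"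
    using U unfolding zariski_open_def by blast
  have "{z\<in>Z. g z \<in> U} = (\<Union>P\<in>S. {z\<in>Z. P (g z) \<noteq> 0})"
    using S(2) Z(2) by auto
  moreover have "open {z\<in>Z. P (g z) \<noteq> 0}" if "P \<in> S" for P
  proof -
    have "continuous_on Z (\<lambda>z. P (g z))"
      by (rule gen_algebra_continuous[OF subsetD[OF S(1) that]]) (rule c)
    then have "open ((\<lambda>z. P (g z)) -` (- {0}) \<inter> Z)"
      unfolding continuous_on_open_vimage[OF Z(1)] by (simp add: open_Compl)
    moreover have "(\<lambda>z. P (g z)) -` (- {0}) \<inter> Z = {z\<in>Z. P (g z) \<noteq> 0}" by auto
    ultimately show ?thesis by simp
  qed
  ultimately show ?thesis by auto
qed

section \<open>Nowhere vanishing functions on the torus\<close>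

lemma gen_algebra_univariate:
  assumes "P \<in> gen_algebra {\<lambda>z. z}"
  shows "\<exists>p. P = poly p"
  using assms
proof induction
  case (const c) show ?case by (rule exI[of _ "[:c:]"]) auto
next
  case (gen f) then show ?case by (intro exI[of _ "[:0,1:]"]) auto
next
  case (add f g) then obtain p q where "f = poly p" "g = poly q" by auto
  then show ?case by (intro exI[of _ "p+q"]) auto
next
  case (mult f g) then obtain p q where "f = poly p" "g = poly q" by auto
  then show ?case by (intro exI[of _ "p*q"]) auto
qed

lemma poly_without_nonzero_roots:
  fixes p :: "complex poly"
  assumes "p \<noteq> 0" "\<And>z. z \<noteq> 0 \<Longrightarrow> poly p z \<noteq> 0"
  shows "\<exists>c k. c \<noteq> 0 \<and> (\<forall>z. poly p z = c * z ^ k)"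
proof -
  obtain q where q: "p = [:0, 1:] ^ order 0 p * q" "\<not> [:0, 1:] dvd q"
    using order_decomp[OF assms(1), of 0] by auto
  have "poly q z \<noteq> 0" for z
  proof (cases "z = 0")
    case True
    then show ?thesis using q(2) by (metis dvd_iff_poly_eq_0 add.inverse_neutral) 
  next
    case False
    then show ?thesis using assms(2)[OF False] by (subst (asm) q(1)) auto
  qed
  then have "constant (poly q)" using fundamental_theorem_of_algebra[of q] by blast
  then obtain c where c: "\<And>z. poly q z = c" unfolding constant_def by metis
  then have "c \<noteq> 0" using \<open>\<And>z. poly q z \<noteq> 0\<close> by metis
  moreover have "poly p z = c * z ^ order 0 p" for z
    by (subst q(1)) (simp add: c)
  ultimately show ?thesis by blast
qed

text \<open>The function is globally a quotient of coprime polynomials.  A root of the denominator other than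
  \<open>0\<close> would be a pole, a root of the numerator other than \<open>0\<close> a zero; so both are monomials.\<close>

lemma unit_univariate:
  fixes F :: "complex \<Rightarrow> complex"
  assumes reg: "regular_on {\<lambda>z. z} (- {0}) F" and nz: "\<And>z. z \<noteq> 0 \<Longrightarrow> F z \<noteq> 0"
  shows "\<exists>m. \<forall>z. z \<noteq> 0 \<longrightarrow> F z = F 1 * z powi m"
proof -
  have loc: "\<exists>p q. poly q y \<noteq> 0 \<and> (\<forall>z. z \<noteq> 0 \<longrightarrow> poly q z \<noteq> 0 \<longrightarrow> F z = poly p z / poly q z)"
    if "y \<noteq> 0" for y
    using regular_onE[OF reg, of y] that gen_algebra_univariate
    by (metis ComplI singletonD)
  obtain p0 q0 where pq0: "poly q0 1 \<noteq> 0" "\<And>z. z \<noteq> 0 \<Longrightarrow> poly q0 z \<noteq> 0 \<Longrightarrow> F z = poly p0 z / poly q0 z"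
    using loc[of 1] by auto
  have "q0 \<noteq> 0" using pq0 by auto
  define h where "h = gcd p0 q0"
  obtain p q where pq: "p0 = p * h" "q0 = q * h" "coprime p q"
    using gcd_coprime_exists[of p0 q0] \<open>q0 \<noteq> 0\<close> unfolding h_def by (metis gcd_eq_0_iff)
  have "h \<noteq> 0" "q \<noteq> 0" using \<open>q0 \<noteq> 0\<close> pq by auto
  (* cross-multiplied: two local representations of F agree off finitely many points *)
  have cross: "p * q' = p' * q"
    if "q' \<noteq> 0" "\<And>z. z \<noteq> 0 \<Longrightarrow> poly q' z \<noteq> 0 \<Longrightarrow> F z = poly p' z / poly q' z" for p' q'
  proof -
    have z: "(p * q' - p' * q) * (q0 * q' * [:0,1:]) = 0"
    proof (rule poly_all_0_iff_0[THEN iffD1], rule allI)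
      fix z
      show "poly ((p * q' - p' * q) * (q0 * q' * [:0,1:])) z = 0"
      proof (cases "z = 0 \<or> poly q0 z = 0 \<or> poly q' z = 0")
        case True then show ?thesis by auto
      next
        case False
        then have "poly p0 z / poly q0 z = poly p' z / poly q' z" using pq0(2) that(2) by metis
        then have "poly p z * poly q' z = poly p' z * poly q z"
          using False pq by (auto simp: field_simps)
        then show ?thesis by simp
      qed
    qed
    then show ?thesis using that(1) \<open>q0 \<noteq> 0\<close> by auto
  qed
  have noroot: "\<not> (poly p z = 0 \<and> poly q z = 0)" for z
  proof
    assume "poly p z = 0 \<and> poly q z = 0"
    then have "[:- z, 1:] dvd p" "[:- z, 1:] dvd q" by (auto simp: poly_eq_0_iff_dvd)
    then have "is_unit [:- z, 1:]" using pq(3) coprime_common_divisor by blast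
    then show False by (auto simp: is_unit_poly_iff)
  qed
  have q_nz: "poly q z \<noteq> 0" if zz: "z \<noteq> 0" for z
  proof
    assume q0: "poly q z = 0"
    obtain p' q' where 1: "poly q' z \<noteq> 0" "\<And>y. y \<noteq> 0 \<Longrightarrow> poly q' y \<noteq> 0 \<Longrightarrow> F y = poly p' y / poly q' y"
      using loc[OF zz] by metis
    then have "p * q' = p' * q" using cross[of q' p'] by (metis poly_0)
    then have "poly p z * poly q' z = poly p' z * poly q z" by (metis poly_mult)
    then show False using q0 1(1) noroot by auto
  qed
  have F: "F z = poly p z / poly q z" if zz: "z \<noteq> 0" for z
  proof -
    obtain p' q' where 1: "poly q' z \<noteq> 0" "\<And>y. y \<noteq> 0 \<Longrightarrow> poly q' y \<noteq> 0 \<Longrightarrow> F y = poly p' y / poly q' y"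
      using loc[OF zz] by metis
    then have "p * q' = p' * q" using cross[of q' p'] by (metis poly_0)
    then have "poly p z * poly q' z = poly p' z * poly q z" by (metis poly_mult)
    moreover have "F z = poly p' z / poly q' z" using 1 zz by blast
    ultimately show ?thesis using q_nz[OF zz] 1(1) by (simp add: frac_eq_eq)
  qed
  have p_nz: "poly p z \<noteq> 0" if "z \<noteq> 0" for z using F[OF that] nz[OF that] by auto
  have "p \<noteq> 0" using p_nz[of 1] by auto
  obtain a k b l where kl: "a \<noteq> 0" "\<And>z. poly p z = a * z ^ k" "b \<noteq> 0" "\<And>z. poly q z = b * z ^ l"
    using poly_without_nonzero_roots[OF \<open>p \<noteq> 0\<close> p_nz] poly_without_nonzero_roots[OF \<open>q \<noteq> 0\<close> q_nz] by metis
  have "F z = F 1 * z powi (int k - int l)" if "z \<noteq> 0" for z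
    using that F[OF that] F[of 1] by (simp add: kl power_int_diff)
  then show ?thesis by blast
qed

lemma two_powi_inject: "(2::complex) powi m = 2 powi n \<longleftrightarrow> m = n"
proof -
  have "m = n" if "(2::complex) powi m = 2 powi n"
  proof -
    have "(2::real) powi m = 2 powi n"
      using arg_cong[OF that, of norm] by (simp add: norm_power_int)
    then show ?thesis
      using power_int_strict_increasing[of m n "2::real"] power_int_strict_increasing[of n m "2::real"]
      by (cases m n rule: linorder_cases) auto
  qed
  then show ?thesis by auto
qed

text \<open>If \<open>c \<noteq> 0\<close>, some \<open>z\<close> on the unit circle has \<open>z\<^sup>c = -1\<close>, which is not a power of \<open>2\<close>.\<close>

lemma power_of_two_character_trivial:
  assumes "\<And>z::complex. z \<noteq> 0 \<Longrightarrow> 2 powi p z = z powi c"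
  shows "c = 0"
proof (rule ccontr)
  assume c: "c \<noteq> 0"
  define z where "z = cis (pi / of_int c)"
  have "z powi c = -1" using c by (simp add: z_def cis_power_int)
  then have "2 powi p z = (-1::complex)" using assms[of z] by (simp add: z_def)
  moreover have "(2::complex) powi p z = of_real (2 powi p z)"
    by (simp only: of_real_power_int of_real_numeral)
  ultimately have "complex_of_real (2 powi p z) = of_real (-1)"
    by (simp only: of_real_minus of_real_1)
  then have "(2::real) powi p z = -1" by (simp only: of_real_eq_iff)
  moreover have "(2::real) powi p z > 0" by simp
  ultimately show False by linarith
qed

abbreviation torus_coords :: "nat \<Rightarrow> ((nat \<Rightarrow> complex) \<Rightarrow> complex) set" where
  "torus_coords d \<equiv> {\<lambda>x. x i |i. i < d}"

lemma torus_upd: "x \<in> torus d \<Longrightarrow> i < d \<Longrightarrow> z \<noteq> 0 \<Longrightarrow> x(i := z) \<in> torus d"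
  by (auto simp: torus_def)

lemma regular_on_torus_line:
  assumes "regular_on (torus_coords d) (torus d) f" "x \<in> torus d" "i < d"
  shows "regular_on {\<lambda>z. z} (- {0}) (\<lambda>z. f (x(i := z)))"
proof (rule regular_on_compose[OF assms(1)])
  show "(\<lambda>z. x(i := z)) ` (- {0}) \<subseteq> torus d" using torus_upd assms(2,3) by auto
  fix c assume "c \<in> torus_coords d"
  then obtain j where "c = (\<lambda>x. x j)" by auto
  then show "regular_on {\<lambda>z. z} (- {0}) (\<lambda>z. c (x(i := z)))"
    by (cases "j = i") (auto intro!: regular_on_const regular_on_gen)
qed

text \<open>On each line parallel to a coordinate axis the function is a power of that coordinate.  The
  exponent does not depend on the line: comparing the two orders in which a pair of coordinates can
  be changed expresses a power of \<open>2\<close> as a fixed power of an arbitrary number, and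
  \<open>power_of_two_character_trivial\<close> applies.  The coordinates are then replaced by \<open>1\<close> one at a time.\<close>

theorem unit_torus_monomial:
  assumes reg: "regular_on (torus_coords d) (torus d) f" and nz: "\<And>x. x \<in> torus d \<Longrightarrow> f x \<noteq> 0"
  shows "\<exists>m\<in>int_space d. \<forall>x\<in>torus d. f x = f (\<lambda>_. 1) * monomial d m x"
proof -
  define E where "E i x = (SOME m. \<forall>z. z \<noteq> 0 \<longrightarrow> f (x(i := z)) = f (x(i := 1)) * z powi m)" for i x
  have E: "f (x(i := z)) = f (x(i := 1)) * z powi E i x" if "x \<in> torus d" "i < d" "z \<noteq> 0" for x i z
  proof -
    have "\<exists>m. \<forall>z. z \<noteq> 0 \<longrightarrow> f (x(i := z)) = f (x(i := 1)) * z powi m"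
      using unit_univariate[OF regular_on_torus_line[OF reg that(1,2)]] nz torus_upd[OF that(1,2)] by simp
    from someI_ex[OF this] show ?thesis using that(3) unfolding E_def by blast
  qed
  have E_const: "E i (x(j := z)) = E i (x(j := 1))"
    if x: "x \<in> torus d" and i: "i < d" and j: "j < d" and z: "z \<noteq> 0" for i j x z
  proof (cases "i = j")
    case True then show ?thesis by (simp add: E_def)
  next
    case False
    define p where "p z = E i (x(j := z))" for z
    define q where "q y = E j (x(i := y))" for y
    have eq: "2 powi (p z - p 1) = z powi (q 2 - q 1)" if "z \<noteq> 0" for z
    proof -
      have y: "(2::complex) \<noteq> 0" by simp
      define A where "A = f (x(i := 1, j := 1))"
      have "A \<noteq> 0" unfolding A_def by (intro nz torus_upd x i j) auto
      have "f (x(j := z, i := 2)) = f (x(j := z, i := 1)) * 2 powi p z"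
        unfolding p_def by (rule E[OF torus_upd[OF x j that] i y])
      moreover have "f (x(i := 1, j := z)) = A * z powi q 1"
        unfolding q_def A_def by (rule E[OF torus_upd[OF x i] j that]) simp
      moreover have "f (x(i := 2, j := z)) = f (x(i := 2, j := 1)) * z powi q 2"
        unfolding q_def by (rule E[OF torus_upd[OF x i y] j that])
      moreover have "f (x(j := 1, i := 2)) = f (x(j := 1, i := 1)) * 2 powi p 1"
        unfolding p_def by (rule E[OF torus_upd[OF x j] i y]) simp
      moreover have "x(j := u, i := w) = x(i := w, j := u)" for u w using False by (rule fun_upd_twist[symmetric])
      ultimately have "A * z powi q 1 * 2 powi p z = A * 2 powi p 1 * z powi q 2"
        unfolding A_def by metis
      then show ?thesis using \<open>A \<noteq> 0\<close> that by (simp add: power_int_diff field_simps)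
    qed
    have "q 2 - q 1 = 0" using power_of_two_character_trivial[OF eq] .
    then have "2 powi (p z - p 1) = (2 powi 0 :: complex)" using eq[OF z] by (simp only: power_int_0_right)
    then have "p z - p 1 = 0" unfolding two_powi_inject .
    then show ?thesis by (simp add: p_def del: fun_upd_apply)
  qed
  (* tr e x keeps the first e coordinates; it joins the point with all coordinates 1 to x *)
  define tr where "tr e x = (\<lambda>j. if j < e then x j else 1)" for e and x :: "nat \<Rightarrow> complex"
  have tr: "tr e x \<in> torus d" if "x \<in> torus d" for e x
    using that by (auto simp: torus_def tr_def)
  have tr_Suc: "tr (Suc e) x = (tr e x)(e := x e)" "(tr e x)(e := 1) = tr e x" for e x
    by (auto simp: tr_def fun_eq_iff less_Suc_eq)
  have E_one: "E i (tr e x) = E i (tr 0 x)" if x: "x \<in> torus d" and i: "i < d" and "e \<le> d" for i e x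
    using \<open>e \<le> d\<close>
  proof (induction e)
    case (Suc e)
    have "x e \<noteq> 0" using x Suc by (auto simp: torus_def)
    then have "E i ((tr e x)(e := x e)) = E i ((tr e x)(e := 1))"
      by (intro E_const[OF tr[OF x] i]) (use Suc in auto)
    then show ?case using Suc by (simp only: tr_Suc)
  qed simp
  define m where "m i = (if i < d then E i (\<lambda>_. 1) else 0)" for i
  have main: "f (tr e x) = f (\<lambda>_. 1) * (\<Prod>i<e. x i powi m i)" if x: "x \<in> torus d" and "e \<le> d" for e x
    using \<open>e \<le> d\<close>
  proof (induction e)
    case 0 then show ?case by (simp add: tr_def)
  next
    case (Suc e)
    have "x e \<noteq> 0" using x Suc by (auto simp: torus_def)
    then have "f ((tr e x)(e := x e)) = f ((tr e x)(e := 1)) * x e powi E e (tr e x)"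
      by (intro E[OF tr[OF x]]) (use Suc in auto)
    moreover have "E e (tr e x) = m e"
      using E_one[OF x, of e e] Suc by (simp add: m_def tr_def)
    ultimately show ?case using Suc by (simp only: tr_Suc prod.lessThan_Suc Suc_leD) (simp only: mult.assoc)
  qed
  have "f x = f (\<lambda>_. 1) * monomial d m x" if "x \<in> torus d" for x
  proof -
    have "tr d x = x" using that by (auto simp: tr_def torus_def fun_eq_iff)
    then show ?thesis using main[OF that, of d] by (simp add: monomial_def)
  qed
  moreover have "m \<in> int_space d" by (simp add: m_def int_space_def)
  ultimately show ?thesis by blast
qed

lemma connected_punctured_plane: "connected (- {0 :: complex})"
proof -
  have "z \<in> range exp" if "z \<noteq> 0" for z :: complex
  proof -
    have "z = of_real (exp (ln (cmod z))) * exp (\<i> * of_real (Arg z))"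
      using that rcis_cmod_Arg[of z] by (simp add: rcis_def cis_conv_exp)
    also have "\<dots> = exp (of_real (ln (cmod z)) + \<i> * of_real (Arg z))"
      by (simp only: exp_add exp_of_real)
    finally show ?thesis by blast
  qed
  then have "range (exp :: complex \<Rightarrow> complex) = - {0}" by auto
  moreover have "connected (range (exp :: complex \<Rightarrow> complex))"
    by (intro connected_continuous_image continuous_intros Convex.connected_UNIV)
  ultimately show ?thesis by simp
qed

section \<open>Minors\<close>

text \<open>The minor in the first \<open>k\<close> columns whose rows are listed by \<open>r\<close> in any order and possibly with
  repetitions, so that rows can be exchanged one at a time without sorting.\<close>

definition rowdet :: "complex mat \<Rightarrow> nat \<Rightarrow> (nat \<Rightarrow> nat) \<Rightarrow> complex" where
  "rowdet A k r = det (mat k k (\<lambda>(i, j). A $$ (r i, j)))"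

lemma flag_minor_rowdet: "flag_minor I A = rowdet A (card I) (\<lambda>i. sorted_list_of_set I ! i)"
  by (simp add: flag_minor_def rowdet_def)

lemma rowdet_expand:
  "rowdet A k r = (\<Sum>p | p permutes {0..<k}. signof p * (\<Prod>i=0..<k. A $$ (r i, p i)))"
proof -
  have "(\<Prod>i=0..<k. mat k k (\<lambda>(i, j). A $$ (r i, j)) $$ (i, p i)) = (\<Prod>i=0..<k. A $$ (r i, p i))"
    if "p permutes {0..<k}" for p
    using permutes_in_image[OF that] by (intro prod.cong) auto
  then show ?thesis
    unfolding rowdet_def by (subst det_def'[of _ k]) (auto intro!: sum.cong)
qed

lemma gen_algebra_sum:
  "(\<And>i. i \<in> I \<Longrightarrow> f i \<in> gen_algebra G) \<Longrightarrow> (\<lambda>y. \<Sum>i\<in>I. f i y) \<in> gen_algebra G"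
  by (induction I rule: infinite_finite_induct) (auto intro: gen_algebra.intros)

lemma gen_algebra_prod:
  "(\<And>i. i \<in> I \<Longrightarrow> f i \<in> gen_algebra G) \<Longrightarrow> (\<lambda>y. \<Prod>i\<in>I. f i y) \<in> gen_algebra G"
  by (induction I rule: infinite_finite_induct) (auto intro: gen_algebra.intros)

lemma rowdet_gen_algebra:
  assumes "k \<le> n" "\<And>i. i < k \<Longrightarrow> r i < n"
  shows "(\<lambda>A. rowdet A k r) \<in> gen_algebra (entries n)"
  unfolding rowdet_expand
proof (intro gen_algebra_sum gen_algebra.mult gen_algebra_prod gen_algebra.const)
  fix p i assume p: "p \<in> {p. p permutes {0..<k}}" and i: "i \<in> {0..<k}"
  then have "p i < k" by (metis atLeastLessThan_iff mem_Collect_eq permutes_in_image)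
  then have "p i < n" "r i < n" using assms i by auto
  then show "(\<lambda>A. A $$ (r i, p i)) \<in> gen_algebra (entries n)"
    by (intro gen_algebra.gen) (auto simp: entries_def)
qed

text \<open>Right multiplication by an upper triangular matrix changes the first \<open>k\<close> columns by an upper
  triangular \<open>k \<times> k\<close> matrix; hence flag minors of one size are homogeneous coordinates of a flag.\<close>

lemma rowdet_mult_upper:
  assumes A: "A \<in> carrier_mat n n" and b: "b \<in> carrier_mat n n"
    and up: "\<And>i j. i < n \<Longrightarrow> j < i \<Longrightarrow> b $$ (i, j) = 0"
    and k: "k \<le> n" and r: "\<And>i. i < k \<Longrightarrow> r i < n"
  shows "rowdet (A * b) k r = rowdet A k r * (\<Prod>l<k. b $$ (l, l))"
proof -
  define N where "N = mat k k (\<lambda>(i, j). A $$ (r i, j))"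
  define c where "c = mat k k (\<lambda>(i, j). b $$ (i, j))"
  have c: "c \<in> carrier_mat k k" and N: "N \<in> carrier_mat k k" by (auto simp: c_def N_def)
  have "mat k k (\<lambda>(i, j). (A * b) $$ (r i, j)) = N * c"
  proof (rule eq_matI)
    fix i j assume "i < dim_row (N * c)" "j < dim_col (N * c)"
    then have i: "i < k" and j: "j < k" by (auto simp: N_def c_def)
    have "(A * b) $$ (r i, j) = (\<Sum>l\<in>{0..<n}. A $$ (r i, l) * b $$ (l, j))"
      using A b r[OF i] j k by (auto simp: scalar_prod_def intro!: sum.cong)
    also have "\<dots> = (\<Sum>l\<in>{0..<k}. A $$ (r i, l) * b $$ (l, j))"
      by (rule sum.mono_neutral_right) (use k j up in auto)
    also have "\<dots> = (N * c) $$ (i, j)"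
      using i j by (auto simp: N_def c_def scalar_prod_def intro!: sum.cong)
    finally show "mat k k (\<lambda>(i, j). (A * b) $$ (r i, j)) $$ (i, j) = (N * c) $$ (i, j)"
      using i j by simp
  qed (auto simp: N_def c_def)
  then have "rowdet (A * b) k r = det N * det c" by (simp add: rowdet_def det_mult[OF N c])
  also have "det c = prod_list (diag_mat c)"
    by (rule det_upper_triangular[OF _ c]) (use up k in \<open>auto simp: c_def upper_triangular_def\<close>)
  also have "\<dots> = (\<Prod>l<k. b $$ (l, l))"
    by (auto simp: diag_mat_def c_def prod.list_conv_set_nth atLeast0LessThan intro!: prod.cong)
  finally show ?thesis by (simp add: N_def rowdet_def)
qed

definition dmat :: "nat \<Rightarrow> (nat \<Rightarrow> complex) \<Rightarrow> complex mat" where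
  "dmat n f = mat n n (\<lambda>(i, j). if i = j then f i else 0)"

lemma dmat_carrier [simp]: "dmat n f \<in> carrier_mat n n" by (simp add: dmat_def)

lemma dmat_mult_index:
  assumes "A \<in> carrier_mat n n" "i < n" "j < n"
  shows "(dmat n f * A) $$ (i, j) = f i * A $$ (i, j)"
proof -
  have "(dmat n f * A) $$ (i, j) = (\<Sum>l\<in>{0..<n}. (if i = l then f i else 0) * A $$ (l, j))"
    using assms by (auto simp: dmat_def scalar_prod_def intro!: sum.cong)
  also have "\<dots> = (\<Sum>l\<in>{0..<n}. if i = l then f i * A $$ (l, j) else 0)"
    by (intro sum.cong) auto
  finally show ?thesis using assms by simp
qed

lemma mult_dmat_index:
  assumes "A \<in> carrier_mat n n" "i < n" "j < n"
  shows "(A * dmat n f) $$ (i, j) = A $$ (i, j) * f j"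
proof -
  have "(A * dmat n f) $$ (i, j) = (\<Sum>l\<in>{0..<n}. A $$ (i, l) * (if l = j then f l else 0))"
    using assms by (auto simp: dmat_def scalar_prod_def intro!: sum.cong)
  also have "\<dots> = (\<Sum>l\<in>{0..<n}. if l = j then A $$ (i, j) * f j else 0)"
    by (intro sum.cong) auto
  finally show ?thesis using assms by simp
qed

lemma rowdet_dmat:
  assumes A: "A \<in> carrier_mat n n" and k: "k \<le> n" and r: "\<And>i. i < k \<Longrightarrow> r i < n"
  shows "rowdet (dmat n f * A) k r = (\<Prod>i<k. f (r i)) * rowdet A k r"
proof -
  have "(\<Prod>i=0..<k. (dmat n f * A) $$ (r i, p i)) = (\<Prod>i<k. f (r i)) * (\<Prod>i=0..<k. A $$ (r i, p i))"
    if p: "p permutes {0..<k}" for p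
  proof -
    have "(\<Prod>i=0..<k. (dmat n f * A) $$ (r i, p i)) = (\<Prod>i=0..<k. f (r i) * A $$ (r i, p i))"
    proof (intro prod.cong refl)
      fix i assume i: "i \<in> {0..<k}"
      then have "p i < k" using p by (metis atLeastLessThan_iff permutes_in_image)
      then show "(dmat n f * A) $$ (r i, p i) = f (r i) * A $$ (r i, p i)"
        using i k r by (intro dmat_mult_index[OF A]) auto
    qed
    then show ?thesis by (simp add: prod.distrib atLeast0LessThan)
  qed
  then show ?thesis unfolding rowdet_expand
    by (simp add: sum_distrib_left mult.left_commute)
qed

lemma rowdet_not_inj:
  assumes "\<not> inj_on r {..<k}"
  shows "rowdet A k r = 0"
proof -
  obtain i j where ij: "i < k" "j < k" "i \<noteq> j" "r i = r j" using assms by (auto simp: inj_on_def)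
  show ?thesis unfolding rowdet_def
    by (rule det_identical_rows[of _ k i j]) (use ij in \<open>auto intro!: eq_vecI\<close>)
qed

lemma rowdet_permute:
  assumes "inj_on r {..<k}" "inj_on r' {..<k}" "r ` {..<k} = r' ` {..<k}"
  shows "\<exists>s\<in>{1, -1}. \<forall>A. rowdet A k r' = s * rowdet A k r"
proof -
  define p where "p i = (if i < k then inv_into {..<k} r (r' i) else i)" for i
  have im: "r' i \<in> r ` {..<k}" if "i < k" for i using assms(3) that by auto
  have pr: "r (p i) = r' i" "p i < k" if "i < k" for i
    using f_inv_into_f[OF im[OF that]] inv_into_into[OF im[OF that]] that by (auto simp: p_def)
  have "inj_on p {..<k}" by (rule inj_onI) (metis assms(2) inj_onD lessThan_iff pr(1))
  moreover have "p ` {..<k} \<subseteq> {..<k}" using pr by auto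
  ultimately have "bij_betw p {..<k} {..<k}"
    by (simp add: bij_betw_def endo_inj_surj)
  then have p: "p permutes {0..<k}"
    by (intro bij_imp_permutes) (auto simp: p_def atLeast0LessThan)
  have "rowdet A k r' = signof p * rowdet A k r" for A
  proof -
    define N where "N = mat k k (\<lambda>(i, j). A $$ (r i, j))"
    have "mat k k (\<lambda>(i, j). A $$ (r' i, j)) = mat k k (\<lambda>(i, j). N $$ (p i, j))"
      by (intro cong_mat) (auto simp: N_def pr)
    then show ?thesis using det_permute_rows[OF _ p, of N] by (simp add: rowdet_def N_def)
  qed
  moreover have "signof p \<in> {1, -1 :: complex}" by (simp add: sign_def)
  ultimately show ?thesis by blast
qed

lemma rowdet_eq_flag_minor:
  assumes inj: "inj_on r {..<k}"
  shows "\<exists>s\<in>{1, -1}. \<forall>A. rowdet A k r = s * flag_minor (r ` {..<k}) A"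
proof -
  define I where "I = r ` {..<k}"
  define l where "l = sorted_list_of_set I"
  have fin: "finite I" and card: "card I = k" using inj by (auto simp: I_def card_image)
  have "distinct l" "set l = I" "length l = k" using fin card by (auto simp: l_def)
  then have "inj_on (\<lambda>i. l ! i) {..<k}" "(\<lambda>i. l ! i) ` {..<k} = r ` {..<k}"
    unfolding I_def[symmetric] by (auto simp: inj_on_def nth_eq_iff_index_eq set_conv_nth)
  from rowdet_permute[OF this(1) inj this(2)] show ?thesis
    unfolding flag_minor_rowdet I_def[symmetric] card l_def by simp
qed

lemma rowdet_Suc_nonzero:
  assumes "rowdet A (Suc k) r \<noteq> 0"
  shows "\<exists>i. rowdet A k (\<lambda>a. r (if a < i then a else Suc a)) \<noteq> 0"
proof (rule ccontr)
  assume "\<not> ?thesis"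
  then have z: "rowdet A k (\<lambda>a. r (if a < i then a else Suc a)) = 0" for i by blast
  define N where "N = mat (Suc k) (Suc k) (\<lambda>(i, j). A $$ (r i, j))"
  have N: "N \<in> carrier_mat (Suc k) (Suc k)" by (simp add: N_def)
  have "det (mat_delete N i k) = 0" if "i < Suc k" for i
  proof -
    have "mat_delete N i k = mat k k (\<lambda>(a, j). A $$ (r (if a < i then a else Suc a), j))"
      by (rule eq_matI) (use that in \<open>auto simp: mat_delete_def N_def\<close>)
    then show ?thesis using z[of i] by (simp add: rowdet_def)
  qed
  then have "det N = 0"
    by (subst laplace_expansion_column[OF N, of k]) (auto simp: cofactor_def)
  then show False using assms by (simp add: rowdet_def N_def)
qed

text \<open>Expanding along the last column repeatedly, some cofactor survives each time.\<close>

lemma exists_flag_minor_nonzero: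
  assumes A: "A \<in> carrier_mat n n" "det A \<noteq> 0" and k: "k \<le> n"
  shows "\<exists>J. J \<subseteq> {..<n} \<and> card J = k \<and> flag_minor J A \<noteq> 0"
proof -
  have "\<exists>r. (\<forall>i<n - m. r i < n) \<and> rowdet A (n - m) r \<noteq> 0" if "m \<le> n" for m
    using that
  proof (induction m)
    case 0
    have "mat n n (\<lambda>(i, j). A $$ (i, j)) = A" using A(1) by (intro eq_matI) auto
    then show ?case using A(2) by (intro exI[of _ "\<lambda>i. i"]) (simp add: rowdet_def)
  next
    case (Suc m)
    then obtain r where r: "\<forall>i<n - m. r i < n" "rowdet A (n - m) r \<noteq> 0" by auto
    have nm: "n - m = Suc (n - Suc m)" using Suc by simp
    obtain i where i: "rowdet A (n - Suc m) (\<lambda>a. r (if a < i then a else Suc a)) \<noteq> 0"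
      using rowdet_Suc_nonzero r(2)[unfolded nm] by blast
    show ?case
      by (intro exI[of _ "\<lambda>a. r (if a < i then a else Suc a)"] conjI i) (use r(1) Suc in auto)
  qed
  from this[of "n - k"] k obtain r where r: "\<forall>i<k. r i < n" "rowdet A k r \<noteq> 0" by auto
  then have inj: "inj_on r {..<k}" using rowdet_not_inj by blast
  then have "flag_minor (r ` {..<k}) A \<noteq> 0" using rowdet_eq_flag_minor[OF inj] r(2) by fastforce
  moreover have "r ` {..<k} \<subseteq> {..<n}" "card (r ` {..<k}) = k" using r inj by (auto simp: card_image)
  ultimately show ?thesis by blast
qed

section \<open>Flags\<close>

lemma SL_carrier: "A \<in> SL n \<Longrightarrow> A \<in> carrier_mat n n" by (simp add: SL_def)

lemma SL_mult: "A \<in> SL n \<Longrightarrow> B \<in> SL n \<Longrightarrow> A * B \<in> SL n"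
  by (auto simp: SL_def det_mult)

lemma Borel_SL: "b \<in> Borel n \<Longrightarrow> b \<in> SL n" by (simp add: Borel_def)

lemma Borel_upper: "b \<in> Borel n \<Longrightarrow> i < n \<Longrightarrow> j < i \<Longrightarrow> b $$ (i, j) = 0" by (simp add: Borel_def)

lemma Borel_one: "1\<^sub>m n \<in> Borel n" by (auto simp: Borel_def SL_def)

lemma Borel_mult:
  assumes "b \<in> Borel n" "c \<in> Borel n"
  shows "b * c \<in> Borel n"
proof -
  have bc: "b \<in> carrier_mat n n" "c \<in> carrier_mat n n" using assms Borel_SL SL_carrier by blast+
  have "(b * c) $$ (i, j) = 0" if "i < n" "j < i" for i j
  proof -
    have "(b * c) $$ (i, j) = (\<Sum>l\<in>{0..<n}. b $$ (i, l) * c $$ (l, j))"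
      using bc that by (auto simp: scalar_prod_def intro!: sum.cong)
    also have "\<dots> = 0"
    proof (rule sum.neutral, rule ballI)
      fix l assume "l \<in> {0..<n}"
      then show "b $$ (i, l) * c $$ (l, j) = 0"
        using that Borel_upper[OF assms(1), of i l] Borel_upper[OF assms(2), of l j]
        by (cases "l < i") auto
    qed
    finally show ?thesis .
  qed
  then show ?thesis using SL_mult[OF Borel_SL[OF assms(1)] Borel_SL[OF assms(2)]] by (auto simp: Borel_def)
qed

lemma Borel_diag_nonzero:
  assumes "b \<in> Borel n" "i < n"
  shows "b $$ (i, i) \<noteq> 0"
proof -
  have b: "b \<in> carrier_mat n n" using assms Borel_SL SL_carrier by blast
  have "det b = prod_list (diag_mat b)"
    by (rule det_upper_triangular[OF _ b]) (use Borel_upper[OF assms(1)] b in \<open>auto simp: upper_triangular_def\<close>)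
  then have "prod_list (diag_mat b) \<noteq> 0" using assms(1) by (auto simp: Borel_def SL_def)
  moreover have "b $$ (i, i) \<in> set (diag_mat b)" using b assms(2) by (auto simp: diag_mat_def)
  ultimately show ?thesis by (auto simp: prod_list_zero_iff)
qed

text \<open>The entries of the inverse below the diagonal vanish by induction on the column, read off from
  the product with \<open>b\<close>, whose diagonal entries are nonzero.\<close>

lemma Borel_inverse:
  assumes b: "b \<in> Borel n"
  shows "\<exists>c\<in>Borel n. b * c = 1\<^sub>m n \<and> c * b = 1\<^sub>m n"
proof -
  have bC: "b \<in> carrier_mat n n" and db: "det b = 1" using b by (auto simp: Borel_def SL_def)
  define c where "c = adj_mat b"
  have c: "c \<in> carrier_mat n n" "b * c = 1\<^sub>m n" "c * b = 1\<^sub>m n"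
    using adj_mat[OF bC] db by (auto simp: c_def)
  have "det c = 1" using det_mult[OF bC c(1)] c(2) db by simp
  have z: "c $$ (i, j) = 0" if "i < n" "j < i" for i j
    using that(2)
  proof (induction j rule: less_induct)
    case (less j)
    have "0 = (c * b) $$ (i, j)" using c(3) that(1) less.prems by simp
    also have "\<dots> = (\<Sum>l\<in>{0..<n}. c $$ (i, l) * b $$ (l, j))"
      using bC c(1) that(1) less.prems by (auto simp: scalar_prod_def intro!: sum.cong)
    also have "\<dots> = (\<Sum>l\<in>{j}. c $$ (i, l) * b $$ (l, j))"
    proof (rule sum.mono_neutral_right)
      show "\<forall>l\<in>{0..<n} - {j}. c $$ (i, l) * b $$ (l, j) = 0"
      proof
        fix l assume l: "l \<in> {0..<n} - {j}"
        show "c $$ (i, l) * b $$ (l, j) = 0"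
          using l less.IH[of l] less.prems Borel_upper[OF b, of l j] by (cases "l < j") auto
      qed
    qed (use that(1) less.prems in auto)
    finally show ?case using Borel_diag_nonzero[OF b, of j] that(1) less.prems by simp
  qed
  then have "c \<in> Borel n" using c(1) \<open>det c = 1\<close> by (auto simp: Borel_def SL_def)
  then show ?thesis using c by blast
qed

lemma flag_self: "A \<in> carrier_mat n n \<Longrightarrow> A \<in> flag n A"
  unfolding flag_def using Borel_one by (force intro!: exI[of _ "1\<^sub>m n"])

lemma flag_mult_Borel:
  assumes A: "A \<in> carrier_mat n n" and b: "b \<in> Borel n"
  shows "flag n (A * b) = flag n A"
proof -
  obtain c where c: "c \<in> Borel n" "b * c = 1\<^sub>m n" using Borel_inverse[OF b] by blast
  have C: "b \<in> carrier_mat n n" "c \<in> carrier_mat n n" using b c Borel_SL SL_carrier by blast+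
  show ?thesis
  proof
    show "flag n (A * b) \<subseteq> flag n A"
    proof
      fix x assume "x \<in> flag n (A * b)"
      then obtain e where e: "e \<in> Borel n" "x = A * b * e" by (auto simp: flag_def)
      then have "x = A * (b * e)" using A C SL_carrier[OF Borel_SL[OF e(1)]] by simp
      then show "x \<in> flag n A" using Borel_mult[OF b e(1)] by (auto simp: flag_def)
    qed
    show "flag n A \<subseteq> flag n (A * b)"
    proof
      fix x assume "x \<in> flag n A"
      then obtain e where e: "e \<in> Borel n" "x = A * e" by (auto simp: flag_def)
      have eC: "e \<in> carrier_mat n n" by (rule SL_carrier[OF Borel_SL[OF e(1)]])
      have "A * b * (c * e) = A * ((b * c) * e)" using A C eC
        by (simp add: assoc_mult_mat[of _ n n _ n _ n])
      then have "x = A * b * (c * e)" using e(2) c(2) eC by simp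
      then show "x \<in> flag n (A * b)" using Borel_mult[OF c(1) e(1)] by (auto simp: flag_def)
    qed
  qed
qed

lemma flag_eqD:
  assumes "flag n A = flag n A'" "A' \<in> carrier_mat n n"
  shows "\<exists>b\<in>Borel n. A' = A * b"
  using flag_self[OF assms(2)] assms(1) unfolding flag_def by blast

lemma flag_minor_mult_Borel:
  assumes A: "A \<in> carrier_mat n n" and b: "b \<in> Borel n" and I: "I \<subseteq> {..<n}"
  shows "\<exists>c. c \<noteq> 0 \<and> (\<forall>J. J \<subseteq> {..<n} \<longrightarrow> card J = card I \<longrightarrow> flag_minor J (A * b) = c * flag_minor J A)"
proof -
  have "(\<Prod>l<card I. b $$ (l, l)) \<noteq> 0"
    using Borel_diag_nonzero[OF b] card_mono[OF _ I] by auto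
  moreover have "flag_minor J (A * b) = (\<Prod>l<card I. b $$ (l, l)) * flag_minor J A"
    if J: "J \<subseteq> {..<n}" "card J = card I" for J
  proof -
    have "finite J" using J finite_subset by blast
    then have "sorted_list_of_set J ! i < n" if "i < card I" for i
      using J that nth_mem[of i "sorted_list_of_set J"] by (auto simp: subset_iff)
    then show ?thesis unfolding flag_minor_rowdet J(2)
      using rowdet_mult_upper[OF A SL_carrier[OF Borel_SL[OF b]] Borel_upper[OF b], of "card I"]
        card_mono[OF _ I] by simp
  qed
  ultimately show ?thesis by blast
qed

lemma flag_minor_dmat:
  assumes A: "A \<in> carrier_mat n n" and J: "J \<subseteq> {..<n}"
  shows "flag_minor J (dmat n f * A) = (\<Prod>i\<in>J. f i) * flag_minor J A"
proof -
  have fin: "finite J" using J finite_subset by blast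
  have lt: "sorted_list_of_set J ! i < n" if "i < card J" for i
    using J that fin nth_mem[of i "sorted_list_of_set J"] by (auto simp: subset_iff)
  have "(\<Prod>i<card J. f (sorted_list_of_set J ! i)) = (\<Prod>i\<in>J. f i)"
    by (rule prod.reindex_bij_betw[OF bij_betw_nth]) (use fin in auto)
  then show ?thesis unfolding flag_minor_rowdet
    using rowdet_dmat[OF A, of "card J" "\<lambda>i. sorted_list_of_set J ! i"] card_mono[OF _ J] lt by simp
qed

lemma flag_minor_gen_algebra:
  assumes J: "J \<subseteq> {..<n}"
  shows "flag_minor J \<in> gen_algebra (entries n)"
proof -
  have fin: "finite J" using J finite_subset by blast
  have lt: "sorted_list_of_set J ! i < n" if "i < card J" for i
    using J that fin nth_mem[of i "sorted_list_of_set J"] by (auto simp: subset_iff)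
  have "flag_minor J = (\<lambda>A. rowdet A (card J) (\<lambda>i. sorted_list_of_set J ! i))"
    by (simp add: fun_eq_iff flag_minor_rowdet)
  then show ?thesis using rowdet_gen_algebra[of "card J" n] card_mono[OF _ J] lt by simp
qed

lemma det_dmat: "det (dmat n f) = (\<Prod>i<n. f i)"
proof -
  have "det (dmat n f) = prod_list (diag_mat (dmat n f))"
    by (rule det_upper_triangular[of _ n]) (auto simp: dmat_def upper_triangular_def)
  also have "\<dots> = (\<Prod>i<n. f i)"
    by (auto simp: diag_mat_def dmat_def prod.list_conv_set_nth atLeast0LessThan intro!: prod.cong)
  finally show ?thesis .
qed

lemma dmat_SL: "(\<Prod>i<n. f i) = 1 \<Longrightarrow> dmat n f \<in> SL n"
  by (simp add: SL_def det_dmat)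

lemma dmat_Borel: "(\<Prod>i<n. f i) = 1 \<Longrightarrow> dmat n f \<in> Borel n"
  using dmat_SL[of f n] by (auto simp: Borel_def dmat_def)

lemma Borel_opp_dmat_mult:
  assumes "(\<Prod>i<n. f i) = 1" "b \<in> Borel_opp n"
  shows "dmat n f * b \<in> Borel_opp n"
proof -
  have b: "b \<in> SL n" using assms by (simp add: Borel_opp_def)
  have "(dmat n f * b) $$ (i, j) = 0" if "i < n" "j < n" "i < j" for i j
    using dmat_mult_index[OF SL_carrier[OF b] that(1,2)] assms(2) that by (simp add: Borel_opp_def)
  then show ?thesis using SL_mult[OF dmat_SL[OF assms(1)] b] by (auto simp: Borel_opp_def)
qed

text \<open>Diagonal matrices of determinant \<open>1\<close> lie in both Borel subgroups, so they preserve both kinds of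
  Schubert cells.\<close>

lemma richardson_dmat:
  assumes f: "(\<Prod>i<n. f i) = 1" and A: "A \<in> SL n" "flag n A \<in> richardson n v w"
  shows "flag n (dmat n f * A) \<in> richardson n v w"
proof -
  define D where "D = dmat n f"
  have D: "D \<in> carrier_mat n n" by (simp add: D_def)
  have *: "flag n (D * A) = flag n ((D * b) * p * b')"
    if e: "flag n A = flag n (b * p * b')" and c: "b \<in> SL n" "p \<in> SL n" "b' \<in> Borel n" for b p b'
  proof -
    have C: "b \<in> carrier_mat n n" "p \<in> carrier_mat n n" "b' \<in> carrier_mat n n"
      using c Borel_SL SL_carrier by blast+
    obtain e where e: "e \<in> Borel n" "A = b * p * b' * e" using flag_eqD[OF e[symmetric] SL_carrier[OF A(1)]] by blast
    have eC: "e \<in> carrier_mat n n" by (rule SL_carrier[OF Borel_SL[OF e(1)]])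
    have "D * A = ((D * b) * p * b') * e"
      using C D eC e(2) by (simp add: assoc_mult_mat[of _ n n _ n _ n])
    moreover have "(D * b) * p * b' \<in> carrier_mat n n"
      using C D by (intro mult_carrier_mat[where n = n])
    ultimately show ?thesis using flag_mult_Borel[OF _ e(1)] by metis
  qed
  have p: "p \<in> SL n" if "p \<in> perm_mats n u" for p u using that by (simp add: perm_mats_def)
  obtain b p b' where 1: "b \<in> Borel n" "p \<in> perm_mats n w" "b' \<in> Borel n" "flag n A = flag n (b * p * b')"
    using A(2) unfolding richardson_def schubert_cell_def by blast
  have "flag n (D * A) \<in> schubert_cell n w"
    unfolding schubert_cell_def *[OF 1(4) Borel_SL[OF 1(1)] p[OF 1(2)] 1(3)]
    using 1 Borel_mult[OF dmat_Borel[OF f] 1(1)] unfolding D_def by blast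
  moreover obtain b p b' where 2: "b \<in> Borel_opp n" "p \<in> perm_mats n v" "b' \<in> Borel n" "flag n A = flag n (b * p * b')"
    using A(2) unfolding richardson_def opp_schubert_cell_def by blast
  have "b \<in> SL n" using 2(1) by (simp add: Borel_opp_def)
  then have "flag n (D * A) \<in> opp_schubert_cell n v"
    unfolding opp_schubert_cell_def *[OF 2(4) \<open>b \<in> SL n\<close> p[OF 2(2)] 2(3)]
    using 2 Borel_opp_dmat_mult[OF f 2(1)] unfolding D_def by blast
  ultimately show ?thesis by (simp add: richardson_def D_def)
qed

section \<open>Degenerating a flag to a coordinate subspace\<close>

lemma prod_powi: "t \<noteq> 0 \<Longrightarrow> (\<Prod>i\<in>S. (t::complex) powi f i) = t powi (\<Sum>i\<in>S. f i)"
  by (induction S rule: infinite_finite_induct) (auto simp: power_int_add)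

lemma dmat_dim [simp]: "dim_row (dmat n f) = n" "dim_col (dmat n f) = n" by (simp_all add: dmat_def)

lemma dmat_mult_carrier [simp]: "A \<in> carrier_mat n n \<Longrightarrow> dmat n f * A \<in> carrier_mat n n"
  by (rule mult_carrier_mat) simp_all

lemma dmat_one_mult: "A \<in> carrier_mat n n \<Longrightarrow> dmat n (\<lambda>_. 1) * A = A"
  by (rule eq_matI) (auto simp: dmat_mult_index simp del: index_mult_mat(1))

text \<open>Weights of a one-parameter group of diagonal matrices: smaller on \<open>I\<close> than off \<open>I\<close>, and shifted so
  that they add up to zero and the determinant is \<open>1\<close>.\<close>

definition minor_weight :: "nat \<Rightarrow> nat set \<Rightarrow> nat \<Rightarrow> int" where
  "minor_weight n I i = (if i \<in> I then int (card I) - int n else int (card I))"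

lemma minor_weight_sum:
  assumes "I \<subseteq> {..<n}" "J \<subseteq> {..<n}"
  shows "(\<Sum>i\<in>J. minor_weight n I i) = int (card J) * int (card I) - int n * int (card (J \<inter> I))"
proof -
  have "finite J" using assms finite_subset by blast
  have "(\<Sum>i\<in>J. minor_weight n I i) = (\<Sum>i\<in>J. int (card I) - (if i \<in> I then int n else 0))"
    by (intro sum.cong) (auto simp: minor_weight_def)
  also have "\<dots> = int (card J) * int (card I) - (\<Sum>i\<in>J \<inter> I. int n)"
    by (simp only: sum_subtractf sum.inter_restrict[OF \<open>finite J\<close>, symmetric] sum_constant of_nat_mult)
  finally show ?thesis by simp
qed

lemma minor_weight_total: "I \<subseteq> {..<n} \<Longrightarrow> (\<Sum>i<n. minor_weight n I i) = 0"
  using minor_weight_sum[of I n "{..<n}"] by (simp add: Int_absorb1)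

text \<open>Among the subsets of its size, \<open>I\<close> alone has the least weight.\<close>

lemma minor_weight_less:
  assumes "I \<subseteq> {..<n}" "J \<subseteq> {..<n}" "card J = card I" "J \<noteq> I"
  shows "(\<Sum>i\<in>I. minor_weight n I i) < (\<Sum>i\<in>J. minor_weight n I i)"
proof -
  have fin: "finite I" "finite J" using assms finite_subset by blast+
  have "J \<inter> I \<noteq> I" using assms fin by (metis card_subset_eq inf.absorb_iff2)
  then have "card (J \<inter> I) < card I" using fin by (intro psubset_card_mono) auto
  moreover have "n > 0" using calculation assms(1) by (cases n) auto
  ultimately show ?thesis using assms by (simp add: minor_weight_sum)
qed

text \<open>The rows in \<open>I\<close> of the first \<open>card I\<close> columns form an invertible matrix, so multiples of these
  columns clear the rows in \<open>I\<close> of all later columns.\<close>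

lemma block_eliminate:
  assumes A: "A \<in> carrier_mat n n" and I: "I \<subseteq> {..<n}" and nz: "flag_minor I A \<noteq> 0"
  shows "\<exists>b\<in>Borel n. \<forall>i\<in>I. \<forall>j<n. card I \<le> j \<longrightarrow> (A * b) $$ (i, j) = 0"
proof -
  define k where "k = card I"
  define l where "l = sorted_list_of_set I"
  have fin: "finite I" using I finite_subset by blast
  have l: "set l = I" "length l = k" using fin by (auto simp: l_def k_def)
  have ln: "l ! p < n" if "p < k" for p using l I nth_mem[of p l] that by auto
  have kn: "k \<le> n" using card_mono[OF _ I] by (simp add: k_def)
  define N where "N = mat k k (\<lambda>(i, j). A $$ (l ! i, j))"
  have N: "N \<in> carrier_mat k k" by (simp add: N_def)
  have dN: "det N \<noteq> 0" using nz by (simp add: flag_minor_rowdet rowdet_def N_def k_def l_def)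
  then obtain Ni where Ni: "Ni \<in> carrier_mat k k" "N * Ni = 1\<^sub>m k"
    using det_non_zero_imp_unit[OF N dN, of "()"] by (auto simp: Units_def ring_mat_def)
  define u where "u q j = (\<Sum>p\<in>{0..<k}. Ni $$ (q, p) * A $$ (l ! p, j))" for q j
  define b where "b = mat n n (\<lambda>(q, j). if q = j then 1 else if q < k \<and> k \<le> j then - u q j else 0)"
  have bC: "b \<in> carrier_mat n n" by (simp add: b_def)
  have "det b = prod_list (diag_mat b)"
    by (rule det_upper_triangular[OF _ bC]) (auto simp: b_def upper_triangular_def)
  also have "\<dots> = 1"
    by (auto simp: diag_mat_def b_def prod.list_conv_set_nth)
  finally have b: "b \<in> Borel n" using bC by (auto simp: Borel_def SL_def b_def)
  have "(A * b) $$ (i, j) = 0" if i: "i \<in> I" and j: "j < n" "k \<le> j" for i j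
  proof -
    obtain p where p: "p < k" "i = l ! p" using l i by (metis in_set_conv_nth)
    have "i < n" using i I by auto
    have Nu: "(\<Sum>q\<in>{0..<k}. A $$ (i, q) * u q j) = A $$ (i, j)"
    proof -
      have "(\<Sum>q\<in>{0..<k}. A $$ (i, q) * u q j) =
          (\<Sum>q\<in>{0..<k}. \<Sum>p'\<in>{0..<k}. N $$ (p, q) * Ni $$ (q, p') * A $$ (l ! p', j))"
        unfolding u_def sum_distrib_left using p by (intro sum.cong) (auto simp: N_def)
      also have "\<dots> = (\<Sum>p'\<in>{0..<k}. (\<Sum>q\<in>{0..<k}. N $$ (p, q) * Ni $$ (q, p')) * A $$ (l ! p', j))"
        by (subst sum.swap) (simp add: sum_distrib_right)
      also have "\<dots> = (\<Sum>p'\<in>{0..<k}. (N * Ni) $$ (p, p') * A $$ (l ! p', j))"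
        using N Ni(1) p by (intro sum.cong) (auto simp: scalar_prod_def)
      also have "\<dots> = (\<Sum>p'\<in>{0..<k}. if p' = p then A $$ (l ! p, j) else 0)"
        using p by (intro sum.cong) (auto simp: Ni(2))
      finally show ?thesis using p by simp
    qed
    have "(A * b) $$ (i, j) = (\<Sum>q\<in>{0..<n}. A $$ (i, q) * b $$ (q, j))"
      using A bC \<open>i < n\<close> j by (auto simp: scalar_prod_def intro!: sum.cong)
    also have "\<dots> = (\<Sum>q\<in>insert j {0..<k}. A $$ (i, q) * b $$ (q, j))"
      by (rule sum.mono_neutral_right) (use j kn in \<open>auto simp: b_def\<close>)
    also have "\<dots> = A $$ (i, j) + (\<Sum>q\<in>{0..<k}. A $$ (i, q) * b $$ (q, j))"
      using j by (simp add: b_def)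
    also have "(\<Sum>q\<in>{0..<k}. A $$ (i, q) * b $$ (q, j)) = (\<Sum>q\<in>{0..<k}. - (A $$ (i, q) * u q j))"
      using j kn by (intro sum.cong) (auto simp: b_def)
    finally show ?thesis using Nu by (simp add: sum_negf)
  qed
  then show ?thesis using b by (auto simp: k_def)
qed

text \<open>Eliminate the rows in \<open>I\<close> from the later columns, apply the diagonal matrix, and rescale the two
  blocks of columns by an element of the Borel subgroup.  All entries are then polynomials in \<open>t\<close>,
  and at \<open>t = 0\<close> the matrix is block diagonal, still with determinant \<open>1\<close>.  This gives the limit
  of the moving flag explicitly, without an appeal to the completeness of the flag variety.\<close>

lemma degeneration_curve:
  assumes A: "A \<in> SL n" and I: "I \<subseteq> {..<n}" and nz: "flag_minor I A \<noteq> 0"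
  obtains C where "\<And>t. C t \<in> SL n" "\<And>i j. i < n \<Longrightarrow> j < n \<Longrightarrow> continuous_on UNIV (\<lambda>t. C t $$ (i, j))"
    "\<And>t. t \<noteq> 0 \<Longrightarrow> flag n (C t) = flag n (dmat n (\<lambda>i. t powi minor_weight n I i) * A)"
proof -
  have AC: "A \<in> carrier_mat n n" using A SL_carrier by blast
  obtain b where b: "b \<in> Borel n" and z: "\<And>i j. i \<in> I \<Longrightarrow> j < n \<Longrightarrow> card I \<le> j \<Longrightarrow> (A * b) $$ (i, j) = 0"
    using block_eliminate[OF AC I nz] by blast
  define k where "k = card I"
  have kn: "k \<le> n" using card_mono[OF _ I] by (simp add: k_def)
  define A1 where "A1 = A * b"
  have bC: "b \<in> carrier_mat n n" using b Borel_SL SL_carrier by blast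
  have A1: "A1 \<in> SL n" using A b Borel_SL SL_mult by (simp add: A1_def)
  then have A1C: "A1 \<in> carrier_mat n n" by (rule SL_carrier)
  define C where "C t = mat n n (\<lambda>(i, j). if (i \<in> I) = (j < k) then A1 $$ (i, j)
      else if i \<in> I then 0 else t ^ n * A1 $$ (i, j))" for t :: complex
  have CC: "C t \<in> carrier_mat n n" for t by (simp add: C_def)
  have cont: "continuous_on UNIV (\<lambda>t. C t $$ (i, j))" if "i < n" "j < n" for i j
    unfolding C_def using that
    by (cases "(i \<in> I) = (j < k)"; cases "i \<in> I"; simp; intro continuous_intros)
  define D where "D t = dmat n (\<lambda>i. t powi minor_weight n I i)" for t
  define E where "E t = dmat n (\<lambda>j. t powi (if j < k then int n - int k else - int k))" for t :: complex
  have D_SL: "D t \<in> SL n" if "t \<noteq> 0" for t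
    unfolding D_def by (rule dmat_SL) (simp only: prod_powi[OF that] minor_weight_total[OF I] power_int_0_right)
  have E_B: "E t \<in> Borel n" if "t \<noteq> 0" for t
    unfolding E_def
  proof (rule dmat_Borel)
    have "(\<Sum>j<n. if j < k then int n - int k else - int k) = (\<Sum>j<n. (if j < k then int n else 0) - int k)"
      by (intro sum.cong) auto
    also have "\<dots> = (\<Sum>j<n. if j < k then int n else 0) - int n * int k"
      by (simp add: sum_subtractf)
    also have "(\<Sum>j<n. if j < k then int n else 0) = (\<Sum>j<k. int n)"
      by (rule sum.mono_neutral_cong_right) (use kn in auto)
    finally have "(\<Sum>j<n. if j < k then int n - int k else - int k) = 0" by simp
    then show "(\<Prod>j<n. t powi (if j < k then int n - int k else - int k)) = 1"
      by (simp only: prod_powi[OF that] power_int_0_right)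
  qed
  have C_eq: "C t = D t * A1 * E t" if t: "t \<noteq> 0" for t
  proof (rule eq_matI)
    fix i j assume "i < dim_row (D t * A1 * E t)" "j < dim_col (D t * A1 * E t)"
    then have ij: "i < n" "j < n" by (auto simp: D_def E_def dmat_def)
    have "D t * A1 \<in> carrier_mat n n" using A1C by (simp add: D_def)
    then have "(D t * A1 * E t) $$ (i, j) =
        t powi minor_weight n I i * A1 $$ (i, j) * t powi (if j < k then int n - int k else - int k)"
      using ij unfolding E_def by (subst mult_dmat_index) (auto simp: D_def dmat_mult_index[OF A1C] simp del: index_mult_mat(1))
    also have "\<dots> = t powi (minor_weight n I i + (if j < k then int n - int k else - int k)) * A1 $$ (i, j)"
      using t by (simp add: power_int_add)
    also have "\<dots> = C t $$ (i, j)"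
    proof (cases "i \<in> I \<and> \<not> j < k")
      case True
      then show ?thesis using z[of i j] ij by (simp add: C_def A1_def k_def)
    next
      case False
      then have "minor_weight n I i + (if j < k then int n - int k else - int k) =
          (if (i \<in> I) = (j < k) then 0 else int n)" by (auto simp: minor_weight_def k_def)
      then show ?thesis using False ij by (auto simp: C_def)
    qed
    finally show "C t $$ (i, j) = (D t * A1 * E t) $$ (i, j)" by simp
  qed (auto simp: C_def D_def E_def dmat_def)
  have C_SL: "C t \<in> SL n" if "t \<noteq> 0" for t
    unfolding C_eq[OF that] by (intro SL_mult D_SL[OF that] A1 Borel_SL[OF E_B[OF that]])
  have "det (C 0) = 1"
  proof -
    have "continuous_on UNIV (\<lambda>t. det (C t))"
      unfolding det_def'[OF CC]
    proof (intro continuous_intros)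
      fix p i assume p: "p \<in> {p. p permutes {0..<n}}" and i: "i \<in> {0..<n}"
      then have "p i < n" by (metis atLeastLessThan_iff mem_Collect_eq permutes_in_image)
      then show "continuous_on UNIV (\<lambda>t. C t $$ (i, p i))" using cont i by auto
    qed
    then have "((\<lambda>t. det (C t)) \<longlongrightarrow> det (C 0)) (at 0)"
      by (simp add: continuous_on_def)
    moreover have "((\<lambda>t. det (C t)) \<longlongrightarrow> 1) (at 0)"
    proof (rule Lim_transform_eventually[OF tendsto_const])
      show "\<forall>\<^sub>F t in at 0. 1 = det (C t)"
        unfolding eventually_at_filter using C_SL by (auto simp: SL_def)
    qed
    ultimately show ?thesis using tendsto_unique[OF at_neq_bot] by blast
  qed
  then have SLC: "C t \<in> SL n" for t using C_SL[of t] CC by (cases "t = 0") (auto simp: SL_def)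
  have flagC: "flag n (C t) = flag n (D t * A)" if t: "t \<noteq> 0" for t
  proof -
    have DC: "D t \<in> carrier_mat n n" by (simp add: D_def)
    have "flag n (C t) = flag n (D t * A1)"
      unfolding C_eq[OF t] by (rule flag_mult_Borel[OF mult_carrier_mat[OF DC A1C] E_B[OF t]])
    also have "D t * A1 = (D t * A) * b"
      unfolding A1_def by (rule assoc_mult_mat[symmetric, OF DC AC bC])
    finally show ?thesis using flag_mult_Borel[OF mult_carrier_mat[OF DC AC] b] by simp
  qed
  show ?thesis by (rule that[of C, OF SLC cont flagC[unfolded D_def]])
qed

section \<open>Regular functions on the flag variety\<close>

definition nonvanishing :: "nat \<Rightarrow> complex mat set set \<Rightarrow> nat set \<Rightarrow> complex mat set set" where
  "nonvanishing n X J = flag n ` {A \<in> SL n. flag n A \<in> X \<and> flag_minor J A \<noteq> 0}"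

text \<open>The value does not depend on the matrix chosen in the coset if \<open>I\<close> and \<open>J\<close> have the same size.\<close>

definition minor_ratio :: "nat set \<Rightarrow> nat set \<Rightarrow> complex mat set \<Rightarrow> complex" where
  "minor_ratio I J F = (let A = SOME A. A \<in> F in flag_minor I A / flag_minor J A)"

lemma flag_minor_same_flag:
  assumes "flag n A = flag n A'" "A \<in> SL n" "A' \<in> SL n" "I \<subseteq> {..<n}"
  shows "\<exists>c. c \<noteq> 0 \<and> (\<forall>J. J \<subseteq> {..<n} \<longrightarrow> card J = card I \<longrightarrow> flag_minor J A' = c * flag_minor J A)"
  using flag_eqD[OF assms(1) SL_carrier[OF assms(3)]]
    flag_minor_mult_Borel[OF SL_carrier[OF assms(2)] _ assms(4)] by blast

lemma nonvanishing_iff: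
  assumes "A \<in> SL n" "J \<subseteq> {..<n}"
  shows "flag n A \<in> nonvanishing n X J \<longleftrightarrow> flag n A \<in> X \<and> flag_minor J A \<noteq> 0"
proof
  assume "flag n A \<in> nonvanishing n X J"
  then obtain A' where "A' \<in> SL n" "flag n A' = flag n A" "flag n A \<in> X" "flag_minor J A' \<noteq> 0"
    unfolding nonvanishing_def by auto
  then show "flag n A \<in> X \<and> flag_minor J A \<noteq> 0"
    using flag_minor_same_flag[OF _ assms(1) _ assms(2), of A'] assms(2) by fastforce
qed (use assms in \<open>auto simp: nonvanishing_def\<close>)

lemma minor_ratio_flag:
  assumes "A \<in> SL n" "I \<subseteq> {..<n}" "J \<subseteq> {..<n}" "card I = card J"
  shows "minor_ratio I J (flag n A) = flag_minor I A / flag_minor J A"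
proof -
  define A' where "A' = (SOME A'. A' \<in> flag n A)"
  have "A' \<in> flag n A" unfolding A'_def by (rule someI[of _ A]) (rule flag_self[OF SL_carrier[OF assms(1)]])
  then obtain b where "b \<in> Borel n" "A' = A * b" by (auto simp: flag_def)
  then show ?thesis
    using flag_minor_mult_Borel[OF SL_carrier[OF assms(1)] _ assms(2), of b] assms
    unfolding minor_ratio_def Let_def A'_def[symmetric] by fastforce
qed

lemma points_flag_var: "X \<subseteq> Fl n \<Longrightarrow> points (flag_var n X) = X"
  unfolding points_def flag_var_def Fl_def by auto

lemma lift_set_flag_var: "lift_set (flag_var n X) U = {A \<in> SL n. flag n A \<in> X \<and> flag n A \<in> U}"
  unfolding lift_set_def flag_var_def by auto

lemma open_in_nonvanishing:
  assumes "X \<subseteq> Fl n" "J \<subseteq> {..<n}"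
  shows "open_in (flag_var n X) (nonvanishing n X J)"
proof -
  have "lift_set (flag_var n X) (nonvanishing n X J) = {A \<in> cover (flag_var n X). \<exists>P\<in>{flag_minor J}. P A \<noteq> 0}"
    unfolding lift_set_flag_var using nonvanishing_iff[OF _ assms(2)] by (auto simp: flag_var_def)
  moreover have "{flag_minor J} \<subseteq> gen_algebra (coords (flag_var n X))"
    using flag_minor_gen_algebra[OF assms(2)] by (simp add: flag_var_def)
  moreover have "nonvanishing n X J \<subseteq> X" unfolding nonvanishing_def by auto
  ultimately show ?thesis
    unfolding open_in_def zariski_open_def using points_flag_var[OF assms(1)] by blast
qed

lemma regular_minor_ratio:
  assumes "I \<subseteq> {..<n}" "J \<subseteq> {..<n}" "card I = card J"
  shows "regular_fun (flag_var n X) (nonvanishing n X J) (minor_ratio I J)"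
  unfolding regular_fun_def
proof (rule regular_onI_global)
  show "flag_minor I \<in> gen_algebra (coords (flag_var n X))" "flag_minor J \<in> gen_algebra (coords (flag_var n X))"
    using flag_minor_gen_algebra assms by (simp_all add: flag_var_def)
  fix A assume A: "A \<in> lift_set (flag_var n X) (nonvanishing n X J)"
  then show "flag_minor J A \<noteq> 0"
    unfolding lift_set_flag_var using nonvanishing_iff[OF _ assms(2)] by auto
  show "minor_ratio I J (proj (flag_var n X) A) = flag_minor I A / flag_minor J A"
    using A minor_ratio_flag[OF _ assms] unfolding lift_set_flag_var by (simp add: flag_var_def)
qed

lemma richardson_subset_Fl: "richardson n v w \<subseteq> Fl n"
  unfolding richardson_def schubert_cell_def Fl_def
  using SL_mult Borel_SL by (auto simp: perm_mats_def)

lemma richardson_subset_closed: "richardson n v w \<subseteq> closed_richardson n v w"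
  unfolding closed_richardson_def by blast

lemma closed_richardson_subset_Fl: "closed_richardson n v w \<subseteq> Fl n"
proof -
  have "lift_set (flag_var n (Fl n)) {} = {y \<in> cover (flag_var n (Fl n)). \<exists>P\<in>{}. P y \<noteq> 0}"
    by (simp add: lift_set_def)
  then have "open_in (flag_var n (Fl n)) {}"
    unfolding open_in_def zariski_open_def by blast
  then have "closed_in (flag_var n (Fl n)) (Fl n)"
    unfolding closed_in_def by (simp add: points_flag_var)
  then show ?thesis unfolding closed_richardson_def using richardson_subset_Fl by blast
qed

lemma nonzero_in_open:
  fixes S :: "complex set"
  assumes "open S" "0 \<in> S"
  obtains t where "t \<in> S" "t \<noteq> 0"
proof -
  have "S \<noteq> {0}" using assms(1) not_open_singleton by metis
  then show ?thesis using assms(2) that by blast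
qed

text \<open>An open neighbourhood of the flag at \<open>0\<close> contains flags of the curve with \<open>t \<noteq> 0\<close>.\<close>

lemma curve_limit_in_closed_richardson:
  fixes C :: "complex \<Rightarrow> complex mat"
  assumes C: "\<And>t. C t \<in> SL n" "\<And>i j. i < n \<Longrightarrow> j < n \<Longrightarrow> continuous_on UNIV (\<lambda>t. C t $$ (i, j))"
    and R: "\<And>t. t \<noteq> 0 \<Longrightarrow> flag n (C t) \<in> richardson n v w"
  shows "flag n (C t) \<in> closed_richardson n v w"
proof (cases "t = 0")
  case False then show ?thesis using R richardson_subset_closed by blast
next
  case True
  have "flag n (C 0) \<in> Z" if Z: "closed_in (flag_var n (Fl n)) Z" "richardson n v w \<subseteq> Z" for Z
  proof (rule ccontr)
    assume nZ: "flag n (C 0) \<notin> Z"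
    define U where "U = lift_set (flag_var n (Fl n)) (Fl n - Z)"
    have "cover (flag_var n (Fl n)) = SL n" "coords (flag_var n (Fl n)) = entries n"
      by (auto simp: flag_var_def Fl_def)
    then have "zariski_open (entries n) (SL n) U"
      using Z(1) unfolding closed_in_def open_in_def points_flag_var[OF order_refl] U_def by metis
    then have "open {t \<in> UNIV. C t \<in> U}"
      by (rule zariski_open_preimage_open) (use C in \<open>auto simp: entries_def\<close>)
    moreover have U: "C t \<in> U \<longleftrightarrow> flag n (C t) \<notin> Z" for t
      unfolding U_def lift_set_flag_var using C(1) by (auto simp: Fl_def)
    ultimately obtain t where "t \<noteq> 0" "flag n (C t) \<notin> Z"
      using nZ nonzero_in_open[of "{t \<in> UNIV. C t \<in> U}"] by auto
    then show False using R Z(2) by blast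
  qed
  then show ?thesis using True unfolding closed_richardson_def by blast
qed

section \<open>Flag minors on a Richardson torus\<close>

locale richardson_torus_chart =
  fixes n d :: nat and v w :: "nat \<Rightarrow> nat"
    and \<psi> :: "(nat \<Rightarrow> complex) \<Rightarrow> complex mat set"
    and M :: "(nat \<Rightarrow> complex) \<Rightarrow> complex mat"
  assumes torus: "richardson_torus n v w d \<psi>"
    and reps: "regular_representatives n d \<psi> M"
begin

abbreviation "R \<equiv> richardson n v w"
abbreviation "X \<equiv> closed_richardson n v w"

lemma M_SL: "x \<in> torus d \<Longrightarrow> M x \<in> SL n"
  and flag_M: "x \<in> torus d \<Longrightarrow> flag n (M x) = \<psi> x"
  using reps unfolding regular_representatives_def by auto

lemma M_regular: "i < n \<Longrightarrow> j < n \<Longrightarrow> regular_on (torus_coords d) (torus d) (\<lambda>x. M x $$ (i, j))"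
  using reps unfolding regular_representatives_def regular_fun_def
  by (simp add: torus_var_def lift_set_def)

lemma minor_regular:
  assumes "I \<subseteq> {..<n}"
  shows "regular_on (torus_coords d) (torus d) (\<lambda>x. flag_minor I (M x))"
  by (rule gen_algebra_compose[OF flag_minor_gen_algebra[OF assms]]) (auto simp: entries_def M_regular)

lemma points_torus: "points (torus_var d) = torus d"
  by (simp add: points_def torus_var_def)

lemma bij: "bij_betw \<psi> (torus d) R"
  using torus unfolding richardson_torus_def isomorphism_def points_torus
  by (simp add: points_flag_var[OF richardson_subset_Fl])

abbreviation "\<psi>inv \<equiv> inv_into (torus d) \<psi>"

lemma chart_inverse: "F \<in> R \<Longrightarrow> \<psi>inv F \<in> torus d" "F \<in> R \<Longrightarrow> \<psi> (\<psi>inv F) = F" "x \<in> torus d \<Longrightarrow> \<psi>inv (\<psi> x) = x"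
  "x \<in> torus d \<Longrightarrow> \<psi> x \<in> R"
  using bij by (auto simp: bij_betw_def inv_into_into f_inv_into_f)

lemma coordinate_regular:
  assumes "i < d"
  shows "regular_on (entries n) {A \<in> SL n. flag n A \<in> R} (\<lambda>A. \<psi>inv (flag n A) i)"
proof -
  have m: "morphism (flag_var n R) (torus_var d) \<psi>inv"
    using torus unfolding richardson_torus_def isomorphism_def points_torus by simp
  have "zariski_open (torus_coords d) (torus d) (torus d)"
    unfolding zariski_open_def
    by (rule exI[of _ "{\<lambda>_. 1}"]) (auto intro: gen_algebra.const)
  then have "open_in (torus_var d) (torus d)"
    unfolding open_in_def points_torus by (simp add: torus_var_def lift_set_def)
  moreover have "regular_fun (torus_var d) (torus d) (\<lambda>x. x i)"
    unfolding regular_fun_def by (rule regular_on_gen) (use assms in \<open>auto simp: torus_var_def\<close>)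
  ultimately have "regular_fun (flag_var n R) {p \<in> points (flag_var n R). \<psi>inv p \<in> torus d} (\<lambda>p. \<psi>inv p i)"
    using m unfolding morphism_def by blast
  moreover have "{p \<in> points (flag_var n R). \<psi>inv p \<in> torus d} = R"
    using chart_inverse(1) by (auto simp: points_flag_var[OF richardson_subset_Fl])
  ultimately have "regular_fun (flag_var n R) R (\<lambda>p. \<psi>inv p i)" by simp
  then show ?thesis
    unfolding regular_fun_def lift_set_flag_var by (simp add: flag_var_def)
qed

text \<open>The coordinates of the translated point are nowhere vanishing regular functions of \<open>t\<close> and \<open>x\<close>
  together, hence monomials in \<open>d + 1\<close> variables; at \<open>t = 1\<close> they reduce to the coordinates of \<open>x\<close>.\<close>

lemma cocharacter:
  assumes wt: "(\<Sum>i<n. wt i) = (0::int)"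
  obtains a :: "nat \<Rightarrow> int" where "\<And>t x. t \<noteq> 0 \<Longrightarrow> x \<in> torus d \<Longrightarrow>
    flag n (dmat n (\<lambda>i. t powi wt i) * M x) = \<psi> (\<lambda>i. if i < d then t powi a i * x i else 1)"
proof -
  define tr where "tr y = (\<lambda>j. if j < d then y j else 1)" for y :: "nat \<Rightarrow> complex"
  (* the last coordinate of y plays the role of t *)
  define G where "G y = dmat n (\<lambda>i. y d powi wt i) * M (tr y)" for y
  have tr: "tr y \<in> torus d" and yd: "y d \<noteq> 0" if "y \<in> torus (Suc d)" for y
    using that by (auto simp: torus_def tr_def)
  have dm: "(\<Prod>i<n. t powi wt i) = 1" if "t \<noteq> 0" for t :: complex
    by (simp only: prod_powi[OF that] wt power_int_0_right)
  have G_SL: "G y \<in> SL n" and G_R: "flag n (G y) \<in> R" if y: "y \<in> torus (Suc d)" for y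
    unfolding G_def
    by (intro SL_mult dmat_SL dm yd[OF y] M_SL[OF tr[OF y]])
       (intro richardson_dmat dm yd[OF y] M_SL[OF tr[OF y]], simp add: flag_M[OF tr[OF y]] chart_inverse(4)[OF tr[OF y]])
  have G_reg: "regular_on (torus_coords (Suc d)) (torus (Suc d)) (\<lambda>y. G y $$ (i, j))" if ij: "i < n" "j < n" for i j
  proof -
    have "regular_on (torus_coords (Suc d)) (torus (Suc d)) (\<lambda>y. M (tr y) $$ (i, j))"
    proof (rule regular_on_compose[OF M_regular[OF ij]])
      fix c assume "c \<in> torus_coords d"
      then obtain l where "c = (\<lambda>x. x l)" "l < d" by blast
      then show "regular_on (torus_coords (Suc d)) (torus (Suc d)) (\<lambda>y. c (tr y))"
        by (auto simp: tr_def intro!: regular_on_gen)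
    qed (use tr in auto)
    moreover have "regular_on (torus_coords (Suc d)) (torus (Suc d)) (\<lambda>y. y d powi wt i)"
      by (intro regular_on_powi regular_on_gen yd) auto
    ultimately have "regular_on (torus_coords (Suc d)) (torus (Suc d)) (\<lambda>y. y d powi wt i * M (tr y) $$ (i, j))"
      by (intro regular_on_mult)
    then show ?thesis
      by (rule regular_on_cong[THEN iffD1, rotated])
         (simp add: G_def dmat_mult_index[OF SL_carrier[OF M_SL[OF tr]] ij] del: index_mult_mat)
  qed
  have "\<exists>a. \<forall>t x. t \<noteq> 0 \<longrightarrow> x \<in> torus d \<longrightarrow>
      \<psi>inv (flag n (dmat n (\<lambda>i. t powi wt i) * M x)) i = t powi a * x i" if i: "i < d" for i
  proof -
    have "regular_on (torus_coords (Suc d)) (torus (Suc d)) (\<lambda>y. \<psi>inv (flag n (G y)) i)"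
      by (rule regular_on_compose[OF coordinate_regular[OF i], of G]) 
         (use G_SL G_R in \<open>auto simp: entries_def intro!: G_reg\<close>)
    moreover have "\<psi>inv (flag n (G y)) i \<noteq> 0" if "y \<in> torus (Suc d)" for y
      using chart_inverse(1)[OF G_R[OF that]] i by (auto simp: torus_def)
    ultimately obtain m c where m: "\<And>y. y \<in> torus (Suc d) \<Longrightarrow> \<psi>inv (flag n (G y)) i = c * monomial (Suc d) m y"
      using unit_torus_monomial[of "Suc d" "\<lambda>y. \<psi>inv (flag n (G y)) i"] by blast
    have key: "\<psi>inv (flag n (dmat n (\<lambda>i. t powi wt i) * M x)) i = c * monomial d m x * t powi m d"
      if t: "t \<noteq> 0" and x: "x \<in> torus d" for t x
    proof -
      define y where "y = x(d := t)"
      have "y \<in> torus (Suc d)" "tr y = x" "y d = t"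
        using t x by (auto simp: y_def torus_def tr_def fun_eq_iff)
      moreover have "monomial (Suc d) m y = monomial d m x * t powi m d"
        by (simp add: monomial_def y_def)
      ultimately show ?thesis using m[of y] by (simp add: G_def)
    qed
    have "c * monomial d m x = x i" if x: "x \<in> torus d" for x
      using key[OF one_neq_zero x] by (simp add: dmat_one_mult[OF SL_carrier[OF M_SL[OF x]]] flag_M[OF x] chart_inverse(3)[OF x])
    then show ?thesis using key by (intro exI[of _ "m d"]) simp
  qed
  then obtain a where a: "\<And>i t x. i < d \<Longrightarrow> t \<noteq> 0 \<Longrightarrow> x \<in> torus d \<Longrightarrow>
      \<psi>inv (flag n (dmat n (\<lambda>i. t powi wt i) * M x)) i = t powi a i * x i" by metis
  show ?thesis
  proof (rule that[of a])
    fix t :: complex and x assume t: "t \<noteq> 0" and x: "x \<in> torus d"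
    define F where "F = flag n (dmat n (\<lambda>i. t powi wt i) * M x)"
    have F: "F \<in> R" unfolding F_def
      by (intro richardson_dmat dm t M_SL[OF x]) (simp add: flag_M[OF x] chart_inverse(4)[OF x])
    have "\<psi>inv F = (\<lambda>i. if i < d then t powi a i * x i else 1)"
      using chart_inverse(1)[OF F] a[OF _ t x] by (auto simp: fun_eq_iff torus_def F_def)
    then show "flag n (dmat n (\<lambda>i. t powi wt i) * M x) = \<psi> (\<lambda>i. if i < d then t powi a i * x i else 1)"
      using chart_inverse(2)[OF F] unfolding F_def by simp
  qed
qed

end

lemma morphism_preimage_open:
  assumes "morphism Y Z \<phi>" "open_in Z U"
  shows "zariski_open (coords Y) (cover Y) {y \<in> cover Y. \<phi> (proj Y y) \<in> U}"
proof -
  have "open_in Y {p \<in> points Y. \<phi> p \<in> U}" using assms unfolding morphism_def by blast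
  moreover have "lift_set Y {p \<in> points Y. \<phi> p \<in> U} = {y \<in> cover Y. \<phi> (proj Y y) \<in> U}"
    by (auto simp: lift_set_def points_def)
  ultimately show ?thesis by (simp add: open_in_def)
qed

lemma morphism_pullback_regular:
  assumes "morphism Y Z \<phi>" "open_in Z U" "regular_fun Z U f"
  shows "regular_on (coords Y) {y \<in> cover Y. \<phi> (proj Y y) \<in> U} (\<lambda>y. f (\<phi> (proj Y y)))"
proof -
  have "regular_fun Y {p \<in> points Y. \<phi> p \<in> U} (\<lambda>p. f (\<phi> p))"
    using assms unfolding morphism_def by blast
  moreover have "lift_set Y {p \<in> points Y. \<phi> p \<in> U} = {y \<in> cover Y. \<phi> (proj Y y) \<in> U}"
    by (auto simp: lift_set_def points_def)
  ultimately show ?thesis by (simp add: regular_fun_def)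
qed

lemma morphism_points: "morphism Y Z \<phi> \<Longrightarrow> p \<in> points Y \<Longrightarrow> \<phi> p \<in> points Z"
  unfolding morphism_def by blast

text \<open>Otherwise \<open>H\<close> would be unbounded near \<open>0\<close>.\<close>

lemma constant_vanishes_at_pole:
  fixes H :: "complex \<Rightarrow> complex"
  assumes W: "open W" "0 \<in> W" and H: "continuous_on W H" and m: "m < 0"
    and eq: "\<And>t. t \<in> W \<Longrightarrow> t \<noteq> 0 \<Longrightarrow> H t = t powi m * c"
  shows "c = 0"
proof -
  have "(H \<longlongrightarrow> H 0) (at 0)"
    using H W by (metis at_within_open continuous_on_def)
  then have "((\<lambda>t. t ^ nat (- m) * H t) \<longlongrightarrow> 0 ^ nat (- m) * H 0) (at 0)"
    by (intro tendsto_mult tendsto_power tendsto_ident_at)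
  then have "((\<lambda>t. t ^ nat (- m) * H t) \<longlongrightarrow> 0) (at 0)" using m by (simp add: zero_power)
  moreover have "((\<lambda>t. t ^ nat (- m) * H t) \<longlongrightarrow> c) (at 0)"
  proof (rule Lim_transform_eventually[OF tendsto_const])
    have "\<forall>\<^sub>F t in at 0. t \<in> W" unfolding eventually_at_topological using W by blast
    moreover have "\<forall>\<^sub>F t in at (0::complex). t \<noteq> 0" by (simp add: eventually_at_filter)
    ultimately show "\<forall>\<^sub>F t in at 0. c = t ^ nat (- m) * H t"
    proof eventually_elim
      case (elim t)
      have "t ^ nat (- m) * H t = t powi (- m) * t powi m * c"
        using eq[OF elim] m by (simp add: power_int_def)
      also have "\<dots> = c" using elim(2) by (simp add: power_int_minus)
      finally show ?case by simp
    qed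
  qed
  ultimately show ?thesis using tendsto_unique[OF at_neq_bot] by blast
qed

context richardson_torus_chart
begin

text \<open>Along the line, both the vanishing and the nonvanishing of the minor are open conditions on
  \<open>z \<noteq> 0\<close>.  The point of the line with parameter \<open>z\<close> is the translate of \<open>x\<close> by \<open>s z\<close>, and
  \<open>\<Phi> z 0\<close> is the translate by \<open>s z\<close> of the limit of the diagonal degeneration of \<open>x\<close>.  If the
  minor vanishes at \<open>z\<close>, another minor \<open>J\<close> of the same size is nonzero at \<open>\<Phi> z 0\<close>, hence also at
  \<open>\<Phi> z' 0\<close> for \<open>z'\<close> near \<open>z\<close>; a nonzero value of the minor \<open>I\<close> at \<open>z'\<close> would make its ratio to
  the minor \<open>J\<close> unbounded along the degeneration.\<close>

lemma minor_nonvanishing_line: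
  assumes x: "x \<in> torus d" and i: "i < d" and I: "I \<subseteq> {..<n}"
    and nz: "flag_minor I (M x) \<noteq> 0" and z: "z \<noteq> 0"
  shows "flag_minor I (M (x(i := z))) \<noteq> 0"
proof -
  obtain a where act: "torus_action d n X a"
    and a: "\<And>s y. s \<in> torus d \<Longrightarrow> y \<in> torus d \<Longrightarrow> a s (\<psi> y) = \<psi> (\<lambda>j. s j * y j)"
    using torus unfolding richardson_torus_def by blast
  define \<A> where "\<A> = (\<lambda>(s, p). a s p)"
  have mor: "morphism (torus_flag_var d n X) (flag_var n X) \<A>"
    using act unfolding torus_action_def \<A>_def by blast
  define D where "D t = dmat n (\<lambda>j. t powi minor_weight n I j)" for t
  obtain \<chi> where \<chi>: "\<And>t y. t \<noteq> 0 \<Longrightarrow> y \<in> torus d \<Longrightarrow>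
      flag n (D t * M y) = \<psi> (\<lambda>j. if j < d then t powi \<chi> j * y j else 1)"
    using cocharacter[OF minor_weight_total[OF I]] unfolding D_def by metis
  obtain C where C_SL: "\<And>t. C t \<in> SL n"
    and C_cont: "\<And>i j. i < n \<Longrightarrow> j < n \<Longrightarrow> continuous_on UNIV (\<lambda>t. C t $$ (i, j))"
    and C_flag: "\<And>t. t \<noteq> 0 \<Longrightarrow> flag n (C t) = flag n (D t * M x)"
    using degeneration_curve[OF M_SL[OF x] I nz] unfolding D_def by metis
  have dm: "(\<Prod>j<n. t powi minor_weight n I j) = 1" if "t \<noteq> 0" for t :: complex
    by (simp only: prod_powi[OF that] minor_weight_total[OF I] power_int_0_right)
  have D_SL: "D t * M y \<in> SL n" if "t \<noteq> 0" "y \<in> torus d" for t y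
    unfolding D_def by (intro SL_mult dmat_SL dm that M_SL)
  have D_R: "flag n (D t * M y) \<in> R" if "t \<noteq> 0" "y \<in> torus d" for t y
    unfolding D_def by (intro richardson_dmat dm that M_SL) (simp add: flag_M that chart_inverse)
  have C_R: "flag n (C t) \<in> R" if "t \<noteq> 0" for t
    using C_flag[OF that] D_R[OF that x] by simp
  have C_X: "flag n (C t) \<in> X" for t
    by (rule curve_limit_in_closed_richardson[OF C_SL C_cont C_R])
  define xz where "xz z = x(i := z)" for z
  have xz: "xz z \<in> torus d" if "z \<noteq> 0" for z
    unfolding xz_def using torus_upd[OF x i that] .
  define s where "s z = (\<lambda>_. 1)(i := z / x i)" for z
  have xi: "x i \<noteq> 0" using x i by (auto simp: torus_def)
  have s: "s z \<in> torus d" if "z \<noteq> 0" for z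
    using that xi i by (auto simp: s_def torus_def)
  define \<Phi> where "\<Phi> z t = a (s z) (flag n (C t))" for z t
  have \<Phi>: "\<Phi> z t = flag n (D t * M (xz z))" if "z \<noteq> 0" "t \<noteq> 0" for z t
  proof -
    define y where "y = (\<lambda>j. if j < d then t powi \<chi> j * x j else 1)"
    have "y \<in> torus d" using x that by (auto simp: y_def torus_def)
    then have "\<Phi> z t = \<psi> (\<lambda>j. s z j * y j)"
      unfolding \<Phi>_def C_flag[OF that(2)] \<chi>[OF that(2) x] y_def[symmetric]
      by (rule a[OF s[OF that(1)]])
    also have "(\<lambda>j. s z j * y j) = (\<lambda>j. if j < d then t powi \<chi> j * xz z j else 1)"
      using xi i by (auto simp: fun_eq_iff s_def y_def xz_def)
    finally show ?thesis using \<chi>[OF that(2) xz[OF that(1)]] by simp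
  qed
  have cover: "(s z, C t) \<in> cover (torus_flag_var d n X)" if "z \<noteq> 0" for z t
    using s[OF that] C_SL C_X by (auto simp: torus_flag_var_def)
  have proj: "\<A> (proj (torus_flag_var d n X) (s z, C t)) = \<Phi> z t" for z t
    by (simp add: torus_flag_var_def \<A>_def \<Phi>_def)
  have coord_t: "continuous_on W (\<lambda>t. c (s z, C t))" if "c \<in> coords (torus_flag_var d n X)" for c z W
    using that by (auto simp: torus_flag_var_def entries_def intro: continuous_on_subset[OF C_cont])
  have coord_z: "continuous_on W (\<lambda>z. c (s z, C t))" if "c \<in> coords (torus_flag_var d n X)" for c t W
  proof -
    have "continuous_on W (\<lambda>z. s z j)" for j
      using xi by (cases "j = i") (auto simp: s_def intro!: continuous_intros)
    then show ?thesis using that by (auto simp: torus_flag_var_def entries_def)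
  qed
  define U where "U J = nonvanishing n X J" for J
  have U_open: "open_in (flag_var n X) (U J)" if "J \<subseteq> {..<n}" for J
    unfolding U_def by (rule open_in_nonvanishing[OF closed_richardson_subset_Fl that])
  have U_iff: "\<Phi> z t \<in> U J \<longleftrightarrow> flag_minor J (M (xz z)) \<noteq> 0"
    if "z \<noteq> 0" "t \<noteq> 0" "J \<subseteq> {..<n}" for z t J
  proof -
    have "(\<Prod>j\<in>J. t powi minor_weight n I j) \<noteq> 0"
      unfolding prod_powi[OF that(2)] using that(2) by simp
    then have "flag_minor J (D t * M (xz z)) \<noteq> 0 \<longleftrightarrow> flag_minor J (M (xz z)) \<noteq> 0"
      using flag_minor_dmat[OF SL_carrier[OF M_SL[OF xz[OF that(1)]]] that(3)] by (simp add: D_def)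
    then show ?thesis
      unfolding \<Phi>[OF that(1,2)] U_def nonvanishing_iff[OF D_SL[OF that(2) xz[OF that(1)]] that(3)]
      using D_R[OF that(2) xz[OF that(1)]] richardson_subset_closed by blast
  qed
  have open_t: "open {t. \<Phi> z t \<in> U J}" if "z \<noteq> 0" "J \<subseteq> {..<n}" for z J
  proof -
    have "open {t \<in> UNIV. (s z, C t) \<in> {y \<in> cover (torus_flag_var d n X). \<A> (proj (torus_flag_var d n X) y) \<in> U J}}"
      by (rule zariski_open_preimage_open[OF morphism_preimage_open[OF mor U_open[OF that(2)]]])
         (use cover[OF that(1)] coord_t in auto)
    then show ?thesis using cover[OF that(1)] by (simp add: proj)
  qed
  have open_z: "open {z \<in> - {0}. \<Phi> z t \<in> U J}" if "J \<subseteq> {..<n}" for t J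
  proof -
    have "open {z \<in> - {0}. (s z, C t) \<in> {y \<in> cover (torus_flag_var d n X). \<A> (proj (torus_flag_var d n X) y) \<in> U J}}"
      by (rule zariski_open_preimage_open[OF morphism_preimage_open[OF mor U_open[OF that]]])
         (use cover coord_z in auto)
    moreover have "{z \<in> - {0}. (s z, C t) \<in> {y \<in> cover (torus_flag_var d n X). \<A> (proj (torus_flag_var d n X) y) \<in> U J}}
        = {z \<in> - {0}. \<Phi> z t \<in> U J}" using cover by (auto simp: proj)
    ultimately show ?thesis by simp
  qed
  define f where "f z = flag_minor I (M (xz z))" for z
  (* a nonzero minor J at the limit flag other than I forces f to vanish *)
  have vanish: "f z = 0" if z: "z \<noteq> 0" and J: "J \<subseteq> {..<n}" "card J = card I" "J \<noteq> I" and lim: "\<Phi> z 0 \<in> U J" for z J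
  proof -
    define W where "W = {t. \<Phi> z t \<in> U J}"
    have W: "open W" "0 \<in> W" unfolding W_def using open_t[OF z J(1)] lim by auto
    define H where "H t = minor_ratio I J (\<Phi> z t)" for t
    have reg: "regular_fun (flag_var n X) (U J) (minor_ratio I J)"
      unfolding U_def by (rule regular_minor_ratio[OF I J(1) J(2)[symmetric]])
    have "continuous_on W (\<lambda>t. minor_ratio I J (\<A> (proj (torus_flag_var d n X) (s z, C t))))"
      by (rule regular_on_continuous[OF morphism_pullback_regular[OF mor U_open[OF J(1)]
            reg]])
         (use cover[OF z] coord_t in \<open>auto simp: proj W_def\<close>)
    then have H: "continuous_on W H" by (simp add: proj H_def[abs_def])
    define m where "m = (\<Sum>j\<in>I. minor_weight n I j) - (\<Sum>j\<in>J. minor_weight n I j)"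
    define c where "c = f z / flag_minor J (M (xz z))"
    have MC: "M (xz z) \<in> carrier_mat n n" by (rule SL_carrier[OF M_SL[OF xz[OF z]]])
    have "H t = t powi m * c" if t: "t \<noteq> 0" for t
    proof -
      have "H t = flag_minor I (D t * M (xz z)) / flag_minor J (D t * M (xz z))"
        unfolding H_def \<Phi>[OF z t] by (rule minor_ratio_flag[OF D_SL[OF t xz[OF z]] I J(1) J(2)[symmetric]])
      then show ?thesis
        unfolding D_def flag_minor_dmat[OF MC I] flag_minor_dmat[OF MC J(1)] prod_powi[OF t]
        using t by (simp add: m_def c_def f_def power_int_diff)
    qed
    moreover have "m < 0" using minor_weight_less[OF I J] by (simp add: m_def)
    ultimately have "c = 0" using constant_vanishes_at_pole[OF W H] by blast
    moreover obtain t where "t \<in> W" "t \<noteq> 0" using nonzero_in_open[OF W] .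
    then have "flag_minor J (M (xz z)) \<noteq> 0" using U_iff[OF z _ J(1)] by (simp add: W_def)
    ultimately show ?thesis by (simp add: c_def)
  qed
  have cont_f: "continuous_on (- {0}) f"
    unfolding f_def
  proof (rule gen_algebra_continuous[OF flag_minor_gen_algebra[OF I]])
    fix c assume "c \<in> entries n"
    then obtain k l where c: "c = (\<lambda>A. A $$ (k, l))" "k < n" "l < n" by (auto simp: entries_def)
    show "continuous_on (- {0}) (\<lambda>z. c (M (xz z)))"
      unfolding c(1)
    proof (rule regular_on_continuous[OF M_regular[OF c(2,3)]])
      fix e assume "e \<in> torus_coords d"
      then obtain j where "e = (\<lambda>x. x j)" by blast
      then show "continuous_on (- {0}) (\<lambda>z. e (xz z))"
        by (cases "j = i") (auto simp: xz_def intro!: continuous_intros)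
    qed (use xz in auto)
  qed
  have open_nz: "open {z \<in> - {0}. f z \<noteq> 0}"
  proof -
    have "open (f -` (- {0}) \<inter> - {0})"
      using cont_f unfolding continuous_on_open_vimage[OF open_Compl[OF closed_singleton]]
      by (simp add: open_Compl)
    moreover have "f -` (- {0}) \<inter> - {0} = {z \<in> - {0}. f z \<noteq> 0}" by auto
    ultimately show ?thesis by simp
  qed
  have open_zero: "open {z \<in> - {0}. f z = 0}"
  proof (rule openI)
    fix z1 assume "z1 \<in> {z \<in> - {0}. f z = 0}"
    then have z1: "z1 \<noteq> 0" "f z1 = 0" by auto
    have "\<Phi> z1 0 \<in> points (flag_var n X)"
      unfolding proj[symmetric] by (rule morphism_points[OF mor]) (use cover[OF z1(1)] in \<open>auto simp: points_def\<close>)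
    then obtain A where A: "A \<in> SL n" "flag n A = \<Phi> z1 0" "flag n A \<in> X"
      by (auto simp: points_def flag_var_def)
    have "card I \<le> n" using card_mono[OF _ I] by simp
    then obtain J where J: "J \<subseteq> {..<n}" "card J = card I" "flag_minor J A \<noteq> 0"
      using exists_flag_minor_nonzero[OF SL_carrier[OF A(1)], of "card I"] A(1) by (auto simp: SL_def)
    have lim: "\<Phi> z1 0 \<in> U J"
      using nonvanishing_iff[OF A(1) J(1), of X] A J by (simp add: U_def)
    have "J \<noteq> I"
    proof
      assume "J = I"
      then obtain t where "t \<noteq> 0" "\<Phi> z1 t \<in> U I"
        using nonzero_in_open[OF open_t[OF z1(1) I]] lim by auto
      then show False using U_iff[OF z1(1) _ I] z1(2) by (simp add: f_def)
    qed
    then have "{z \<in> - {0}. \<Phi> z 0 \<in> U J} \<subseteq> {z \<in> - {0}. f z = 0}" using vanish J by auto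
    moreover have "z1 \<in> {z \<in> - {0}. \<Phi> z 0 \<in> U J}" using z1 lim by simp
    ultimately show "\<exists>T. open T \<and> z1 \<in> T \<and> T \<subseteq> {z \<in> - {0}. f z = 0}"
      using open_z[OF J(1)] by blast
  qed
  have "f (x i) \<noteq> 0" using nz by (simp add: f_def xz_def)
  then have ne: "{z \<in> - {0}. f z \<noteq> 0} \<inter> - {0} \<noteq> {}" using xi by auto
  have "{z \<in> - {0}. f z = 0} \<inter> - {0} = {}"
    using connectedD[OF connected_punctured_plane open_nz open_zero] ne by auto
  then show ?thesis using z by (auto simp: f_def xz_def)
qed

text \<open>Two points of the torus are joined by \<open>d\<close> coordinate lines.\<close>

lemma minor_nonvanishing:
  assumes x: "x \<in> torus d" and y: "y \<in> torus d" and I: "I \<subseteq> {..<n}" and nz: "flag_minor I (M x) \<noteq> 0"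
  shows "flag_minor I (M y) \<noteq> 0"
proof -
  define mix where "mix e = (\<lambda>j. if j < e then y j else x j)" for e
  have mix: "mix e \<in> torus d" for e using x y by (auto simp: mix_def torus_def)
  have "flag_minor I (M (mix e)) \<noteq> 0" if "e \<le> d" for e
    using that
  proof (induction e)
    case 0 then show ?case using nz by (simp add: mix_def)
  next
    case (Suc e)
    have mix_Suc: "mix (Suc e) = (mix e)(e := y e)" by (auto simp: mix_def fun_eq_iff less_Suc_eq)
    have "y e \<noteq> 0" using y Suc by (auto simp: torus_def)
    then show ?case unfolding mix_Suc by (intro minor_nonvanishing_line mix I) (use Suc in auto)
  qed
  from this[of d] have "flag_minor I (M (mix d)) \<noteq> 0" by simp
  moreover have "mix d = y" using x y by (auto simp: mix_def torus_def fun_eq_iff)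
  ultimately show ?thesis by simp
qed

lemma minor_zero_or_monomial:
  assumes I: "I \<subseteq> {..<n}"
  shows "(\<forall>x\<in>torus d. flag_minor I (M x) = 0) \<or>
    (\<exists>c m. c \<noteq> 0 \<and> m \<in> int_space d \<and> (\<forall>x\<in>torus d. flag_minor I (M x) = c * monomial d m x))"
proof (cases "\<forall>x\<in>torus d. flag_minor I (M x) = 0")
  case False
  then have nz: "flag_minor I (M x) \<noteq> 0" if "x \<in> torus d" for x
    using minor_nonvanishing[OF _ that I] by blast
  moreover have "(\<lambda>_. 1) \<in> torus d" by (simp add: torus_def)
  ultimately show ?thesis using unit_torus_monomial[OF minor_regular[OF I] nz] by blast
qed simp

lemma richardson_matroid_iff:
  "I \<in> richardson_matroid n v w k \<longleftrightarrow>
    I \<subseteq> {..<n} \<and> card I = k \<and> (\<exists>x\<in>torus d. flag_minor I (M x) \<noteq> 0)"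
proof -
  have 1: "\<exists>x\<in>torus d. flag_minor I (M x) \<noteq> 0"
    if I: "I \<subseteq> {..<n}" and A: "A \<in> SL n" "flag n A \<in> R" "flag_minor I A \<noteq> 0" for A
  proof -
    define x where "x = \<psi>inv (flag n A)"
    have x: "x \<in> torus d" "flag n A = flag n (M x)" using chart_inverse(1,2)[OF A(2)] flag_M by (auto simp: x_def)
    obtain c where "c \<noteq> 0" "flag_minor I (M x) = c * flag_minor I A"
      using flag_minor_same_flag[OF x(2) A(1) M_SL[OF x(1)] I] I by blast
    then show ?thesis using A(3) x(1) by (intro bexI[of _ x]) auto
  qed
  have 2: "\<exists>A\<in>SL n. flag n A \<in> R \<and> flag_minor I A \<noteq> 0"
    if "x \<in> torus d" "flag_minor I (M x) \<noteq> 0" for x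
    using that M_SL[OF that(1)] flag_M[OF that(1)] chart_inverse(4)[OF that(1)] by (intro bexI[of _ "M x"]) auto
  show ?thesis
    unfolding richardson_matroid_def using 1 2 by blast
qed

end

section \<open>Potentials on bipartite graphs\<close>
definition cyc_pred :: "nat \<Rightarrow> nat \<Rightarrow> nat" where
  "cyc_pred s q = (if q = 0 then s else q - 1)"

text \<open>The hypothesis \<open>cyc\<close> says that the alternating sum of \<open>e\<close> vanishes on induced cycles: in the cycle
  with rows \<open>i 0, \<dots>, i s\<close> and columns \<open>f 0, \<dots>, f s\<close> the row \<open>i q\<close> meets the columns \<open>f q\<close> and
  \<open>f (cyc_pred s q)\<close>.  A walk from \<open>l\<close> to \<open>l'\<close> through rows in \<open>F\<close> closes up through the new row \<open>j\<close>.  If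
  the claim fails, a walk of minimal length for which it fails closes up to an induced cycle,
  because a chord or another neighbour of \<open>j\<close> on the walk would give a shorter one.\<close>

lemma potential_consistent:
  fixes adj :: "'r \<Rightarrow> 'c \<Rightarrow> bool" and e :: "'r \<Rightarrow> 'c \<Rightarrow> 'g::ab_group_add"
  assumes cyc: "\<And>s f i. s \<ge> 1 \<Longrightarrow> inj_on f {..s} \<Longrightarrow> (\<forall>q\<le>s. i q \<in> insert j F) \<Longrightarrow>
      (\<forall>q\<le>s. \<forall>p\<le>s. adj (i q) (f p) \<longleftrightarrow> p = q \<or> p = cyc_pred s q) \<Longrightarrow>
      (\<Sum>q\<le>s. e (i q) (f q)) = (\<Sum>q\<le>s. e (i q) (f (cyc_pred s q)))"
    and h: "\<And>i l l'. i \<in> F \<Longrightarrow> adj i l \<Longrightarrow> adj i l' \<Longrightarrow> e i l + h l = e i l' + h l'"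
    and \<rho>: "\<And>l l'. \<rho> l l' \<longleftrightarrow> (\<exists>i\<in>F. adj i l \<and> adj i l')"
  shows "(\<rho> ^^ s) l l' \<Longrightarrow> adj j l \<Longrightarrow> adj j l' \<Longrightarrow> e j l + h l = e j l' + h l'"
proof (induction s arbitrary: l l' rule: less_induct)
  case (less s)
  show ?case
  proof (rule ccontr)
    assume neq: "e j l + h l \<noteq> e j l' + h l'"
    obtain f where f: "f 0 = l" "f s = l'" "\<And>q. q < s \<Longrightarrow> \<rho> (f q) (f (Suc q))"
      using less.prems(1) unfolding relpowp_fun_conv by blast
    have sub: "(\<rho> ^^ (b - a)) (f a) (f b)" if "a \<le> b" "b \<le> s" for a b
      unfolding relpowp_fun_conv
      by (rule exI[of _ "\<lambda>q. f (a + q)"]) (use that f(3) in auto)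
    (* less.IH rules out violating walks shorter than s, so this one admits no shortcut *)
    have short: False if ab: "a \<le> b" "b \<le> s" "(\<rho> ^^ c) (f a) (f b)" "c < b - a" for a b c
    proof -
      have "(\<rho> ^^ (a + (c + (s - b)))) l l'"
        unfolding relpowp_add using sub[of 0 a] sub[of b s] ab f(1,2) by (auto simp: relcompp_apply)
      moreover have "a + (c + (s - b)) < s" using ab by linarith
      ultimately show False using less.IH less.prems(2,3) neq by blast
    qed
    have inj: "inj_on f {..s}"
    proof (rule linorder_inj_onI)
      fix a b assume ab: "a < b" "a \<in> {..s}" "b \<in> {..s}"
      show "f a \<noteq> f b" using short[of a b 0] ab by auto
    qed auto
    have interior: "\<not> adj j (f p)" if "0 < p" "p < s" for p
    proof
      assume adj: "adj j (f p)"
      have "e j l + h l = e j (f p) + h (f p)"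
        using less.IH[of p l "f p"] sub[of 0 p] that f adj less.prems by simp
      also have "\<dots> = e j l' + h l'"
        using less.IH[of "s - p" "f p" l'] sub[of p s] that f adj less.prems by simp
      finally show False using neq by simp
    qed
    have "s \<noteq> 0"
    proof
      assume "s = 0"
      then have "l = l'" using f(1,2) by simp
      then show False using neq by simp
    qed
    then obtain s' where s': "s = Suc s'" by (cases s) auto
    have "\<forall>q. \<exists>i. q < s \<longrightarrow> i \<in> F \<and> adj i (f q) \<and> adj i (f (Suc q))" using f(3) \<rho> by blast
    then obtain r where r: "\<And>q. q < s \<Longrightarrow> r q \<in> F \<and> adj (r q) (f q) \<and> adj (r q) (f (Suc q))" by metis
    define i where "i q = (if q = 0 then j else r (q - 1))" for q
    have "(\<Sum>q\<le>s. e (i q) (f q)) = (\<Sum>q\<le>s. e (i q) (f (cyc_pred s q)))"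
    proof (rule cyc[OF _ inj])
      show "\<forall>q\<le>s. i q \<in> insert j F" using r by (auto simp: i_def)
      show "\<forall>q\<le>s. \<forall>p\<le>s. adj (i q) (f p) \<longleftrightarrow> p = q \<or> p = cyc_pred s q"
      proof (intro allI impI)
        fix q p assume q: "q \<le> s" and p: "p \<le> s"
        show "adj (i q) (f p) \<longleftrightarrow> p = q \<or> p = cyc_pred s q"
        proof (cases q)
          case 0
          then show ?thesis using interior[of p] p less.prems f by (cases "p = 0"; cases "p = s") (auto simp: i_def cyc_pred_def)
        next
          case (Suc q')
          then have rq: "r q' \<in> F" "adj (r q') (f q')" "adj (r q') (f q)" using r[of q'] q by auto
          have "p = q \<or> p = q'" if a: "adj (r q') (f p)"
          proof (rule ccontr)
            assume "\<not> (p = q \<or> p = q')"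
            then consider "p > q" | "p < q'" using Suc by linarith
            then show False
            proof cases
              case 1
              have W: "(\<rho> ^^ 1) (f q') (f p)" using rq a \<rho> by auto
              show False by (rule short[OF _ p W]) (use 1 Suc in linarith)+
            next
              case 2
              have W: "(\<rho> ^^ 1) (f p) (f q)" using rq a \<rho> by auto
              show False by (rule short[OF _ q W]) (use 2 Suc in linarith)+
            qed
          qed
          then show ?thesis using rq Suc by (auto simp: i_def cyc_pred_def)
        qed
      qed
    qed (use \<open>s \<noteq> 0\<close> in auto)
    then have "e j (f 0) + (\<Sum>q\<le>s'. e (r q) (f (Suc q))) = e j (f s) + (\<Sum>q\<le>s'. e (r q) (f q))"
      unfolding s' sum.atMost_Suc_shift by (simp add: i_def cyc_pred_def s')
    moreover define A where "A = (\<Sum>q\<le>s'. e (r q) (f q))"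
    moreover have "(\<Sum>q\<le>s'. e (r q) (f (Suc q))) = (\<Sum>q\<le>s'. e (r q) (f q) + (h (f q) - h (f (Suc q))))"
    proof (rule sum.cong[OF refl])
      fix q assume "q \<in> {..s'}"
      then show "e (r q) (f (Suc q)) = e (r q) (f q) + (h (f q) - h (f (Suc q)))"
        using h[of "r q" "f q" "f (Suc q)"] r[of q] s' by (simp add: algebra_simps)
    qed
    moreover have "\<dots> = A + (h (f 0) - h (f s))"
      unfolding sum.distrib s' A_def by (subst sum_telescope) simp
    ultimately have "e j (f 0) + (A + (h (f 0) - h (f s))) = e j (f s) + A" by simp
    then have "e j (f 0) + h (f 0) = e j (f s) + h (f s)" by (simp add: algebra_simps)
    then show False using neq f by simp
  qed
qed

text \<open>Rows are added one at a time, starting from the graph that has columns only.\<close>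

lemma exists_potential:
  fixes adj :: "'r \<Rightarrow> 'c \<Rightarrow> bool" and e :: "'r \<Rightarrow> 'c \<Rightarrow> 'g::ab_group_add"
  assumes fin: "finite S"
    and cyc: "\<And>s f i. s \<ge> 1 \<Longrightarrow> inj_on f {..s} \<Longrightarrow> (\<forall>q\<le>s. i q \<in> S) \<Longrightarrow>
      (\<forall>q\<le>s. \<forall>p\<le>s. adj (i q) (f p) \<longleftrightarrow> p = q \<or> p = cyc_pred s q) \<Longrightarrow>
      (\<Sum>q\<le>s. e (i q) (f q)) = (\<Sum>q\<le>s. e (i q) (f (cyc_pred s q)))"
  shows "\<exists>g h. \<forall>i\<in>S. \<forall>l. adj i l \<longrightarrow> e i l = g i - h l"
proof -
  have "\<exists>h. \<forall>i\<in>F. \<forall>l l'. adj i l \<longrightarrow> adj i l' \<longrightarrow> e i l + h l = e i l' + h l'"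
    if "finite F" "F \<subseteq> S" for F
    using that
  proof (induction F rule: finite_induct)
    case (insert j F)
    then obtain h where h: "\<And>i l l'. i \<in> F \<Longrightarrow> adj i l \<Longrightarrow> adj i l' \<Longrightarrow> e i l + h l = e i l' + h l'" by blast
    define \<rho> where "\<rho> l l' \<longleftrightarrow> (\<exists>i\<in>F. adj i l \<and> adj i l')" for l l'
    have sym: "\<rho> l l' \<Longrightarrow> \<rho> l' l" for l l' by (auto simp: \<rho>_def)
    have cons: "e j l + h l = e j l' + h l'" if walk: "\<rho>\<^sup>*\<^sup>* l l'" and adj: "adj j l" "adj j l'" for l l'
    proof -
      obtain s where "(\<rho> ^^ s) l l'" using walk unfolding rtranclp_power by blast
      show ?thesis
      proof (rule potential_consistent[where F = F and s = s, OF _ h \<rho>_def \<open>(\<rho> ^^ s) l l'\<close> adj])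
        fix t :: nat and f i
        assume as: "t \<ge> 1" "inj_on f {..t}" "\<forall>q\<le>t. i q \<in> insert j F"
          "\<forall>q\<le>t. \<forall>p\<le>t. adj (i q) (f p) \<longleftrightarrow> p = q \<or> p = cyc_pred t q"
        show "(\<Sum>q\<le>t. e (i q) (f q)) = (\<Sum>q\<le>t. e (i q) (f (cyc_pred t q)))"
          by (rule cyc[OF as(1,2) _ as(4)]) (use as(3) insert.prems in blast)
      qed
    qed
    (* shifting h on each component meeting the new row normalises that row to potential 0 *)
    define sh where "sh c = (if \<exists>l. \<rho>\<^sup>*\<^sup>* c l \<and> adj j l
      then (let l = SOME l. \<rho>\<^sup>*\<^sup>* c l \<and> adj j l in e j l + h l) else 0)" for c
    have sh_const: "sh l = sh l'" if "\<rho> l l'" for l l'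
    proof -
      have "\<rho>\<^sup>*\<^sup>* l = \<rho>\<^sup>*\<^sup>* l'"
        using that sym[OF that] by (intro ext iffI) (meson converse_rtranclp_into_rtranclp)+
      then show ?thesis by (simp only: sh_def)
    qed
    have sh_j: "sh l = e j l + h l" if l: "adj j l" for l
    proof -
      have ex: "\<exists>m. \<rho>\<^sup>*\<^sup>* l m \<and> adj j m" by (rule exI[of _ l]) (simp add: l)
      define m where "m = (SOME m. \<rho>\<^sup>*\<^sup>* l m \<and> adj j m)"
      have "sh l = e j m + h m" using ex by (simp add: sh_def m_def Let_def)
      also have "\<dots> = e j l + h l"
        using someI_ex[OF ex] cons[of l m] l unfolding m_def by metis
      finally show ?thesis .
    qed
    have "e i l + (h l - sh l) = e i l' + (h l' - sh l')" if i: "i \<in> insert j F" and l: "adj i l" "adj i l'" for i l l'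
    proof (cases "i = j")
      case True
      then show ?thesis using sh_j l by simp
    next
      case False
      then have "i \<in> F" using i by simp
      then have "\<rho> l l'" using l by (auto simp: \<rho>_def)
      then show ?thesis using h[OF \<open>i \<in> F\<close> l] sh_const[of l l'] by (simp add: algebra_simps)
    qed
    then show ?case by (intro exI[of _ "\<lambda>l. h l - sh l"]) blast
  qed simp
  from this[OF fin order_refl]
obtain h where h: "\<And>i l l'. i \<in> S \<Longrightarrow> adj i l \<Longrightarrow> adj i l' \<Longrightarrow> e i l + h l = e i l' + h l'" by blast
  define g where "g i = (let l = SOME l. adj i l in e i l + h l)" for i
  have "e i l = g i - h l" if "i \<in> S" "adj i l" for i l
    using h[OF that(1) that(2) someI[of "adj i", OF that(2)]] by (simp add: g_def Let_def algebra_simps)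
  then show ?thesis by blast
qed

section \<open>Minors supported on a cycle\<close>

text \<open>A permutation with nonzero term in the Leibniz expansion fixes all rows off the cycle, and on the
  cycle each row chooses one of two neighbouring columns.  The choice at one row forces the choices
  at all others, so only the identity and the rotation of the cycle contribute.  The sign \<open>\<sigma>\<close> of the
  rotation does not depend on the matrix.\<close>

lemma det_cycle:
  fixes f :: "nat \<Rightarrow> nat"
  assumes s: "s \<ge> 1" and inj: "inj_on f {..s}" and fk: "f ` {..s} \<subseteq> {..<k}"
  shows "\<exists>\<sigma>::complex. \<sigma> \<noteq> 0 \<and> (\<forall>X\<in>carrier_mat k k.
    (\<forall>p<k. p \<notin> f ` {..s} \<longrightarrow> (\<forall>l<k. X $$ (p, l) = (if l = p then 1 else 0))) \<longrightarrow>
    (\<forall>q\<le>s. \<forall>p\<le>s. p \<noteq> q \<longrightarrow> p \<noteq> cyc_pred s q \<longrightarrow> X $$ (f q, f p) = 0) \<longrightarrow>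
    det X = (\<Prod>q\<le>s. X $$ (f q, f q)) + \<sigma> * (\<Prod>q\<le>s. X $$ (f q, f (cyc_pred s q))))"
proof -
  define c where "c l = (if l \<in> f ` {..s} then f (cyc_pred s (inv_into {..s} f l)) else l)" for l
  have c_f: "c (f q) = f (cyc_pred s q)" if "q \<le> s" for q
    using inv_into_f_f[OF inj, of q] that by (simp add: c_def)
  have c_out: "c l = l" if "l \<notin> f ` {..s}" for l using that by (simp add: c_def)
  have pred_le: "cyc_pred s q \<le> s" if "q \<le> s" for q using that by (auto simp: cyc_pred_def)
  have pred_inj: "q = q'" if "cyc_pred s q = cyc_pred s q'" "q \<le> s" "q' \<le> s" for q q'
    using that by (auto simp: cyc_pred_def split: if_splits)
  have "inj_on c {..<k}"
  proof (rule inj_onI)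
    fix l l' assume l: "l \<in> {..<k}" "l' \<in> {..<k}" "c l = c l'"
    show "l = l'"
    proof (cases "l \<in> f ` {..s} \<and> l' \<in> f ` {..s}")
      case True
      then obtain q q' where q: "q \<le> s" "q' \<le> s" "l = f q" "l' = f q'" by auto
      then have "cyc_pred s q = cyc_pred s q'"
        using l(3) c_f inj_onD[OF inj] pred_le by simp
      then show ?thesis using pred_inj q by blast
    next
      case False
      have "c x \<in> f ` {..s} \<longleftrightarrow> x \<in> f ` {..s}" for x using c_f c_out pred_le by fastforce
      then have "l \<notin> f ` {..s}" "l' \<notin> f ` {..s}" using False l(3) by metis+
      then show ?thesis using l(3) c_out by simp
    qed
  qed
  moreover have "c l \<in> {..<k}" if "l \<in> {..<k}" for l
  proof (cases "l \<in> f ` {..s}")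
    case True
    then obtain q where "q \<le> s" "l = f q" by auto
    then show ?thesis using fk pred_le[of q] by (auto simp: c_f)
  qed (use that c_out in simp)
  then have "c ` {..<k} \<subseteq> {..<k}" by blast
  ultimately have "bij_betw c {..<k} {..<k}" by (simp add: bij_betw_def endo_inj_surj)
  then have c_perm: "c permutes {0..<k}"
    using fk by (intro bij_imp_permutes) (auto simp: c_def atLeast0LessThan)
  have c_id: "c \<noteq> id"
  proof
    assume "c = id"
    then have "f 0 = f s" using c_f[of 0] by (simp add: cyc_pred_def)
    then show False using inj_onD[OF inj, of 0 s] s by simp
  qed
  have main: "det X = (\<Prod>q\<le>s. X $$ (f q, f q)) + signof c * (\<Prod>q\<le>s. X $$ (f q, f (cyc_pred s q)))"
    if X: "X \<in> carrier_mat k k"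
      and out: "\<And>p l. p < k \<Longrightarrow> p \<notin> f ` {..s} \<Longrightarrow> l < k \<Longrightarrow> X $$ (p, l) = (if l = p then 1 else 0)"
      and z: "\<And>q p. q \<le> s \<Longrightarrow> p \<le> s \<Longrightarrow> p \<noteq> q \<Longrightarrow> p \<noteq> cyc_pred s q \<Longrightarrow> X $$ (f q, f p) = 0"
    for X :: "complex mat"
  proof -
    have zero: "\<pi> \<in> {id, c}" if \<pi>: "\<pi> permutes {0..<k}" and nz: "(\<Prod>i=0..<k. X $$ (i, \<pi> i)) \<noteq> 0" for \<pi>
    proof -
      have X_nz: "X $$ (i, \<pi> i) \<noteq> 0" if "i < k" for i using nz that by (auto simp: prod_zero_iff)
      have lt: "\<pi> i < k" if "i < k" for i using permutes_in_image[OF \<pi>, of i] that by simp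
      have inj\<pi>: "\<pi> x = \<pi> y \<Longrightarrow> x = y" for x y using permutes_inj[OF \<pi>] by (auto dest: injD)
      have fq: "f q < k" if "q \<le> s" for q using fk that by auto
      have fixp: "\<pi> p = p" if "p \<notin> f ` {..s}" for p
      proof (cases "p < k")
        case True
        then show ?thesis using out[OF True that lt[OF True]] X_nz[OF True] by (auto split: if_splits)
      next
        case False
        then show ?thesis using permutes_not_in[OF \<pi>, of p] by simp
      qed
      have step: "\<pi> (f q) = f q \<or> \<pi> (f q) = f (cyc_pred s q)" if q: "q \<le> s" for q
      proof -
        have "\<pi> (f q) \<in> f ` {..s}"
        proof (rule ccontr)
          assume n: "\<pi> (f q) \<notin> f ` {..s}"
          then have "\<pi> (f q) = f q" using inj\<pi>[OF fixp[OF n]] by simp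
          then show False using n q by auto
        qed
        then obtain p where "p \<le> s" "\<pi> (f q) = f p" by auto
        then show ?thesis using z[OF q, of p] X_nz[OF fq[OF q]] by auto
      qed
      show ?thesis
      proof (cases "\<pi> (f 0) = f 0")
        case True
        have "\<pi> (f q) = f q" if "q \<le> s" for q
          using that
        proof (induction q)
          case 0 then show ?case using True by simp
        next
          case (Suc q)
          then have "\<pi> (f (Suc q)) \<noteq> f q"
            using inj\<pi>[of "f (Suc q)" "f q"] inj_onD[OF inj, of "Suc q" q] by auto
          then show ?case using step[of "Suc q"] Suc.prems by (simp add: cyc_pred_def)
        qed
        then have "\<pi> l = l" for l using fixp by (cases "l \<in> f ` {..s}") auto
        then have "\<pi> = id" by (simp add: fun_eq_iff)
        then show ?thesis by simp
      next
        case False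
        then have \<pi>0: "\<pi> (f 0) = f s" using step[of 0] by (simp add: cyc_pred_def)
        have down: "\<pi> (f (s - m)) = f (s - m - 1)" if "m < s" for m
          using that
        proof (induction m)
          case 0
          have "\<pi> (f s) \<noteq> f s"
            using \<pi>0 inj\<pi>[of "f 0" "f s"] inj_onD[OF inj, of 0 s] s by auto
          then show ?case using step[of s] s by (simp add: cyc_pred_def)
        next
          case (Suc m)
          then have m: "\<pi> (f (s - m)) = f (s - Suc m)" by simp
          have "\<pi> (f (s - Suc m)) \<noteq> f (s - Suc m)"
          proof
            assume "\<pi> (f (s - Suc m)) = f (s - Suc m)"
            then have "f (s - m) = f (s - Suc m)" using m inj\<pi> by metis
            then show False using inj_onD[OF inj, of "s - m" "s - Suc m"] Suc.prems by simp
          qed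
          then show ?case using step[of "s - Suc m"] Suc.prems by (simp add: cyc_pred_def)
        qed
        have "\<pi> (f q) = f (cyc_pred s q)" if "q \<le> s" for q
          using down[of "s - q"] \<pi>0 that by (cases "q = 0") (auto simp: cyc_pred_def)
        then have "\<pi> l = c l" for l
          using fixp c_f c_out by (cases "l \<in> f ` {..s}") auto
        then show ?thesis by (simp add: fun_eq_iff)
      qed
    qed
    have prod: "(\<Prod>i=0..<k. X $$ (i, g i)) = (\<Prod>q\<le>s. X $$ (f q, g (f q)))"
      if "\<And>l. l \<notin> f ` {..s} \<Longrightarrow> g l = l" for g
    proof -
      have "(\<Prod>i=0..<k. X $$ (i, g i)) = (\<Prod>i\<in>f ` {..s}. X $$ (i, g i))"
        by (rule prod.mono_neutral_right) (use fk out that in \<open>auto simp: atLeast0LessThan\<close>)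
      also have "\<dots> = (\<Prod>q\<le>s. X $$ (f q, g (f q)))" by (simp add: prod.reindex[OF inj])
      finally show ?thesis .
    qed
    have "det X = (\<Sum>\<pi>\<in>{\<pi>. \<pi> permutes {0..<k}}. signof \<pi> * (\<Prod>i=0..<k. X $$ (i, \<pi> i)))"
      by (rule det_def'[OF X])
    also have "\<dots> = (\<Sum>\<pi>\<in>{id, c}. signof \<pi> * (\<Prod>i=0..<k. X $$ (i, \<pi> i)))"
    proof (rule sum.mono_neutral_right)
      show "\<forall>\<pi>\<in>{\<pi>. \<pi> permutes {0..<k}} - {id, c}. signof \<pi> * (\<Prod>i=0..<k. X $$ (i, \<pi> i)) = 0"
        using zero by auto
    qed (use c_perm permutes_id finite_permutations in auto)
    also have "\<dots> = (\<Prod>i=0..<k. X $$ (i, id i)) + signof c * (\<Prod>i=0..<k. X $$ (i, c i))"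
      using c_id by (simp add: sign_id)
    also have "(\<Prod>i=0..<k. X $$ (i, id i)) = (\<Prod>q\<le>s. X $$ (f q, f q))"
      by (subst prod) auto
    also have "(\<Prod>i=0..<k. X $$ (i, c i)) = (\<Prod>q\<le>s. X $$ (f q, f (cyc_pred s q)))"
      by (subst prod) (auto simp: c_out c_f)
    finally show ?thesis .
  qed
  show ?thesis
    by (rule exI[of _ "signof c"]) (use main in \<open>auto simp: sign_def\<close>)
qed

text \<open>After right multiplication by the inverse of the base rows, the entries of the matrix become
  quotients of minors by Cramer's rule.\<close>

lemma rowdet_relative:
  assumes nz: "rowdet A k \<beta> \<noteq> 0"
  shows "rowdet A k r = det (mat k k (\<lambda>(p, l). rowdet A k (\<beta>(l := r p)) / rowdet A k \<beta>)) * rowdet A k \<beta>"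
proof -
  define N where "N = mat k k (\<lambda>(i, j). A $$ (\<beta> i, j))"
  have N: "N \<in> carrier_mat k k" and dN: "det N = rowdet A k \<beta>" by (simp_all add: N_def rowdet_def)
  obtain Ni where Ni: "Ni \<in> carrier_mat k k" "Ni * N = 1\<^sub>m k"
    using det_non_zero_imp_unit[OF N, of "()"] nz dN by (auto simp: Units_def ring_mat_def)
  define Q where "Q = mat k k (\<lambda>(i, j). A $$ (r i, j))"
  have Q: "Q \<in> carrier_mat k k" by (simp add: Q_def)
  define P where "P = Q * Ni"
  have P: "P \<in> carrier_mat k k" using Q Ni by (simp add: P_def)
  have PN: "P * N = Q" unfolding P_def assoc_mult_mat[OF Q Ni(1) N] Ni(2) using Q by simp
  have entry: "P $$ (p, l) = rowdet A k (\<beta>(l := r p)) / rowdet A k \<beta>" if p: "p < k" and l: "l < k" for p l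
  proof -
    define x where "x = row P p"
    have x: "x \<in> carrier_vec k" unfolding x_def by (rule row_carrier_vec[OF p P])
    have NT: "N\<^sup>T \<in> carrier_mat k k" using N by simp
    have Nx: "(N\<^sup>T *\<^sub>v x) $ j = A $$ (r p, j)" if "j < k" for j
    proof -
      have "(N\<^sup>T *\<^sub>v x) $ j = (P * N) $$ (p, j)"
        using that N P p unfolding x_def by (simp add: comm_scalar_prod[of "col N j" k])
      then show ?thesis using that p by (simp add: PN Q_def)
    qed
    have "replace_col N\<^sup>T (N\<^sup>T *\<^sub>v x) l = (mat k k (\<lambda>(i, j). A $$ ((\<beta>(l := r p)) i, j)))\<^sup>T"
      by (rule eq_matI) (use N Nx in \<open>auto simp: replace_col_def N_def\<close>)
    then have "det (replace_col N\<^sup>T (N\<^sup>T *\<^sub>v x) l) = rowdet A k (\<beta>(l := r p))"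
      unfolding rowdet_def by (simp only: det_transpose[OF mat_carrier])
    then have "rowdet A k (\<beta>(l := r p)) = x $ l * rowdet A k \<beta>"
      using cramer_lemma_mat[OF NT x l] det_transpose[OF N] dN by simp
    then show ?thesis using nz p l P by (simp add: x_def)
  qed
  have "P = mat k k (\<lambda>(p, l). rowdet A k (\<beta>(l := r p)) / rowdet A k \<beta>)"
    by (rule eq_matI) (use P entry in auto)
  then show ?thesis using det_mult[OF P N] PN dN by (simp add: rowdet_def Q_def)
qed

lemma rowdet_base_update:
  assumes "p < k" "l < k" "rowdet A k \<beta> \<noteq> 0"
  shows "rowdet A k (\<beta>(l := \<beta> p)) / rowdet A k \<beta> = (if l = p then 1 else 0)"
proof (cases "l = p")
  case False
  then have "(\<beta>(l := \<beta> p)) l = (\<beta>(l := \<beta> p)) p" by simp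
  then have "\<not> inj_on (\<beta>(l := \<beta> p)) {..<k}"
    using inj_onD[of "\<beta>(l := \<beta> p)" "{..<k}" l p] assms False by blast
  then show ?thesis using rowdet_not_inj False by simp
qed (use assms in simp)

section \<open>Laurent monomials\<close>

lemma sum_fun_apply: "(\<Sum>q\<in>S. F q) i = (\<Sum>q\<in>S. F q i)"
  for F :: "'q \<Rightarrow> 'a \<Rightarrow> 'b::comm_monoid_add"
  by (induction S rule: infinite_finite_induct) auto

lemma monomial_nonzero: "x \<in> torus d \<Longrightarrow> monomial d m x \<noteq> 0"
  by (auto simp: monomial_def torus_def)

lemma monomial_zero [simp]: "monomial d 0 x = 1" by (simp add: monomial_def)

lemma monomial_add: "x \<in> torus d \<Longrightarrow> monomial d (m + m') x = monomial d m x * monomial d m' x"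
  unfolding monomial_def prod.distrib[symmetric]
  by (intro prod.cong) (auto simp: torus_def power_int_add)

lemma monomial_diff:
  assumes "x \<in> torus d"
  shows "monomial d (m - m') x = monomial d m x / monomial d m' x"
  using monomial_add[OF assms, of "m - m'" m'] monomial_nonzero[OF assms, of m'] by (simp add: field_simps)

lemma monomial_sum:
  "x \<in> torus d \<Longrightarrow> monomial d (\<Sum>q\<in>S. F q) x = (\<Prod>q\<in>S. monomial d (F q) x)"
  by (induction S rule: infinite_finite_induct) (auto simp: monomial_add)

lemma monomial_cong: "(\<And>i. i < d \<Longrightarrow> m i = m' i) \<Longrightarrow> monomial d m x = monomial d m' x"
  by (simp add: monomial_def)

text \<open>A weak form of the linear independence of characters, with \<open>c3 = 0\<close> allowed.  It suffices to
  evaluate at the points \<open>1\<close>, \<open>2\<close> and \<open>4\<close> of a coordinate line.\<close>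

lemma two_monomials_merge:
  assumes c: "c1 \<noteq> 0" "c2 \<noteq> 0"
    and eq: "\<And>x. x \<in> torus d \<Longrightarrow> c1 * monomial d \<mu> x + c2 * monomial d \<nu> x = c3 * monomial d \<kappa> x"
    and i: "i < d"
  shows "\<mu> i = \<nu> i"
proof (rule ccontr)
  assume neq: "\<mu> i \<noteq> \<nu> i"
  define \<alpha> \<beta> \<gamma> where "\<alpha> = (2::complex) powi \<mu> i" and "\<beta> = (2::complex) powi \<nu> i" and "\<gamma> = (2::complex) powi \<kappa> i"
  have ne: "\<alpha> \<noteq> \<beta>" using neq two_powi_inject by (simp add: \<alpha>_def \<beta>_def)
  have mon: "monomial d m ((\<lambda>_. 1)(i := z)) = z powi m i" for m and z :: complex
  proof -
    have "monomial d m ((\<lambda>_. 1)(i := z)) = (\<Prod>j<d. if j = i then z powi m i else 1)"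
      unfolding monomial_def by (intro prod.cong) auto
    then show ?thesis using i by simp
  qed
  have pt: "c1 * z powi \<mu> i + c2 * z powi \<nu> i = c3 * z powi \<kappa> i" if "z \<noteq> 0" for z :: complex
    using eq[of "(\<lambda>_. 1)(i := z)"] that i by (simp add: mon torus_def)
  have sq: "(2 * 2::complex) powi m = 2 powi m * 2 powi m" for m by (rule power_int_mult_distrib)
  have 1: "c1 + c2 = c3" using pt[of 1] by simp
  have 2: "c1 * \<alpha> + c2 * \<beta> = c3 * \<gamma>" using pt[of 2] by (simp add: \<alpha>_def \<beta>_def \<gamma>_def)
  have 3: "c1 * (\<alpha> * \<alpha>) + c2 * (\<beta> * \<beta>) = c3 * (\<gamma> * \<gamma>)"
    using pt[of "2 * 2"] unfolding sq by (simp add: \<alpha>_def \<beta>_def \<gamma>_def)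
  have "c1 * (\<alpha> - \<gamma>) * (\<alpha> - \<beta>) =
      (c1 * (\<alpha> * \<alpha>) + c2 * (\<beta> * \<beta>)) - (\<beta> + \<gamma>) * (c1 * \<alpha> + c2 * \<beta>) + \<beta> * \<gamma> * (c1 + c2)"
    by (simp add: algebra_simps)
  also have "\<dots> = 0" unfolding 1 2 3 by (simp add: algebra_simps)
  finally have "c1 * (\<alpha> - \<gamma>) * (\<alpha> - \<beta>) = 0" .
  then have "\<alpha> = \<gamma>" using c(1) ne by simp
  then have "c2 * (\<beta> - \<alpha>) = 0" using 1 2 by (simp add: algebra_simps flip: 1)
  then show False using c(2) ne by simp
qed

lemma monomial_exponent_unique:
  assumes c: "c1 \<noteq> 0"
    and eq: "\<And>x. x \<in> torus d \<Longrightarrow> c1 * monomial d \<mu> x = c2 * monomial d \<nu> x" and i: "i < d"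
  shows "\<mu> i = \<nu> i"
proof (rule two_monomials_merge[OF c c _ i, of \<mu> \<nu> "c1 + c2" \<nu>])
  fix x assume "x \<in> torus d"
  from eq[OF this] show "c1 * monomial d \<mu> x + c1 * monomial d \<nu> x = (c1 + c2) * monomial d \<nu> x"
    by (simp add: algebra_simps)
qed

lemma exponent_eq:
  assumes c: "c \<noteq> 0" and f: "\<And>x. x \<in> torus d \<Longrightarrow> f x = c * monomial d m x"
  shows "exponent d f = (\<lambda>i. if i < d then m i else 0)"
  unfolding exponent_def
proof (rule the_equality)
  let ?m = "\<lambda>i. if i < d then m i else 0"
  have "monomial d ?m x = monomial d m x" for x by (rule monomial_cong) simp
  then show "?m \<in> int_space d \<and> (\<exists>c. c \<noteq> 0 \<and> (\<forall>x\<in>torus d. f x = c * monomial d ?m x))"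
    using c f by (auto simp: int_space_def)
  fix m' assume "m' \<in> int_space d \<and> (\<exists>c. c \<noteq> 0 \<and> (\<forall>x\<in>torus d. f x = c * monomial d m' x))"
  then obtain c' where m': "m' \<in> int_space d" "c' \<noteq> 0" "\<And>x. x \<in> torus d \<Longrightarrow> f x = c' * monomial d m' x" by blast
  have "m' i = m i" if "i < d" for i
    by (rule monomial_exponent_unique[OF m'(2) _ that, of m' c m]) (use f m'(3) in simp)
  then show "m' = ?m" using m'(1) by (auto simp: int_space_def fun_eq_iff)
qed

definition zero_or_monomial :: "nat \<Rightarrow> ((nat \<Rightarrow> complex) \<Rightarrow> complex) \<Rightarrow> bool" where
  "zero_or_monomial d f \<longleftrightarrow> (\<exists>c m. \<forall>x\<in>torus d. f x = c * monomial d m x)"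

lemma zero_or_monomial_divide:
  assumes "zero_or_monomial d f" "zero_or_monomial d g"
  shows "zero_or_monomial d (\<lambda>x. f x / g x)"
proof -
  obtain a m where 1: "\<And>x. x \<in> torus d \<Longrightarrow> f x = a * monomial d m x"
    using assms(1) unfolding zero_or_monomial_def by blast
  obtain b l where 2: "\<And>x. x \<in> torus d \<Longrightarrow> g x = b * monomial d l x"
    using assms(2) unfolding zero_or_monomial_def by blast
  show ?thesis unfolding zero_or_monomial_def
    by (intro exI[of _ "a / b"] exI[of _ "m - l"]) (simp add: 1 2 monomial_diff)
qed

lemma det_scale_rows_cols:
  "det (mat k k (\<lambda>(p, l). u p * y p l * z l :: complex)) = (\<Prod>p<k. u p) * (\<Prod>l<k. z l) * det (mat k k (\<lambda>(p, l). y p l))"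
proof -
  define Y where "Y = mat k k (\<lambda>(p, l). y p l)"
  have Y: "Y \<in> carrier_mat k k" by (simp add: Y_def)
  have "(dmat k u * Y * dmat k z) $$ (p, l) = u p * y p l * z l" if "p < k" "l < k" for p l
    using that by (simp only: mult_dmat_index[OF dmat_mult_carrier[OF Y]] dmat_mult_index[OF Y]) (simp add: Y_def)
  then have "mat k k (\<lambda>(p, l). u p * y p l * z l) = dmat k u * Y * dmat k z"
    by (intro eq_matI) (simp_all del: index_mult_mat(1))
  then have "det (mat k k (\<lambda>(p, l). u p * y p l * z l)) = det (dmat k u) * det Y * det (dmat k z)"
    using Y by (simp add: det_mult[OF dmat_mult_carrier[OF Y] dmat_carrier] det_mult[OF dmat_carrier Y])
  then show ?thesis by (simp add: Y_def det_dmat)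
qed

section \<open>Exponents of flag minors are affine\<close>

context richardson_torus_chart
begin

lemma rowdet_zero_or_monomial:
  assumes r: "\<And>p. p < k \<Longrightarrow> r p < n"
  shows "zero_or_monomial d (\<lambda>x. rowdet (M x) k r)"
proof (cases "inj_on r {..<k}")
  case True
  obtain s where s: "\<And>A. rowdet A k r = s * flag_minor (r ` {..<k}) A"
    using rowdet_eq_flag_minor[OF True] by blast
  have "r ` {..<k} \<subseteq> {..<n}" using r by auto
  then have "zero_or_monomial d (\<lambda>x. flag_minor (r ` {..<k}) (M x))"
    unfolding zero_or_monomial_def using minor_zero_or_monomial[of "r ` {..<k}"] by (metis mult_zero_left)
  then obtain c m where "\<And>x. x \<in> torus d \<Longrightarrow> flag_minor (r ` {..<k}) (M x) = c * monomial d m x"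
    unfolding zero_or_monomial_def by blast
  then show ?thesis unfolding zero_or_monomial_def s
    by (intro exI[of _ "s * c"] exI[of _ m]) simp
next
  case False
  then show ?thesis unfolding zero_or_monomial_def rowdet_not_inj[OF False]
    by (intro exI[of _ 0]) simp
qed

text \<open>In terms of the matrix \<open>\<alpha>\<close> normalised at the base rows \<open>\<beta>\<close>, potentials turn into monomial scalings
  of rows and columns: each entry is a constant times \<open>x\<^sup>g\<close> of its row divided by \<open>x\<^sup>h\<close> of its column.\<close>

lemma rowdet_monomials_affine:
  assumes \<beta>: "\<And>p. p < k \<Longrightarrow> \<beta> p < n" and nz: "\<And>x. x \<in> torus d \<Longrightarrow> rowdet (M x) k \<beta> \<noteq> 0"
  shows "\<exists>g b. \<forall>r. (\<forall>p<k. r p < n) \<longrightarrow>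
    (\<exists>K. \<forall>x\<in>torus d. rowdet (M x) k r = K * monomial d ((\<Sum>p<k. g (r p)) + b) x)"
proof -
  define \<alpha> where "\<alpha> x i l = rowdet (M x) k (\<beta>(l := i)) / rowdet (M x) k \<beta>" for x i l
  have \<alpha>_det: "det (mat k k (\<lambda>(p, l). \<alpha> x (r p) l)) = rowdet (M x) k r / rowdet (M x) k \<beta>"
    if "x \<in> torus d" for x r
    using rowdet_relative[OF nz[OF that], of r] nz[OF that] by (simp add: \<alpha>_def)
  have "\<exists>c m. \<forall>x\<in>torus d. \<alpha> x i l = c * monomial d m x" if "i < n" for i l
    using zero_or_monomial_divide[OF rowdet_zero_or_monomial rowdet_zero_or_monomial, of k "\<beta>(l := i)" k \<beta>] \<beta> that
    unfolding zero_or_monomial_def \<alpha>_def by simp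
  then obtain c e where ce: "\<And>i l x. i < n \<Longrightarrow> x \<in> torus d \<Longrightarrow> \<alpha> x i l = c i l * monomial d (e i l) x" by metis
  (* monomials ignore exponents from d on; setting these to 0 makes exponents of equal monomials equal *)
  define e' where "e' i l = (\<lambda>j. if j < d then e i l j else 0)" for i l
  have \<alpha>: "\<alpha> x i l = c i l * monomial d (e' i l) x" if "i < n" "x \<in> torus d" for x i l
  proof -
    have "monomial d (e' i l) x = monomial d (e i l) x" by (rule monomial_cong) (simp add: e'_def)
    then show ?thesis using ce[OF that] by simp
  qed
  define adj where "adj i l \<longleftrightarrow> l < k \<and> c i l \<noteq> 0" for i l
  have "\<exists>g h. \<forall>i\<in>{..<n}. \<forall>l. adj i l \<longrightarrow> e' i l = g i - h l"
  proof (rule exists_potential)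
    fix s :: nat and f i
    assume s: "s \<ge> 1" and inj: "inj_on f {..s}" and i: "\<forall>q\<le>s. i q \<in> {..<n}"
      and adj: "\<forall>q\<le>s. \<forall>p\<le>s. adj (i q) (f p) \<longleftrightarrow> p = q \<or> p = cyc_pred s q"
    have pred: "cyc_pred s q \<le> s" if "q \<le> s" for q using that by (auto simp: cyc_pred_def)
    have adj1: "adj (i q) (f q)" and adj2: "adj (i q) (f (cyc_pred s q))" if "q \<le> s" for q
      using adj[rule_format, OF that that] adj[rule_format, OF that pred[OF that]] by simp_all
    have adj3: "\<not> adj (i q) (f p)" if "q \<le> s" "p \<le> s" "p \<noteq> q" "p \<noteq> cyc_pred s q" for p q
      using adj[rule_format, OF that(1,2)] that(3,4) by simp
    have fk: "f ` {..s} \<subseteq> {..<k}" using adj1 unfolding adj_def by blast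
    obtain \<sigma> :: complex where \<sigma>: "\<sigma> \<noteq> 0" and det: "\<forall>X\<in>carrier_mat k k.
      (\<forall>p<k. p \<notin> f ` {..s} \<longrightarrow> (\<forall>l<k. X $$ (p, l) = (if l = p then 1 else 0))) \<longrightarrow>
      (\<forall>q\<le>s. \<forall>p\<le>s. p \<noteq> q \<longrightarrow> p \<noteq> cyc_pred s q \<longrightarrow> X $$ (f q, f p) = 0) \<longrightarrow>
      det X = (\<Prod>q\<le>s. X $$ (f q, f q)) + \<sigma> * (\<Prod>q\<le>s. X $$ (f q, f (cyc_pred s q)))"
      using det_cycle[OF s inj fk] by (elim exE conjE)
    (* replace the base rows on the cycle by the rows i q and keep the others *)
    define r where "r p = (if p \<in> f ` {..s} then i (inv_into {..s} f p) else \<beta> p)" for p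
    have r_f: "r (f q) = i q" if "q \<le> s" for q using inv_into_f_f[OF inj, of q] that by (simp add: r_def)
    have r_n: "r p < n" if "p < k" for p
    proof (cases "p \<in> f ` {..s}")
      case True
      then show ?thesis using i r_f by auto
    qed (use \<beta> that in \<open>simp add: r_def\<close>)
    define \<mu> where "\<mu> = (\<Sum>q\<le>s. e' (i q) (f q))"
    define \<nu> where "\<nu> = (\<Sum>q\<le>s. e' (i q) (f (cyc_pred s q)))"
    define c1 where "c1 = (\<Prod>q\<le>s. c (i q) (f q))"
    define c2 where "c2 = (\<Prod>q\<le>s. c (i q) (f (cyc_pred s q)))"
    have nz12: "c1 \<noteq> 0" "c2 \<noteq> 0" using adj1 adj2 by (simp_all add: c1_def c2_def adj_def)
    have "zero_or_monomial d (\<lambda>x. rowdet (M x) k r / rowdet (M x) k \<beta>)"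
      by (intro zero_or_monomial_divide rowdet_zero_or_monomial r_n \<beta>)
    then obtain c3 \<kappa> where c3: "\<And>x. x \<in> torus d \<Longrightarrow> rowdet (M x) k r / rowdet (M x) k \<beta> = c3 * monomial d \<kappa> x"
      unfolding zero_or_monomial_def by blast
    have two: "c1 * monomial d \<mu> x + (\<sigma> * c2) * monomial d \<nu> x = c3 * monomial d \<kappa> x" if x: "x \<in> torus d" for x
    proof -
      define X where "X = mat k k (\<lambda>(p, l). \<alpha> x (r p) l)"
      have Xi: "X $$ (f q, f p) = c (i q) (f p) * monomial d (e' (i q) (f p)) x" if "q \<le> s" "p \<le> s" for p q
        using that fk i by (auto simp: X_def r_f \<alpha>[OF _ x] image_subset_iff)
      have "det X = (\<Prod>q\<le>s. X $$ (f q, f q)) + \<sigma> * (\<Prod>q\<le>s. X $$ (f q, f (cyc_pred s q)))"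
      proof (rule det[THEN bspec, THEN mp, THEN mp])
        show "\<forall>p<k. p \<notin> f ` {..s} \<longrightarrow> (\<forall>l<k. X $$ (p, l) = (if l = p then 1 else 0))"
          using rowdet_base_update[OF _ _ nz[OF x]] by (simp add: X_def r_def \<alpha>_def)
        show "\<forall>q\<le>s. \<forall>p\<le>s. p \<noteq> q \<longrightarrow> p \<noteq> cyc_pred s q \<longrightarrow> X $$ (f q, f p) = 0"
        proof (intro allI impI)
          fix q p assume q: "q \<le> s" and p: "p \<le> s" and ne: "p \<noteq> q" "p \<noteq> cyc_pred s q"
          have "f p < k" using fk p by auto
          then have "c (i q) (f p) = 0" using adj3[OF q p ne] by (simp add: adj_def)
          then show "X $$ (f q, f p) = 0" using Xi[OF q p] by simp
        qed
      qed (simp add: X_def)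
      also have "(\<Prod>q\<le>s. X $$ (f q, f q)) = c1 * monomial d \<mu> x"
        by (simp add: Xi c1_def \<mu>_def monomial_sum[OF x] prod.distrib)
      also have "(\<Prod>q\<le>s. X $$ (f q, f (cyc_pred s q))) = c2 * monomial d \<nu> x"
        by (simp add: Xi pred c2_def \<nu>_def monomial_sum[OF x] prod.distrib)
      finally show ?thesis using \<alpha>_det[OF x, of r] c3[OF x] by (simp add: X_def)
    qed
    have "\<mu> j = \<nu> j" for j
    proof (cases "j < d")
      case True
      then show ?thesis using two_monomials_merge[OF nz12(1) _ two] nz12(2) \<sigma> by simp
    next
      case False
      then show ?thesis by (simp add: \<mu>_def \<nu>_def sum_fun_apply e'_def)
    qed
    then show "(\<Sum>q\<le>s. e' (i q) (f q)) = (\<Sum>q\<le>s. e' (i q) (f (cyc_pred s q)))"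
      by (simp add: fun_eq_iff \<mu>_def \<nu>_def)
  qed simp
  then obtain g h where gh: "\<And>i l. i < n \<Longrightarrow> adj i l \<Longrightarrow> e' i l = g i - h l" by auto
  obtain c\<beta> m\<beta> where m\<beta>: "\<And>x. x \<in> torus d \<Longrightarrow> rowdet (M x) k \<beta> = c\<beta> * monomial d m\<beta> x"
    using rowdet_zero_or_monomial[of k \<beta>, OF \<beta>] unfolding zero_or_monomial_def by blast
  define b where "b = m\<beta> - (\<Sum>l<k. h l)"
  have "\<exists>K. \<forall>x\<in>torus d. rowdet (M x) k r = K * monomial d ((\<Sum>p<k. g (r p)) + b) x"
    if r: "\<forall>p<k. r p < n" for r
  proof -
    note r = r[rule_format]
    define K where "K = det (mat k k (\<lambda>(p, l). c (r p) l)) * c\<beta>"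
    have "rowdet (M x) k r = K * monomial d ((\<Sum>p<k. g (r p)) + b) x" if x: "x \<in> torus d" for x
    proof -
      have ent: "\<alpha> x (r p) l = monomial d (g (r p)) x * c (r p) l * (1 / monomial d (h l) x)"
        if "p < k" "l < k" for p l
      proof (cases "c (r p) l = 0")
        case True
        then show ?thesis using \<alpha>[OF r[OF that(1)] x, of l] by simp
      next
        case False
        then show ?thesis using \<alpha>[OF r[OF that(1)] x, of l] gh[OF r[OF that(1)], of l] that
          by (simp add: adj_def monomial_diff[OF x])
      qed
      have "mat k k (\<lambda>(p, l). \<alpha> x (r p) l) =
          mat k k (\<lambda>(p, l). monomial d (g (r p)) x * c (r p) l * (1 / monomial d (h l) x))"
        by (rule cong_mat) (auto simp: ent)
      then have "rowdet (M x) k r / rowdet (M x) k \<beta> =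
          (\<Prod>p<k. monomial d (g (r p)) x) * (\<Prod>l<k. 1 / monomial d (h l) x) * det (mat k k (\<lambda>(p, l). c (r p) l))"
        using \<alpha>_det[OF x, of r] det_scale_rows_cols[of k "\<lambda>p. monomial d (g (r p)) x" "\<lambda>p l. c (r p) l" "\<lambda>l. 1 / monomial d (h l) x"]
        by simp
      then have "rowdet (M x) k r = (\<Prod>p<k. monomial d (g (r p)) x) * (\<Prod>l<k. 1 / monomial d (h l) x) *
          det (mat k k (\<lambda>(p, l). c (r p) l)) * (c\<beta> * monomial d m\<beta> x)"
        using nz[OF x] m\<beta>[OF x] by (metis nonzero_eq_divide_eq)
      then show ?thesis
        by (simp add: K_def b_def monomial_add[OF x] monomial_diff[OF x] monomial_sum[OF x] prod_dividef)
    qed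
    then show ?thesis by blast
  qed
  then show ?thesis by (intro exI[of _ g] exI[of _ b]) blast
qed

theorem minor_exponents_affine:
  shows "\<exists>(g :: nat \<Rightarrow> nat \<Rightarrow> int) b. \<forall>I\<in>richardson_matroid n v w k. \<forall>i.
    exponent d (\<lambda>x. flag_minor I (M x)) i = (if i < d then (\<Sum>j\<in>I. g j i) + b i else 0)"
proof (cases "richardson_matroid n v w k = {}")
  case False
  then obtain B where B: "B \<in> richardson_matroid n v w k" by blast
  have enum: "(\<forall>p<k. sorted_list_of_set I ! p < n) \<and> bij_betw (\<lambda>p. sorted_list_of_set I ! p) {..<k} I"
    if "I \<in> richardson_matroid n v w k" for I
  proof -
    have I: "I \<subseteq> {..<n}" "card I = k" using that by (auto simp: richardson_matroid_def)
    have "finite I" using I(1) finite_subset by blast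
    then have "bij_betw (\<lambda>p. sorted_list_of_set I ! p) {..<k} I" by (intro bij_betw_nth) (auto simp: I)
    then show ?thesis using I(1) by (auto simp: bij_betw_def)
  qed
  have nz: "rowdet (M x) k (\<lambda>p. sorted_list_of_set I ! p) \<noteq> 0"
    if "I \<in> richardson_matroid n v w k" "x \<in> torus d" for I x
    using that minor_nonvanishing[OF _ that(2), of _ I]
    unfolding richardson_matroid_iff flag_minor_rowdet by blast
  obtain g b where gb: "\<And>r. (\<forall>p<k. r p < n) \<Longrightarrow>
      \<exists>K. \<forall>x\<in>torus d. rowdet (M x) k r = K * monomial d ((\<Sum>p<k. g (r p)) + b) x"
    using rowdet_monomials_affine[of k "\<lambda>p. sorted_list_of_set B ! p"] enum[OF B] nz[OF B] by blast
  have "exponent d (\<lambda>x. flag_minor I (M x)) i = (if i < d then (\<Sum>j\<in>I. g j i) + b i else 0)"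
    if I: "I \<in> richardson_matroid n v w k" for I i
  proof -
    define r where "r p = sorted_list_of_set I ! p" for p
    have bij: "bij_betw r {..<k} I" and rn: "\<forall>p<k. r p < n" using enum[OF I] by (auto simp: r_def[abs_def])
    obtain K where K: "\<And>x. x \<in> torus d \<Longrightarrow> rowdet (M x) k r = K * monomial d ((\<Sum>p<k. g (r p)) + b) x"
      using gb[OF rn] by blast
    have one: "(\<lambda>_. 1) \<in> torus d" by (simp add: torus_def)
    have "K \<noteq> 0" using K[OF one] nz[OF I one] by (auto simp: r_def[abs_def])
    moreover have "flag_minor I (M x) = K * monomial d ((\<Sum>p<k. g (r p)) + b) x" if "x \<in> torus d" for x
      using K[OF that] I by (simp add: flag_minor_rowdet richardson_matroid_def r_def[abs_def])
    moreover have "(\<Sum>p<k. g (r p)) = (\<Sum>j\<in>I. g j)" by (rule sum.reindex_bij_betw[OF bij])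
    ultimately show ?thesis
      using exponent_eq[of K d "\<lambda>x. flag_minor I (M x)" "(\<Sum>j\<in>I. g j) + b"] by (simp add: sum_fun_apply)
  qed
  then show ?thesis by blast
qed simp

end

section \<open>Polytopes\<close>

definition affine_of :: "nat \<Rightarrow> nat \<Rightarrow> (nat \<Rightarrow> nat \<Rightarrow> int) \<Rightarrow> (nat \<Rightarrow> int) \<Rightarrow> (nat \<Rightarrow> real) \<Rightarrow> nat \<Rightarrow> real" where
  "affine_of n d g b x = (\<lambda>i. if i < d then (\<Sum>j<n. real_of_int (g j i) * x j) + real_of_int (b i) else 0)"

lemma affine_map_affine_of: "affine_map n d (affine_of n d g b)"
  unfolding affine_map_def affine_of_def
  by (intro exI[of _ "\<lambda>i j. real_of_int (g j i)"] exI[of _ "\<lambda>i. real_of_int (b i)"]) simp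

lemma convex_hull_affine_of: "affine_of n d g b ` (convex hull S) = convex hull (affine_of n d g b ` S)"
proof -
  define L where "L = affine_of n d g (\<lambda>_. 0)"
  define c where "c = (\<lambda>i. if i < d then real_of_int (b i) else 0)"
  have "linear L"
    by (rule linearI)
       (auto simp: L_def affine_of_def fun_eq_iff scaleR_fun_def distrib_left sum.distrib sum_distrib_left mult.left_commute)
  moreover have eq: "affine_of n d g b = (\<lambda>x. c + L x)"
    by (auto simp: L_def c_def affine_of_def fun_eq_iff)
  ultimately show ?thesis
    using convex_hull_linear_image[of L S] convex_hull_translation[of c "L ` S"]
    by (simp add: eq image_image[symmetric, of "\<lambda>x. c + x" L])
qed

lemma affine_of_indicator:
  assumes "I \<subseteq> {..<n}"
  shows "affine_of n d g b (indicator I) = (\<lambda>i. real_of_int (if i < d then (\<Sum>j\<in>I. g j i) + b i else 0))"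
proof -
  have "(\<Sum>j<n. real_of_int (g j i) * indicator I j) = (\<Sum>j\<in>I. real_of_int (g j i))" for i
    using assms by (simp add: indicator_def if_distrib[of "\<lambda>x. _ * x"] sum.If_cases Int_absorb1 cong: if_cong)
  then show ?thesis by (auto simp: affine_of_def fun_eq_iff)
qed

theorem theorem1p5:
  fixes n d :: nat
    and v w :: "nat \<Rightarrow> nat"
    and \<psi> :: "(nat \<Rightarrow> complex) \<Rightarrow> complex mat set"
    and M :: "(nat \<Rightarrow> complex) \<Rightarrow> complex mat"
  assumes "n \<ge> 1"
    and "bruhat_le n v w"
    and "toric n (closed_richardson n v w)"
    and "d = perm_length n w - perm_length n v"
    and "richardson_torus n v w d \<psi>"
    and "regular_representatives n d \<psi> M"
  shows "\<exists>\<phi>. (\<forall>k\<in>{1..n-1}. affine_map n d (\<phi> k)) \<and>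
           moment_polytope n v w d M = (\<Sum>k=1..n-1. \<phi> k ` positroid_polytope n v w k)"
proof -
  interpret richardson_torus_chart n d v w \<psi> M
    using assms(5,6) by unfold_locales
  define m where "m I = exponent d (\<lambda>x. flag_minor I (M x))" for I
  obtain g b where gb: "\<And>k I i. I \<in> richardson_matroid n v w k \<Longrightarrow>
      m I i = (if i < d then (\<Sum>j\<in>I. g k j i) + b k i else (0::int))"
    using minor_exponents_affine unfolding m_def by metis
  define \<phi> where "\<phi> k = affine_of n d (g k) (b k)" for k
  define V where "V k = {\<lambda>i. real_of_int (m I i) |I. I \<in> richardson_matroid n v w k}" for k
  have image: "\<phi> k ` positroid_polytope n v w k = convex hull (V k)" for k
  proof -
    have "\<phi> k (indicator I) = (\<lambda>i. real_of_int (m I i))" if I: "I \<in> richardson_matroid n v w k" for I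
      using affine_of_indicator[of I n d "g k" "b k"] gb[OF I] I
      by (simp add: \<phi>_def richardson_matroid_def)
    then have "\<phi> k ` {indicator I |I. I \<in> richardson_matroid n v w k} = V k"
      unfolding V_def by (auto simp: image_iff) metis+
    then show ?thesis
      unfolding positroid_polytope_def \<phi>_def convex_hull_affine_of by simp
  qed
  have "{(\<lambda>i. \<Sum>k=1..n-1. real_of_int (m (I k) i)) |I. \<forall>k\<in>{1..n-1}. I k \<in> richardson_matroid n v w k} =
      (\<Sum>k=1..n-1. V k)"
  proof -
    have "(\<Sum>k=1..n-1. V k) = {\<Sum>k=1..n-1. s k |s. \<forall>k\<in>{1..n-1}. s k \<in> V k}"
      by (rule set_sum_alt) simp
    also have "\<dots> = {\<Sum>k=1..n-1. (\<lambda>i. real_of_int (m (I k) i)) |I. \<forall>k\<in>{1..n-1}. I k \<in> richardson_matroid n v w k}"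
    proof (intro equalityI subsetI)
      fix y assume "y \<in> {\<Sum>k=1..n-1. s k |s. \<forall>k\<in>{1..n-1}. s k \<in> V k}"
      then obtain s where s: "y = (\<Sum>k=1..n-1. s k)" "\<forall>k\<in>{1..n-1}. s k \<in> V k" by blast
      then have "\<forall>k\<in>{1..n-1}. \<exists>I. I \<in> richardson_matroid n v w k \<and> s k = (\<lambda>i. real_of_int (m I i))"
        unfolding V_def by blast
      then obtain I where I: "\<forall>k\<in>{1..n-1}. I k \<in> richardson_matroid n v w k \<and> s k = (\<lambda>i. real_of_int (m (I k) i))"
        by metis
      then have "y = (\<Sum>k=1..n-1. (\<lambda>i. real_of_int (m (I k) i)))"
        unfolding s(1) by (intro sum.cong) auto
      then show "y \<in> {\<Sum>k=1..n-1. (\<lambda>i. real_of_int (m (I k) i)) |I. \<forall>k\<in>{1..n-1}. I k \<in> richardson_matroid n v w k}"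
        using I by blast
    next
      fix y assume "y \<in> {\<Sum>k=1..n-1. (\<lambda>i. real_of_int (m (I k) i)) |I. \<forall>k\<in>{1..n-1}. I k \<in> richardson_matroid n v w k}"
      then show "y \<in> {\<Sum>k=1..n-1. s k |s. \<forall>k\<in>{1..n-1}. s k \<in> V k}"
        unfolding V_def by blast
    qed
    moreover have "(\<Sum>k=1..n-1. (\<lambda>i. real_of_int (m (I k) i))) = (\<lambda>i. \<Sum>k=1..n-1. real_of_int (m (I k) i))" for I
      by (simp add: fun_eq_iff sum_fun_apply)
    ultimately show ?thesis by simp
  qed
  then have "moment_polytope n v w d M = (\<Sum>k=1..n-1. \<phi> k ` positroid_polytope n v w k)"
    unfolding moment_polytope_def m_def[symmetric] image by (simp only: convex_hull_set_sum)
  moreover have "\<forall>k\<in>{1..n-1}. affine_map n d (\<phi> k)"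
    by (simp add: \<phi>_def affine_map_affine_of)
  ultimately show ?thesis by blast
qed

end
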